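(* Let $\delta\geq 3$ be an integer. Counted up to permutations of rows and permutations of columns, there are exactly $\phi(\delta)$ exponent matrices of monomial Cremona transformations of $\mathbb{P}^2$ with multidegree $(1,\delta,1)$, where $\phi$ is Euler's totient function.
   Context: Work over a fixed algebraically closed field, with homogeneous coordinates $(x:y:z)$ on $\mathbb{P}^2$. A monomial rational map $\varphi:\mathbb{P}^2\dashrightarrow\mathbb{P}^2$ is a map of the form $(x:y:z)\mapsto(x^{a_{11}}y^{a_{12}}z^{a_{13}}:x^{a_{21}}y^{a_{22}}z^{a_{23}}:x^{a_{31}}y^{a_{32}}z^{a_{33}})$ with nonnegative integer exponents and all three monomials of the same total degree $\delta$. Its exponent matrix is $M_\varphi=(a_{ij})$, so every row sums to $\delta$. All monomial maps are assumed to be in reduced form: the three monomials share no common factor, i.e. every column of $M_\varphi$ contains a $0$. A Cremona transformation is a birational map $\mathbb{P}^2\dashrightarrow\mathbb{P}^2$. The multidegree of $\varphi$ is the triple $(\gamma_0,\gamma_1,\gamma_2)$ defined by $[\Gamma(\varphi)]=\gamma_0h_2^2+\gamma_1h_1h_2+\gamma_2h_1^2$ in the Chow ring of $\mathbb{P}^2\times\mathbb{P}^2$, where $\Gamma(\varphi)$ is the closure of the graph of $\varphi$ and $h_1,h_2$ are the pullbacks of the hyperplane class via the first and second projections. Two exponent matrices are counted as the same here if one is obtained from the other by permuting rows and permuting columns (independently). *)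

theory Defs
  imports
    "HOL-Analysis.Finite_Cartesian_Product"
    "HOL-Computational_Algebra.Polynomial"
    "HOL-Algebra.Ideal"
    "HOL-Algebra.Free_Abelian_Groups"
    "HOL-Decision_Procs.Algebra_Aux"
    "HOL-Combinatorics.Permutations"
    "HOL-Number_Theory.Totient"
    "HOL-Library.Extended_Nat"
begin

section \<open>Polynomials\<close>

type_synonym ('v, 'k) mpoly = "('v \<Rightarrow>\<^sub>0 nat) \<Rightarrow>\<^sub>0 'k"

definition Var :: "'v \<Rightarrow> ('v, 'k::comm_ring_1) mpoly" where
  "Var i = Poly_Mapping.single (Poly_Mapping.single i 1) 1"

definition peval :: "('v::finite, 'k::comm_ring_1) mpoly \<Rightarrow> ('v \<Rightarrow> 'k) \<Rightarrow> 'k" where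
  "peval f u = (\<Sum>m\<in>Poly_Mapping.keys f.
     Poly_Mapping.lookup f m * (\<Prod>i\<in>UNIV. u i ^ Poly_Mapping.lookup m i))"

text \<open>As usual, \<open>0\<close> is homogeneous of every degree.\<close>

definition homog :: "nat \<Rightarrow> ('v::finite, 'k::comm_ring_1) mpoly \<Rightarrow> bool" where
  "homog d f \<longleftrightarrow> (\<forall>m\<in>Poly_Mapping.keys f. (\<Sum>i\<in>UNIV. Poly_Mapping.lookup m i) = d)"


section \<open>Rational maps of the projective plane\<close>

text \<open>A rational map is given by three forms of equal degree, not all zero; it is defined
  (at least) where they do not all vanish.\<close>

definition rational_map :: "(3 \<Rightarrow> (3, 'k::field) mpoly) \<Rightarrow> bool" where
  "rational_map F \<longleftrightarrow> (\<exists>d. \<forall>i. homog d (F i)) \<and> (\<exists>i. F i \<noteq> 0)"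

definition pmap :: "(3 \<Rightarrow> (3, 'k::field) mpoly) \<Rightarrow> (3 \<Rightarrow> 'k) \<Rightarrow> (3 \<Rightarrow> 'k)" where
  "pmap F v = (\<lambda>i. peval (F i) v)"

text \<open>\<open>G \<circ> F\<close> is the identity as a rational map: on a nonempty open set \<open>h \<noteq> 0\<close> it sends
  every point to itself, in homogeneous coordinates up to a nonzero scalar.\<close>

definition rational_left_inverse ::
    "(3 \<Rightarrow> (3, 'k::field) mpoly) \<Rightarrow> (3 \<Rightarrow> (3, 'k) mpoly) \<Rightarrow> bool" where
  "rational_left_inverse G F \<longleftrightarrow>
     (\<exists>h. h \<noteq> 0 \<and>
       (\<forall>v. peval h v \<noteq> 0 \<longrightarrow> (\<exists>c. c \<noteq> 0 \<and> pmap G (pmap F v) = (\<lambda>i. c * v i))))"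

definition cremona :: "(3 \<Rightarrow> (3, 'k::field) mpoly) \<Rightarrow> bool" where
  "cremona F \<longleftrightarrow> rational_map F \<and>
     (\<exists>G. rational_map G \<and> rational_left_inverse G F \<and> rational_left_inverse F G)"


section \<open>Subvarieties of the product of two projective planes\<close>

text \<open>The bihomogeneous coordinate ring of \<open>P\<^sup>2 \<times> P\<^sup>2\<close> is the polynomial ring in the variables
  \<open>x\<^sub>i = Var (Inl i)\<close> and \<open>y\<^sub>j = Var (Inr j)\<close>.\<close>

type_synonym 'k bipoly = "(3 + 3, 'k) mpoly"

definition bihomog :: "nat \<Rightarrow> nat \<Rightarrow> 'k::field bipoly \<Rightarrow> bool" where
  "bihomog a b f \<longleftrightarrow> (\<forall>m\<in>Poly_Mapping.keys f.
     (\<Sum>i\<in>UNIV. Poly_Mapping.lookup m (Inl i)) = a \<and>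
     (\<Sum>j\<in>UNIV. Poly_Mapping.lookup m (Inr j)) = b)"

definition bihomog_ideal :: "'k::field bipoly set \<Rightarrow> bool" where
  "bihomog_ideal J \<longleftrightarrow> ideal J cring_class_ops \<and>
     J = genideal cring_class_ops {f \<in> J. \<exists>a b. bihomog a b f}"

text \<open>Subvarieties (integral closed subschemes) are represented by their ideals, the
  bihomogeneous primes containing neither irrelevant ideal.  Hence a smaller subvariety is a
  larger set.\<close>

definition subvariety :: "'k::field bipoly set \<Rightarrow> bool" where
  "subvariety P \<longleftrightarrow> primeideal P cring_class_ops \<and> bihomog_ideal P \<and>
     (\<exists>i. Var (Inl i) \<notin> P) \<and> (\<exists>j. Var (Inr j) \<notin> P)"

text \<open>Supremum of the lengths (numbers of strict inclusions) of finite chains in a family of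
  sets.\<close>

definition chain_length :: "'a set set \<Rightarrow> enat" where
  "chain_length C = Sup (enat ` {n. \<exists>c :: nat \<Rightarrow> 'a set.
     (\<forall>i\<le>n. c i \<in> C) \<and> (\<forall>i<n. c i \<subset> c (Suc i))})"

definition vdim :: "'k::field bipoly set \<Rightarrow> enat" where
  "vdim P = chain_length {Q. subvariety Q \<and> P \<subseteq> Q}"


section \<open>Orders of vanishing and the Chow group\<close>

text \<open>The ideals of the local ring of \<open>P\<^sup>2 \<times> P\<^sup>2\<close> along the subvariety \<open>Z\<close>.  That ring is the
  part of bidegree \<open>(0,0)\<close> of the localization of the coordinate ring at the bihomogeneous
  elements outside \<open>Z\<close>.  This localization has units in every bidegree, so contraction
  identifies the ideals of the local ring with the bihomogeneous ideals saturated with respect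
  to these elements.  The unit ideal is included.\<close>

definition local_ideals :: "'k::field bipoly set \<Rightarrow> 'k bipoly set set" where
  "local_ideals Z = {J. bihomog_ideal J \<and>
     (\<forall>s a. (\<exists>d e. bihomog d e s) \<and> s \<notin> Z \<and> s * a \<in> J \<longrightarrow> a \<in> J)}"

text \<open>The order along \<open>Z\<close> of a form \<open>f\<close> not vanishing identically on the subvariety \<open>V\<close>: the
  length of the quotient by \<open>f\<close> of the local ring of \<open>V\<close> along \<open>Z\<close>.  If \<open>Z\<close> is a divisor on
  \<open>V\<close>, this length is finite; it is \<open>0\<close> if \<open>Z\<close> does not lie on \<open>V\<close>.\<close>

definition ord_along :: "'k::field bipoly set \<Rightarrow> 'k bipoly set \<Rightarrow> 'k bipoly \<Rightarrow> int" where
  "ord_along V Z f = int (the_enat (chain_length {J \<in> local_ideals Z. V \<subseteq> J \<and> f \<in> J}))"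

definition cycle_group :: "nat \<Rightarrow> ('k::field bipoly set \<Rightarrow>\<^sub>0 int) monoid" where
  "cycle_group k = free_Abelian_group {Z. subvariety Z \<and> vdim Z = enat k}"

text \<open>The \<open>k\<close>-cycles of the form \<open>div (f / g)\<close>, for a nonzero rational function \<open>f / g\<close> on a
  subvariety \<open>V\<close> of dimension \<open>k + 1\<close>.\<close>

definition principal_cycles :: "nat \<Rightarrow> ('k::field bipoly set \<Rightarrow>\<^sub>0 int) set" where
  "principal_cycles k = {\<alpha> \<in> carrier (cycle_group k).
     \<exists>V f g a b. subvariety V \<and> vdim V = enat (k + 1) \<and>
       bihomog a b f \<and> bihomog a b g \<and> f \<notin> V \<and> g \<notin> V \<and>
       (\<forall>Z. subvariety Z \<and> vdim Z = enat k \<longrightarrow>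
          Poly_Mapping.lookup \<alpha> Z = ord_along V Z f - ord_along V Z g)}"

text \<open>The class of a cycle in the Chow group of \<open>k\<close>-cycles modulo rational equivalence,
  \<open>cycle_group k Mod generate (cycle_group k) (principal_cycles k)\<close>.\<close>

definition chow_class ::
    "nat \<Rightarrow> ('k::field bipoly set \<Rightarrow>\<^sub>0 int) \<Rightarrow> ('k bipoly set \<Rightarrow>\<^sub>0 int) set" where
  "chow_class k \<alpha> =
     generate (cycle_group k) (principal_cycles k) #>\<^bsub>cycle_group k\<^esub> \<alpha>"

definition coordinate_subvariety :: "3 set \<Rightarrow> 3 set \<Rightarrow> 'k::field bipoly set" where
  "coordinate_subvariety A B =
     genideal cring_class_ops ((\<lambda>i. Var (Inl i)) ` A \<union> (\<lambda>j. Var (Inr j)) ` B)"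


section \<open>Graphs and multidegrees\<close>

text \<open>The ideal of the closure of the graph of \<open>F\<close>, that is, of the polynomials vanishing at
  all homogeneous coordinates \<open>(v, c F(v))\<close> of points of the graph.\<close>

definition graph_closure :: "(3 \<Rightarrow> (3, 'k::field) mpoly) \<Rightarrow> 'k bipoly set" where
  "graph_closure F = {f. \<forall>v c. v \<noteq> (\<lambda>_. 0) \<and> pmap F v \<noteq> (\<lambda>_. 0) \<and> c \<noteq> 0 \<longrightarrow>
     peval f (case_sum v (\<lambda>i. c * pmap F v i)) = 0}"

text \<open>\<open>[\<Gamma>] = \<gamma>\<^sub>0 h\<^sub>2\<^sup>2 + \<gamma>\<^sub>1 h\<^sub>1 h\<^sub>2 + \<gamma>\<^sub>2 h\<^sub>1\<^sup>2\<close> in the group of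
  2-cycles modulo rational equivalence.  The products of hyperplane classes are represented by
  transversal intersections of coordinate hyperplanes: \<open>h\<^sub>2\<^sup>2\<close> by \<open>P\<^sup>2 \<times> point\<close>, \<open>h\<^sub>1 h\<^sub>2\<close> by
  \<open>line \<times> line\<close>, and \<open>h\<^sub>1\<^sup>2\<close> by \<open>point \<times> P\<^sup>2\<close>.\<close>

definition has_multidegree ::
    "(3 \<Rightarrow> (3, 'k::field) mpoly) \<Rightarrow> int \<times> int \<times> int \<Rightarrow> bool" where
  "has_multidegree F = (\<lambda>(\<gamma>\<^sub>0, \<gamma>\<^sub>1, \<gamma>\<^sub>2).
     chow_class 2 (frag_of (graph_closure F)) =
     chow_class 2
       (frag_cmul \<gamma>\<^sub>0 (frag_of (coordinate_subvariety {} {0, 1})) +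
        frag_cmul \<gamma>\<^sub>1 (frag_of (coordinate_subvariety {0} {0})) +
        frag_cmul \<gamma>\<^sub>2 (frag_of (coordinate_subvariety {0, 1} {}))))"


section \<open>Monomial maps\<close>

text \<open>Exponent matrices of monomial maps in reduced form.\<close>

definition exponent_matrix :: "nat^3^3 \<Rightarrow> bool" where
  "exponent_matrix A \<longleftrightarrow>
     (\<exists>d. \<forall>i. (\<Sum>j\<in>UNIV. A $ i $ j) = d) \<and> (\<forall>j. \<exists>i. A $ i $ j = 0)"

definition monomial_map :: "nat^3^3 \<Rightarrow> 3 \<Rightarrow> (3, 'k::field) mpoly" where
  "monomial_map A i = (\<Prod>j\<in>UNIV. Var j ^ (A $ i $ j))"

text \<open>The first argument selects the ground field.\<close>

definition monomial_cremona_matrices ::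
    "'k::field itself \<Rightarrow> int \<times> int \<times> int \<Rightarrow> (nat^3^3) set" where
  "monomial_cremona_matrices _ \<gamma> = {A. exponent_matrix A \<and>
     cremona (monomial_map A :: 3 \<Rightarrow> (3, 'k) mpoly) \<and>
     has_multidegree (monomial_map A :: 3 \<Rightarrow> (3, 'k) mpoly) \<gamma>}"

definition row_column_permutation :: "((nat^3^3) \<times> (nat^3^3)) set" where
  "row_column_permutation = {(A, B). \<exists>p q. p permutes UNIV \<and> q permutes UNIV \<and>
     (\<forall>i j. B $ i $ j = A $ p i $ q j)}"

end

theory Submission
  imports Defs
begin

text \<open>Write \<open>S\<close> for the bihomogeneous coordinate ring of \<open>P\<^sup>2 \<times> P\<^sup>2\<close>.  The theorem has three
  ingredients: a monomial map is birational iff its exponent matrix is unimodular on the vectors of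
  coordinate sum zero; a monomial Cremona map whose monomials have degree \<open>d\<close> has multidegree
  \<open>(1, d, 1)\<close> and no other multidegree of the form \<open>(1, \<delta>, 1)\<close>; and the matrices so described are
  classified by the units modulo \<open>d\<close>.

  Birationality (\<open>cremona_iff_unimodular\<close>).  If \<open>G\<close> inverts the monomial map \<open>F\<close>, comparing monomials
  in \<open>x\<^sub>j G\<^sub>0(F) = x\<^sub>0 G\<^sub>j(F)\<close> expresses \<open>e\<^sub>j - e\<^sub>0\<close> as an integer combination of the rows with coefficient
  sum zero.  Conversely such combinations are the exponents of a monomial inverse.

  A degree on cycles (\<open>chow_class_degree\<close>).  In place of intersection theory, a surface \<open>Z\<close> is
  measured by its Hilbert function \<open>k \<mapsto> dim (S / Z)\<close> in bidegree \<open>(s k, t k)\<close>, modulo functions that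
  grow at most linearly.  For a prime \<open>V\<close> and a form \<open>f\<close> outside it, the Hilbert function of
  \<open>S / (V + f S)\<close> depends only on \<open>V\<close> and the bidegree of \<open>f\<close>.  A prime filtration of this quotient
  shows that up to a linear error it is the sum over the surfaces \<open>Z\<close> of the order of \<open>f\<close> along \<open>Z\<close>
  times the Hilbert function of \<open>Z\<close>: the order is the number of factors \<open>S / Z\<close>
  (\<open>ord_along_filtration\<close>), and factors of smaller dimension, as well as shifts of the grading,
  contribute linearly (\<open>filtration_surfaces\<close>).  Hence rationally trivial cycles have degree zero.

  The class of the graph (\<open>graph_in_std_span\<close>).  The graph lies on the toric threefold
  \<open>y\<^sub>0 x\<^sup>p = y\<^sub>1 x\<^sup>q\<close>, where \<open>x\<^sup>p\<close> and \<open>x\<^sup>q\<close> are the coprime parts of the first two monomials.  There it is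
  the only component of the divisor of a second such binomial that is not a coordinate surface, and
  it has multiplicity one.  Coordinate surfaces of the same type are equivalent, so the graph is
  equivalent to a combination \<open>x h\<^sub>2\<^sup>2 + y h\<^sub>1 h\<^sub>2 + z h\<^sub>1\<^sup>2\<close>.  Its Hilbert function counts the lattice points
  \<open>u + A\<^sup>T w\<close> with \<open>u\<close> and \<open>w\<close> in dilated standard triangles; four elementary bounds on this number
  force \<open>x = 1\<close>, \<open>y = d\<close> and \<open>z = 1\<close> (\<open>multidegree_coefficients\<close>).

  Counting (\<open>normal_form_exists\<close>, \<open>normal_form_unique\<close>).  For \<open>d \<ge> 3\<close> some row has two zeros.
  Moving its nonzero entry \<open>d\<close> and a zero of the same column into place leaves a row \<open>(p, d - p, 0)\<close>
  and a third row that unimodularity and the order of the first two columns determine from \<open>p\<close>; the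
  \<open>p\<close> that occur are the units modulo \<open>d\<close>.\<close>

abbreviation "lookup \<equiv> Poly_Mapping.lookup"
abbreviation "keys \<equiv> Poly_Mapping.keys"
abbreviation "single \<equiv> Poly_Mapping.single"

section \<open>Polynomials as sums of monomials\<close>

lemma sum_singles: "f = (\<Sum>m\<in>keys f. single m (lookup f m))"
proof (rule poly_mapping_eqI)
  fix k
  have "lookup (\<Sum>m\<in>keys f. single m (lookup f m)) k = (\<Sum>m\<in>keys f. if m = k then lookup f m else 0)"
    unfolding lookup_sum by (intro sum.cong refl) (simp add: lookup_single when_def)
  also have "\<dots> = lookup f k"
    by (simp add: in_keys_iff)
  finally show "lookup f k = lookup (\<Sum>m\<in>keys f. single m (lookup f m)) k" by simp
qed

lemma poly_induct [case_names zero add single]: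
  fixes f :: "'a \<Rightarrow>\<^sub>0 'b::comm_monoid_add"
  assumes "P 0" and "\<And>f g. P f \<Longrightarrow> P g \<Longrightarrow> P (f + g)" and "\<And>m c. P (single m c)"
  shows "P f"
proof -
  have "P (\<Sum>m\<in>A. single m (lookup f m))" if "finite A" for A
    using that by induction (auto intro: assms)
  then show ?thesis using sum_singles[of f] by (metis finite_keys)
qed

text \<open>Evaluation of polynomials and homomorphisms into monoid rings are both of this form: \<open>\<iota>\<close> maps the
  coefficients and \<open>\<psi>\<close> the monomials.\<close>

definition lin_ext :: "('k \<Rightarrow> 'r) \<Rightarrow> ('m \<Rightarrow> 'r) \<Rightarrow> ('m \<Rightarrow>\<^sub>0 'k::zero) \<Rightarrow> 'r::comm_ring_1" where
  "lin_ext \<iota> \<psi> f = (\<Sum>m\<in>keys f. \<iota> (lookup f m) * \<psi> m)"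

locale scalar_hom =
  fixes \<iota> :: "'k::comm_ring_1 \<Rightarrow> 'r::comm_ring_1"
  assumes hom_add: "\<iota> (a + b) = \<iota> a + \<iota> b"
    and hom_mult: "\<iota> (a * b) = \<iota> a * \<iota> b"
    and hom_one: "\<iota> 1 = 1"
begin

lemma hom_zero: "\<iota> 0 = 0"
  using hom_add[of 0 0] by simp

lemma lin_ext_superset:
  assumes "finite K" "keys f \<subseteq> K"
  shows "lin_ext \<iota> \<psi> f = (\<Sum>m\<in>K. \<iota> (lookup f m) * \<psi> m)"
  unfolding lin_ext_def using assms
  by (intro sum.mono_neutral_left) (auto simp: in_keys_iff hom_zero)

lemma lin_ext_zero [simp]: "lin_ext \<iota> \<psi> 0 = 0"
  by (simp add: lin_ext_def)

lemma lin_ext_add: "lin_ext \<iota> \<psi> (f + g) = lin_ext \<iota> \<psi> f + lin_ext \<iota> \<psi> g"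
proof -
  let ?K = "keys f \<union> keys g"
  have "keys (f + g) \<subseteq> ?K" by (rule keys_add)
  then show ?thesis
    by (simp add: lin_ext_superset[of ?K] lookup_add hom_add sum.distrib algebra_simps)
qed

lemma lin_ext_sum: "lin_ext \<iota> \<psi> (\<Sum>i\<in>A. f i) = (\<Sum>i\<in>A. lin_ext \<iota> \<psi> (f i))"
  by (induction A rule: infinite_finite_induct) (auto simp: lin_ext_add)

lemma lin_ext_single: "lin_ext \<iota> \<psi> (single m c) = \<iota> c * \<psi> m"
  by (cases "c = 0") (simp_all add: lin_ext_def hom_zero)

lemma lin_ext_mult:
  fixes \<psi> :: "'m::comm_monoid_add \<Rightarrow> 'r"
  assumes mult: "\<And>m n. \<psi> (m + n) = \<psi> m * \<psi> n"
  shows "lin_ext \<iota> \<psi> (f * g) = lin_ext \<iota> \<psi> f * lin_ext \<iota> \<psi> g"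
proof (induction f rule: poly_induct)
  case (single m c)
  show ?case
    by (induction g rule: poly_induct)
      (auto simp: distrib_left lin_ext_add mult_single lin_ext_single mult hom_mult algebra_simps)
qed (auto simp: distrib_right lin_ext_add)

end

lemma lookup_single_mult:
  fixes f :: "('a::cancel_comm_monoid_add) \<Rightarrow>\<^sub>0 'b::comm_ring_1"
  shows "lookup (single m c * f) (m + n) = c * lookup f n"
  by (induction f rule: poly_induct)
    (auto simp: distrib_left lookup_add mult_single lookup_single when_def)

lemma keys_single_mult:
  fixes f :: "('a::cancel_comm_monoid_add) \<Rightarrow>\<^sub>0 'b::comm_ring_1"
  shows "keys (single m c * f) \<subseteq> (\<lambda>n. m + n) ` keys f"
  using keys_mult[of "single m c" f] by (cases "c = 0") auto

section \<open>The bigrading\<close>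

definition bideg :: "(3 + 3 \<Rightarrow>\<^sub>0 nat) \<Rightarrow> nat \<times> nat" where
  "bideg m = (\<Sum>i\<in>UNIV. lookup m (Inl i), \<Sum>j\<in>UNIV. lookup m (Inr j))"

lemma bihomog_iff: "bihomog a b f \<longleftrightarrow> (\<forall>m\<in>keys f. bideg m = (a, b))"
  by (simp add: bihomog_def bideg_def)

lemma bideg_add: "bideg (m + n) = (fst (bideg m) + fst (bideg n), snd (bideg m) + snd (bideg n))"
  by (simp add: bideg_def lookup_add sum.distrib)

lemma bideg_zero [simp]: "bideg 0 = (0, 0)"
  by (simp add: bideg_def)

lemma bihomog_zero [simp]: "bihomog a b 0"
  by (simp add: bihomog_iff)

lemma bihomog_add: "bihomog a b f \<Longrightarrow> bihomog a b g \<Longrightarrow> bihomog a b (f + g)"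
  using keys_add[of f g] by (auto simp: bihomog_iff)

lemma bihomog_sum: "(\<And>i. i \<in> A \<Longrightarrow> bihomog a b (f i)) \<Longrightarrow> bihomog a b (\<Sum>i\<in>A. f i)"
  by (induction A rule: infinite_finite_induct) (auto intro: bihomog_add)

lemma bihomog_uminus: "bihomog a b f \<Longrightarrow> bihomog a b (- f)"
  by (simp add: bihomog_iff in_keys_iff)

lemma bihomog_diff: "bihomog a b f \<Longrightarrow> bihomog a b g \<Longrightarrow> bihomog a b (f - g)"
  using bihomog_add[of a b f "- g"] bihomog_uminus[of a b g] by simp

lemma bihomog_mult: "bihomog a b f \<Longrightarrow> bihomog c d g \<Longrightarrow> bihomog (a + c) (b + d) (f * g)"
  using keys_mult[of f g] by (fastforce simp: bihomog_iff bideg_add)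

lemma bihomog_single: "bideg m = (a, b) \<Longrightarrow> bihomog a b (single m c)"
  by (cases "c = 0") (auto simp: bihomog_iff)

lemma bihomog_const: "bihomog 0 0 (single 0 c)"
  by (rule bihomog_single) simp

lemma bihomog_one: "bihomog 0 0 1"
  using bihomog_const[of 1] by simp

lemma bihomog_power: "bihomog a b f \<Longrightarrow> bihomog (n * a) (n * b) (f ^ n)"
  by (induction n) (auto simp: bihomog_one dest: bihomog_mult)

definition part :: "nat \<Rightarrow> nat \<Rightarrow> 'k::field bipoly \<Rightarrow> 'k bipoly" where
  "part a b f = (\<Sum>m\<in>{m \<in> keys f. bideg m = (a, b)}. single m (lookup f m))"

lemma lookup_part: "lookup (part a b f) k = (if bideg k = (a, b) then lookup f k else 0)"
proof -
  have "lookup (part a b f) k = (\<Sum>m\<in>{m \<in> keys f. bideg m = (a, b)}. if m = k then lookup f m else 0)"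
    unfolding part_def lookup_sum by (intro sum.cong refl) (simp add: lookup_single when_def)
  also have "\<dots> = (if bideg k = (a, b) then lookup f k else 0)"
    by (simp add: in_keys_iff)
  finally show ?thesis .
qed

lemma bihomog_part: "bihomog a b (part a b f)"
  by (auto simp: bihomog_iff in_keys_iff lookup_part split: if_splits)

lemma part_zero [simp]: "part a b 0 = 0"
  by (simp add: part_def)

lemma part_add: "part a b (f + g) = part a b f + part a b g"
  by (rule poly_mapping_eqI) (simp add: lookup_part lookup_add)

lemma part_sum: "part a b (\<Sum>i\<in>A. f i) = (\<Sum>i\<in>A. part a b (f i))"
  by (induction A rule: infinite_finite_induct) (auto simp: part_add)

lemma part_single: "part a b (single m c) = (if bideg m = (a, b) then single m c else 0)"
  by (rule poly_mapping_eqI) (auto simp: lookup_part lookup_single when_def)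

lemma part_bihomog: "bihomog c d f \<Longrightarrow> part a b f = (if (a, b) = (c, d) then f else 0)"
proof (rule poly_mapping_eqI)
  fix k assume f: "bihomog c d f"
  show "lookup (part a b f) k = lookup (if (a, b) = (c, d) then f else 0) k"
    using f by (cases "k \<in> keys f") (auto simp: lookup_part bihomog_iff in_keys_iff)
qed

lemma part_notin: "(a, b) \<notin> bideg ` keys f \<Longrightarrow> part a b f = 0"
  by (rule poly_mapping_eqI) (metis image_eqI in_keys_iff lookup_part lookup_zero)

lemma sum_parts: "f = (\<Sum>p\<in>bideg ` keys f. part (fst p) (snd p) f)"
proof (rule poly_mapping_eqI)
  fix k
  have "lookup (\<Sum>p\<in>bideg ` keys f. part (fst p) (snd p) f) k =
      (\<Sum>p\<in>bideg ` keys f. if p = bideg k then lookup f k else 0)"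
    unfolding lookup_sum by (intro sum.cong refl) (auto simp: lookup_part)
  also have "\<dots> = lookup f k"
    by (auto simp: in_keys_iff)
  finally show "lookup f k = lookup (\<Sum>p\<in>bideg ` keys f. part (fst p) (snd p) f) k" by simp
qed

lemma part_single_mult:
  assumes "bideg m = (p, q)"
  shows "part a b (single m c * f) = (if p \<le> a \<and> q \<le> b then single m c * part (a - p) (b - q) f else 0)"
proof (induction f rule: poly_induct)
  case (single n d)
  obtain u v where "bideg n = (u, v)" by fastforce
  then show ?case using assms by (auto simp: mult_single part_single bideg_add)
qed (auto simp: distrib_left part_add)

lemma part_form_mult:
  assumes "bihomog p q s"
  shows "part a b (s * f) = (if p \<le> a \<and> q \<le> b then s * part (a - p) (b - q) f else 0)"
proof -
  have s: "s = (\<Sum>m\<in>keys s. single m (lookup s m))" by (rule sum_singles)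
  have "part a b (s * f) = (\<Sum>m\<in>keys s. part a b (single m (lookup s m) * f))"
    by (subst s) (simp only: sum_distrib_right part_sum)
  also have "\<dots> = (\<Sum>m\<in>keys s. if p \<le> a \<and> q \<le> b
      then single m (lookup s m) * part (a - p) (b - q) f else 0)"
    using assms by (intro sum.cong refl part_single_mult) (auto simp: bihomog_iff)
  also have "\<dots> = (if p \<le> a \<and> q \<le> b then s * part (a - p) (b - q) f else 0)"
    by (auto simp: sum_distrib_right[symmetric] sum_singles[of s, symmetric])
  finally show ?thesis .
qed

section \<open>Ideals\<close>

definition is_ideal :: "'a::comm_ring_1 set \<Rightarrow> bool" where
  "is_ideal J \<longleftrightarrow> 0 \<in> J \<and> (\<forall>a\<in>J. \<forall>b\<in>J. a + b \<in> J) \<and> (\<forall>r. \<forall>a\<in>J. r * a \<in> J)"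

lemma is_idealD:
  assumes "is_ideal J"
  shows "0 \<in> J" "a \<in> J \<Longrightarrow> b \<in> J \<Longrightarrow> a + b \<in> J" "a \<in> J \<Longrightarrow> r * a \<in> J" "a \<in> J \<Longrightarrow> a * r \<in> J"
    "a \<in> J \<Longrightarrow> - a \<in> J" "a \<in> J \<Longrightarrow> b \<in> J \<Longrightarrow> a - b \<in> J"
proof -
  note A = assms[unfolded is_ideal_def]
  show "0 \<in> J" "a \<in> J \<Longrightarrow> b \<in> J \<Longrightarrow> a + b \<in> J" "a \<in> J \<Longrightarrow> r * a \<in> J" using A by auto
  show "a \<in> J \<Longrightarrow> a * r \<in> J" using A by (metis mult.commute)
  have m: "- x \<in> J" if "x \<in> J" for x using A that by (metis mult_minus1)
  then show "a \<in> J \<Longrightarrow> - a \<in> J" .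
  show "a \<in> J \<Longrightarrow> b \<in> J \<Longrightarrow> a - b \<in> J" using A m by (metis add_uminus_conv_diff)
qed

lemma is_ideal_sum: "is_ideal J \<Longrightarrow> (\<And>i. i \<in> A \<Longrightarrow> f i \<in> J) \<Longrightarrow> (\<Sum>i\<in>A. f i) \<in> J"
  by (induction A rule: infinite_finite_induct) (auto intro: is_idealD)

lemma ideal_class_iff: "ideal J (cring_class_ops :: 'a::comm_ring_1 ring) \<longleftrightarrow> is_ideal J"
proof
  assume "ideal J (cring_class_ops :: 'a ring)"
  then interpret I: ideal J "cring_class_ops :: 'a ring" .
  have "0 \<in> J" using I.zero_closed by (simp add: cring_class_ops_def)
  moreover have "a + b \<in> J" if "a \<in> J" "b \<in> J" for a b
    using I.a_closed[OF that] by (simp add: cring_class_ops_def)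
  moreover have "r * a \<in> J" if "a \<in> J" for a r
    using I.I_l_closed[OF that, of r] by (simp add: cring_class_ops_def)
  ultimately show "is_ideal J" by (auto simp: is_ideal_def)
next
  assume J: "is_ideal J"
  show "ideal J (cring_class_ops :: 'a ring)"
  proof (rule idealI)
    show "ring (cring_class_ops :: 'a ring)"
      using cring_class.ring_axioms by simp
    have inv: "inv\<^bsub>add_monoid cring_class_ops\<^esub> a = - a" for a :: 'a
      using uminus_class[of a] by (simp add: a_inv_def)
    show "subgroup J (add_monoid (cring_class_ops :: 'a ring))"
      using J by (intro subgroup.intro)
        (auto simp only: inv, auto simp: cring_class_ops_def intro: is_idealD)
  qed (use J in \<open>auto simp: cring_class_ops_def intro: is_idealD\<close>)
qed

lemma primeideal_class_iff:
  "primeideal P (cring_class_ops :: 'a::comm_ring_1 ring) \<longleftrightarrow>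
     is_ideal P \<and> 1 \<notin> P \<and> (\<forall>a b. a * b \<in> P \<longrightarrow> a \<in> P \<or> b \<in> P)"
proof
  assume P: "primeideal P (cring_class_ops :: 'a ring)"
  then interpret I: primeideal P "cring_class_ops :: 'a ring" .
  have i: "is_ideal P" using I.ideal_axioms by (simp add: ideal_class_iff)
  moreover have "1 \<notin> P"
  proof
    assume "1 \<in> P"
    then have "P = UNIV" using is_idealD(3)[OF i, of 1] by auto
    then show False using I.I_notcarr by (simp add: cring_class_ops_def)
  qed
  moreover have "a \<in> P \<or> b \<in> P" if "a * b \<in> P" for a b
    using I.I_prime[of a b] that by (simp add: cring_class_ops_def)
  ultimately show "is_ideal P \<and> 1 \<notin> P \<and> (\<forall>a b. a * b \<in> P \<longrightarrow> a \<in> P \<or> b \<in> P)" by blast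
next
  assume P: "is_ideal P \<and> 1 \<notin> P \<and> (\<forall>a b. a * b \<in> P \<longrightarrow> a \<in> P \<or> b \<in> P)"
  show "primeideal P (cring_class_ops :: 'a ring)"
  proof (rule primeidealI)
    show "ideal P (cring_class_ops :: 'a ring)" using P by (simp add: ideal_class_iff)
    show "cring (cring_class_ops :: 'a ring)" by (rule cring_class)
  qed (use P in \<open>auto simp: cring_class_ops_def\<close>)
qed

lemma genideal_class: "genideal (cring_class_ops :: 'a::comm_ring_1 ring) A = \<Inter>{J. is_ideal J \<and> A \<subseteq> J}"
  by (simp add: genideal_def ideal_class_iff)

lemma is_ideal_genideal: "is_ideal (genideal (cring_class_ops :: 'a::comm_ring_1 ring) A)"
  unfolding genideal_class by (auto simp: is_ideal_def)

lemma genideal_superset: "A \<subseteq> genideal (cring_class_ops :: 'a::comm_ring_1 ring) A"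
  unfolding genideal_class by auto

lemma genideal_minimal: "is_ideal J \<Longrightarrow> A \<subseteq> J \<Longrightarrow> genideal (cring_class_ops :: 'a::comm_ring_1 ring) A \<subseteq> J"
  unfolding genideal_class by auto

lemma bihomog_ideal_iff:
  "bihomog_ideal J \<longleftrightarrow> is_ideal J \<and> (\<forall>f\<in>J. \<forall>a b. part a b f \<in> J)"
proof
  assume J: "bihomog_ideal J"
  then have i: "is_ideal J" by (simp add: bihomog_ideal_def ideal_class_iff)
  let ?J = "{f \<in> J. \<forall>a b. part a b f \<in> J}"
  have "is_ideal ?J"
    unfolding is_ideal_def
  proof (intro conjI ballI allI)
    fix r a assume a: "a \<in> ?J"
    have "part c d (r * a) \<in> J" for c d
    proof (induction r rule: poly_induct)
      case (single m e)
      obtain p q where "bideg m = (p, q)" by fastforce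
      then show ?case using a i by (auto simp: part_single_mult intro: is_idealD)
    qed (use i in \<open>auto simp: distrib_right part_add intro: is_idealD\<close>)
    then show "r * a \<in> ?J" using a i by (auto intro: is_idealD)
  qed (use i in \<open>auto simp: part_add intro: is_idealD\<close>)
  moreover have "{f \<in> J. \<exists>a b. bihomog a b f} \<subseteq> ?J"
    using i by (auto simp: part_bihomog intro: is_idealD)
  ultimately have "genideal cring_class_ops {f \<in> J. \<exists>a b. bihomog a b f} \<subseteq> ?J"
    by (rule genideal_minimal)
  then show "is_ideal J \<and> (\<forall>f\<in>J. \<forall>a b. part a b f \<in> J)"
    using J i by (auto simp: bihomog_ideal_def)
next
  assume J: "is_ideal J \<and> (\<forall>f\<in>J. \<forall>a b. part a b f \<in> J)"
  let ?G = "genideal cring_class_ops {f \<in> J. \<exists>a b. bihomog a b f}"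
  have "f \<in> ?G" if "f \<in> J" for f
  proof -
    have "part a b f \<in> ?G" for a b
      using J that genideal_superset[of "{f \<in> J. \<exists>a b. bihomog a b f}"] bihomog_part by blast
    then have "(\<Sum>p\<in>bideg ` keys f. part (fst p) (snd p) f) \<in> ?G"
      by (intro is_ideal_sum is_ideal_genideal)
    then show ?thesis using sum_parts[of f] by simp
  qed
  moreover have "?G \<subseteq> J" using J by (intro genideal_minimal) auto
  ultimately show "bihomog_ideal J"
    using J by (auto simp: bihomog_ideal_def ideal_class_iff)
qed

lemma bihomog_idealD:
  assumes "bihomog_ideal J"
  shows "is_ideal J" "f \<in> J \<Longrightarrow> part a b f \<in> J"
  using assms by (auto simp: bihomog_ideal_iff)

lemma bihomog_ideal_subsetI:
  assumes "bihomog_ideal J" "is_ideal K" "\<And>a b f. bihomog a b f \<Longrightarrow> f \<in> J \<Longrightarrow> f \<in> K"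
  shows "J \<subseteq> K"
proof
  fix f assume f: "f \<in> J"
  have "part a b f \<in> K" for a b
    using assms bihomog_part bihomog_idealD(2)[OF assms(1) f] by blast
  then have "(\<Sum>p\<in>bideg ` keys f. part (fst p) (snd p) f) \<in> K"
    by (intro is_ideal_sum assms(2)) blast
  then show "f \<in> K" using sum_parts[of f] by simp
qed

lemma form_in_diff:
  assumes "bihomog_ideal J" "is_ideal K" "\<not> J \<subseteq> K"
  obtains a b f where "bihomog a b f" "f \<in> J" "f \<notin> K"
  using bihomog_ideal_subsetI assms by blast

lemma part_mult:
  "part a b (f * g) = (\<Sum>p\<in>bideg ` keys f. if fst p \<le> a \<and> snd p \<le> b
     then part (fst p) (snd p) f * part (a - fst p) (b - snd p) g else 0)"
proof -
  have "part a b (f * g) = (\<Sum>p\<in>bideg ` keys f. part a b (part (fst p) (snd p) f * g))"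
    by (subst sum_parts[of f]) (simp only: sum_distrib_right part_sum)
  then show ?thesis by (simp add: part_form_mult[OF bihomog_part] cong: if_cong)
qed

text \<open>The product of the components of highest bidegree outside the ideal is, modulo the
  ideal, a component of the product.\<close>

lemma prime_if_prime_on_forms:
  assumes Q: "bihomog_ideal Q"
    and prime: "\<And>a b c d f g. bihomog a b f \<Longrightarrow> bihomog c d g \<Longrightarrow> f * g \<in> Q \<Longrightarrow> f \<in> Q \<or> g \<in> Q"
    and fg: "f * g \<in> Q"
  shows "f \<in> Q \<or> g \<in> Q"
proof (rule ccontr)
  assume "\<not> (f \<in> Q \<or> g \<in> Q)"
  then have nf: "f \<notin> Q" and ng: "g \<notin> Q" by auto
  note i = bihomog_idealD(1)[OF Q]
  define D where "D h = {p. part (fst p) (snd p) h \<notin> Q}" for h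
  have fin: "finite (D h)" for h
  proof (rule finite_subset)
    show "D h \<subseteq> bideg ` keys h"
      unfolding D_def using part_notin[of _ _ h] is_idealD(1)[OF i] by (metis (mono_tags, lifting) mem_Collect_eq prod.collapse subsetI)
  qed simp
  have top: "\<exists>a b. (a, b) \<in> D h \<and> (\<forall>c d. (c, d) \<in> D h \<longrightarrow> c < a \<or> c = a \<and> d \<le> b)" if "h \<notin> Q" for h
  proof -
    have "D h \<noteq> {}"
    proof
      assume "D h = {}"
      then have "(\<Sum>p\<in>bideg ` keys h. part (fst p) (snd p) h) \<in> Q"
        by (intro is_ideal_sum i) (auto simp: D_def)
      then show False using that sum_parts[of h] by simp
    qed
    define a where "a = Max (fst ` D h)"
    have a: "a \<in> fst ` D h" unfolding a_def using fin \<open>D h \<noteq> {}\<close> by (intro Max_in) auto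
    define b where "b = Max {b. (a, b) \<in> D h}"
    have fb: "finite {b. (a, b) \<in> D h}"
      by (rule finite_subset[of _ "snd ` D h"]) (use fin in force)+
    have b: "(a, b) \<in> D h" using Max_in[OF fb] a b_def by fastforce
    have "c < a \<or> c = a \<and> d \<le> b" if "(c, d) \<in> D h" for c d
    proof -
      have "c \<le> a" unfolding a_def using that fin by (intro Max_ge) force+
      moreover have "d \<le> b" if "c = a" unfolding b_def using that \<open>(c, d) \<in> D h\<close> fb by (intro Max_ge) auto
      ultimately show ?thesis by auto
    qed
    then show ?thesis using b by blast
  qed
  obtain a b where ab: "(a, b) \<in> D f" "\<And>c d. (c, d) \<in> D f \<Longrightarrow> c < a \<or> c = a \<and> d \<le> b" using top[OF nf] by blast
  obtain c d where cd: "(c, d) \<in> D g" "\<And>a b. (a, b) \<in> D g \<Longrightarrow> a < c \<or> a = c \<and> b \<le> d" using top[OF ng] by blast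
  let ?t = "\<lambda>p. if fst p \<le> a + c \<and> snd p \<le> b + d
     then part (fst p) (snd p) f * part (a + c - fst p) (b + d - snd p) g else 0"
  have abin: "(a, b) \<in> bideg ` keys f" using ab(1) part_notin[of a b f] is_idealD(1)[OF i]
    unfolding D_def by (metis (mono_tags, lifting) fst_conv mem_Collect_eq snd_conv)
  have "(\<Sum>p\<in>bideg ` keys f. ?t p) \<in> Q"
    using bihomog_idealD(2)[OF Q fg, of "a + c" "b + d"] by (simp add: part_mult)
  then have "?t (a, b) + (\<Sum>p\<in>bideg ` keys f - {(a, b)}. ?t p) \<in> Q"
    using abin by (subst (asm) sum.remove[of _ "(a, b)"]) auto
  moreover have "(\<Sum>p\<in>bideg ` keys f - {(a, b)}. ?t p) \<in> Q"
  proof (intro is_ideal_sum i)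
    fix p assume p: "p \<in> bideg ` keys f - {(a, b)}"
    show "?t p \<in> Q"
    proof (cases "p \<in> D f \<and> fst p \<le> a + c \<and> snd p \<le> b + d")
      case True
      obtain u v where uv: "p = (u, v)" by fastforce
      have "(a + c - u, b + d - v) \<notin> D g"
        using cd(2)[of "a + c - u" "b + d - v"] ab(2)[of u v] True p uv by auto
      then show ?thesis using True uv i by (auto simp: D_def intro: is_idealD)
    qed (use i in \<open>auto simp: D_def intro: is_idealD\<close>)
  qed
  ultimately have "?t (a, b) \<in> Q" using is_idealD(6)[OF i] by fastforce
  then have "part a b f * part c d g \<in> Q" by simp
  then have "part a b f \<in> Q \<or> part c d g \<in> Q" by (rule prime[OF bihomog_part bihomog_part])
  then show False using ab(1) cd(1) by (simp add: D_def)
qed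

subsection \<open>Colon ideals and adjoining a form\<close>

definition colon :: "'a::comm_ring_1 set \<Rightarrow> 'a \<Rightarrow> 'a set" where
  "colon I h = {r. r * h \<in> I}"

definition adjoin :: "'a::comm_ring_1 set \<Rightarrow> 'a \<Rightarrow> 'a set" where
  "adjoin I h = {i + r * h |i r. i \<in> I}"

lemma is_ideal_colon: "is_ideal I \<Longrightarrow> is_ideal (colon I h)"
  by (auto simp: is_ideal_def colon_def distrib_right mult.assoc)

lemma is_ideal_adjoin:
  assumes "is_ideal I" shows "is_ideal (adjoin I h)"
  unfolding is_ideal_def
proof (intro conjI ballI allI)
  show "0 \<in> adjoin I h" using is_idealD(1)[OF assms] unfolding adjoin_def
    by (metis (mono_tags, lifting) add_0 mem_Collect_eq mult_zero_left)
next
  fix a b assume "a \<in> adjoin I h" "b \<in> adjoin I h"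
  then obtain i r j s where "a = i + r * h" "b = j + s * h" "i \<in> I" "j \<in> I" by (auto simp: adjoin_def)
  then have "a + b = (i + j) + (r + s) * h" "i + j \<in> I" using is_idealD(2)[OF assms] by (auto simp: algebra_simps)
  then show "a + b \<in> adjoin I h" unfolding adjoin_def by blast
next
  fix a t assume "a \<in> adjoin I h"
  then obtain i r where "a = i + r * h" "i \<in> I" by (auto simp: adjoin_def)
  then have "t * a = t * i + (t * r) * h" "t * i \<in> I" using is_idealD(3)[OF assms] by (auto simp: algebra_simps)
  then show "t * a \<in> adjoin I h" unfolding adjoin_def by blast
qed

lemma adjoin_superset: "I \<subseteq> adjoin I h"
  by (force simp: adjoin_def intro: exI[of _ 0])

lemma in_adjoin: "is_ideal I \<Longrightarrow> h \<in> adjoin I h"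
  using is_idealD(1)[of I] by (force simp: adjoin_def intro: exI[of _ 1])

lemma adjoin_least: "is_ideal J \<Longrightarrow> I \<subseteq> J \<Longrightarrow> h \<in> J \<Longrightarrow> adjoin I h \<subseteq> J"
  by (auto simp: adjoin_def intro!: is_idealD(2) is_idealD(3))

lemma colon_superset: "is_ideal I \<Longrightarrow> I \<subseteq> colon I h"
  by (auto simp: colon_def intro: is_idealD)

lemma bihomog_ideal_colon:
  assumes "bihomog_ideal I" "bihomog c d h"
  shows "bihomog_ideal (colon I h)"
  unfolding bihomog_ideal_iff
proof (intro conjI ballI allI)
  show "is_ideal (colon I h)" using assms by (simp add: is_ideal_colon bihomog_idealD)
next
  fix f a b assume "f \<in> colon I h"
  then have "part (c + a) (d + b) (h * f) \<in> I"
    using bihomog_idealD(2)[OF assms(1), of "f * h"] by (simp add: colon_def mult.commute)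
  then show "part a b f \<in> colon I h"
    by (simp add: part_form_mult[OF assms(2)]) (simp add: colon_def mult.commute)
qed

lemma bihomog_ideal_adjoin:
  assumes "bihomog_ideal I" "bihomog c d h"
  shows "bihomog_ideal (adjoin I h)"
  unfolding bihomog_ideal_iff
proof (intro conjI ballI allI)
  note i = bihomog_idealD(1)[OF assms(1)]
  show "is_ideal (adjoin I h)" using i by (rule is_ideal_adjoin)
  fix f a b assume "f \<in> adjoin I h"
  then obtain j r where j: "f = j + r * h" "j \<in> I" by (auto simp: adjoin_def)
  have "part a b f = part a b j + part a b (h * r)" using j by (simp add: part_add mult.commute)
  also have "\<dots> \<in> adjoin I h"
    using bihomog_idealD(2)[OF assms(1) j(2), of a b] adjoin_superset[of I h] in_adjoin[OF i, of h]
      is_ideal_adjoin[OF i, of h]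
    by (auto simp: part_form_mult[OF assms(2)] intro!: is_idealD)
  finally show "part a b f \<in> adjoin I h" .
qed

section \<open>The Hilbert function\<close>

text \<open>Gaussian elimination of the unknown \<open>p\<close> by the equation \<open>r\<close>.\<close>

lemma homogeneous_system:
  fixes A :: "'i \<Rightarrow> 'j \<Rightarrow> 'k::field"
  assumes "finite I" "finite J" "card I < card J"
  shows "\<exists>c. (\<exists>j\<in>J. c j \<noteq> 0) \<and> (\<forall>i\<in>I. (\<Sum>j\<in>J. A i j * c j) = 0)"
  using assms
proof (induction I arbitrary: J A rule: finite_induct)
  case empty
  then have "J \<noteq> {}" by auto
  then show ?case by (intro exI[of _ "\<lambda>_. 1"]) auto
next
  case (insert r I)
  show ?case
  proof (cases "\<forall>j\<in>J. A r j = 0")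
    case True
    obtain c where "\<exists>j\<in>J. c j \<noteq> 0" "\<forall>i\<in>I. (\<Sum>j\<in>J. A i j * c j) = 0"
      using insert.IH[of J A] insert.hyps insert.prems by force
    then show ?thesis using True by (intro exI[of _ c]) auto
  next
    case False
    then obtain p where p: "p \<in> J" "A r p \<noteq> 0" by blast
    define B where "B i j = A i j - A i p * A r j / A r p" for i j
    have "card I < card (J - {p})" using insert p by simp
    then obtain c where c: "\<exists>j\<in>J - {p}. c j \<noteq> 0" "\<forall>i\<in>I. (\<Sum>j\<in>J - {p}. B i j * c j) = 0"
      using insert.IH[of "J - {p}" B] insert by blast
    define d where "d = c(p := - (\<Sum>j\<in>J - {p}. A r j * c j) / A r p)"
    have sum: "(\<Sum>j\<in>J. A i j * d j) = A i p * d p + (\<Sum>j\<in>J - {p}. A i j * c j)" for i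
      using insert.prems p by (subst sum.remove[of _ p]) (auto simp: d_def intro!: sum.cong)
    have "(\<Sum>j\<in>J. A r j * d j) = 0"
      unfolding sum using p by (simp add: d_def)
    moreover have "(\<Sum>j\<in>J. A i j * d j) = 0" if "i \<in> I" for i
    proof -
      have "(\<Sum>j\<in>J - {p}. B i j * c j) =
          (\<Sum>j\<in>J - {p}. A i j * c j) - (A i p / A r p) * (\<Sum>j\<in>J - {p}. A r j * c j)"
        by (simp add: B_def sum_subtractf sum_distrib_left algebra_simps)
      then show ?thesis using c(2) that unfolding sum by (simp add: d_def)
    qed
    ultimately show ?thesis using c(1) by (intro exI[of _ d]) (auto simp: d_def)
  qed
qed

abbreviation cst :: "'k \<Rightarrow> 'k::field bipoly" where
  "cst c \<equiv> single 0 c"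

lemma cst_mult: "cst a * cst b = cst (a * b)"
  by (simp add: mult_single)

lemma cst_sum: "(\<Sum>i\<in>A. cst (c i)) = cst (\<Sum>i\<in>A. c i)"
  by (induction A rule: infinite_finite_induct) (auto simp: single_add)

lemma bihomog_cst_mult: "bihomog a b f \<Longrightarrow> bihomog a b (cst c * f)"
  using bihomog_mult[OF bihomog_const, of a b f c] by simp

definition indep_mod :: "'k::field bipoly set \<Rightarrow> 'i set \<Rightarrow> ('i \<Rightarrow> 'k bipoly) \<Rightarrow> bool" where
  "indep_mod I J e \<longleftrightarrow> finite J \<and> (\<forall>c. (\<Sum>j\<in>J. cst (c j) * e j) \<in> I \<longrightarrow> (\<forall>j\<in>J. c j = 0))"

definition span_mod :: "'k::field bipoly set \<Rightarrow> nat \<Rightarrow> nat \<Rightarrow> 'i set \<Rightarrow> ('i \<Rightarrow> 'k bipoly) \<Rightarrow> bool" where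
  "span_mod I a b J e \<longleftrightarrow> finite J \<and> (\<forall>f. bihomog a b f \<longrightarrow> (\<exists>c. f - (\<Sum>j\<in>J. cst (c j) * e j) \<in> I))"

lemma indep_modD: "indep_mod I J e \<Longrightarrow> (\<Sum>j\<in>J. cst (c j) * e j) \<in> I \<Longrightarrow> j \<in> J \<Longrightarrow> c j = 0"
  by (auto simp: indep_mod_def)

text \<open>Steinitz exchange: expressing more than \<open>card K\<close> vectors through \<open>card K\<close> generators gives a linear
  system with more unknowns than equations.\<close>

lemma indep_le_span:
  assumes I: "is_ideal I" and e: "indep_mod I J e" "\<And>j. j \<in> J \<Longrightarrow> bihomog a b (e j)"
    and g: "span_mod I a b K g"
  shows "card J \<le> card K"
proof (rule ccontr)
  assume "\<not> card J \<le> card K"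
  then have less: "card K < card J" by simp
  have fin: "finite J" "finite K" using e g by (auto simp: indep_mod_def span_mod_def)
  have "\<forall>j\<in>J. \<exists>c. e j - (\<Sum>i\<in>K. cst (c i) * g i) \<in> I"
    using e(2) g by (auto simp: span_mod_def)
  from bchoice[OF this] obtain A where A: "\<And>j. j \<in> J \<Longrightarrow> e j - (\<Sum>i\<in>K. cst (A j i) * g i) \<in> I"
    by blast
  obtain c where c: "\<exists>j\<in>J. c j \<noteq> 0" "\<forall>i\<in>K. (\<Sum>j\<in>J. A j i * c j) = 0"
    using homogeneous_system[OF fin(2,1) less, of "\<lambda>i j. A j i"] by blast
  have "(\<Sum>j\<in>J. cst (c j) * (e j - (\<Sum>i\<in>K. cst (A j i) * g i))) \<in> I"
    using A I by (intro is_ideal_sum is_idealD(3))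
  moreover have "(\<Sum>j\<in>J. cst (c j) * (\<Sum>i\<in>K. cst (A j i) * g i)) = 0"
  proof -
    have "(\<Sum>j\<in>J. cst (c j) * (\<Sum>i\<in>K. cst (A j i) * g i)) = (\<Sum>j\<in>J. \<Sum>i\<in>K. cst (A j i * c j) * g i)"
      unfolding sum_distrib_left
      by (intro sum.cong refl) (simp only: mult.assoc[symmetric] cst_mult mult.commute[of "c _"])
    also have "\<dots> = (\<Sum>i\<in>K. \<Sum>j\<in>J. cst (A j i * c j) * g i)" by (rule sum.swap)
    also have "\<dots> = (\<Sum>i\<in>K. cst (\<Sum>j\<in>J. A j i * c j) * g i)"
      by (simp only: sum_distrib_right[symmetric] cst_sum)
    also have "\<dots> = 0" using c(2) by simp
    finally show ?thesis .
  qed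
  ultimately have "(\<Sum>j\<in>J. cst (c j) * e j) \<in> I"
    by (simp add: right_diff_distrib sum_subtractf)
  then show False using e(1) c(1) by (auto simp: indep_mod_def)
qed

lemma finite_bideg: "finite {m. bideg m = (a, b)}"
proof -
  have le: "lookup m v \<in> {..a + b}" if m: "bideg m = (a, b)" for m v
  proof -
    show ?thesis
    proof (cases v)
      case (Inl i)
      have "lookup m (Inl i) \<le> (\<Sum>i\<in>UNIV. lookup m (Inl i))" by (rule member_le_sum) auto
      then show ?thesis using m Inl by (simp add: bideg_def)
    next
      case (Inr i)
      have "lookup m (Inr i) \<le> (\<Sum>i\<in>UNIV. lookup m (Inr i))" by (rule member_le_sum) auto
      then show ?thesis using m Inr by (simp add: bideg_def)
    qed
  qed
  then have "lookup ` {m. bideg m = (a, b)} \<subseteq> {f. \<forall>v. (v \<in> UNIV \<longrightarrow> f v \<in> {..a + b}) \<and> (v \<notin> UNIV \<longrightarrow> f v = 0)}"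
    by auto
  then have "finite (lookup ` {m. bideg m = (a, b)})"
    by (rule finite_subset) (rule finite_set_of_finite_funs, auto)
  then show ?thesis
    by (rule finite_imageD) (auto intro: inj_onI poly_mapping_eqI)
qed

lemma span_monomials:
  assumes "is_ideal I"
  shows "span_mod I a b {m. bideg m = (a, b)} (\<lambda>m. single m 1)"
  unfolding span_mod_def
proof (intro conjI finite_bideg allI impI)
  fix f :: "'a bipoly" assume f: "bihomog a b f"
  have "f = (\<Sum>m\<in>keys f. single m (lookup f m))" by (rule sum_singles)
  also have "\<dots> = (\<Sum>m | bideg m = (a, b). single m (lookup f m))"
    using f by (intro sum.mono_neutral_left finite_bideg) (auto simp: bihomog_iff in_keys_iff)
  also have "\<dots> = (\<Sum>m | bideg m = (a, b). cst (lookup f m) * single m 1)"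
    by (simp add: mult_single)
  finally show "\<exists>c. f - (\<Sum>m | bideg m = (a, b). cst (c m) * single m 1) \<in> I"
    using is_idealD(1)[OF assms] by (intro exI[of _ "lookup f"]) simp
qed

text \<open>The dimension of the part of bidegree \<open>(a, b)\<close> of \<open>S / I\<close>.\<close>

definition hilb :: "'k::field bipoly set \<Rightarrow> nat \<Rightarrow> nat \<Rightarrow> nat" where
  "hilb I a b = (GREATEST n. \<exists>e. indep_mod I {..<n} e \<and> (\<forall>j<n. bihomog a b (e j)))"

lemma indep_reindex:
  assumes "indep_mod I J e" "\<And>j. j \<in> J \<Longrightarrow> bihomog a b (e j)"
  shows "\<exists>e'. indep_mod I {..<card J} e' \<and> (\<forall>j<card J. bihomog a b (e' j))"
proof -
  have "finite J" using assms by (simp add: indep_mod_def)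
  then obtain h where "bij_betw h {0..<card J} J" using ex_bij_betw_nat_finite by blast
  then have h: "bij_betw h {..<card J} J" by (simp add: atLeast0LessThan)
  have "indep_mod I {..<card J} (e \<circ> h)"
    unfolding indep_mod_def
  proof (intro conjI allI impI)
    fix c :: "nat \<Rightarrow> 'a" assume c: "(\<Sum>j<card J. cst (c j) * (e \<circ> h) j) \<in> I"
    let ?g = "inv_into {..<card J} h"
    have "(\<Sum>j\<in>J. cst (c (?g j)) * e j) = (\<Sum>j<card J. cst (c (?g (h j))) * e (h j))"
      by (rule sum.reindex_bij_betw[OF h, symmetric])
    also have "\<dots> = (\<Sum>j<card J. cst (c j) * e (h j))"
      using h by (intro sum.cong) (auto simp: bij_betw_def)
    finally have "(\<Sum>j\<in>J. cst (c (?g j)) * e j) \<in> I" using c by simp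
    from indep_modD[OF assms(1) this] have 0: "c (?g j) = 0" if "j \<in> J" for j using that by blast
    show "\<forall>j\<in>{..<card J}. c j = 0"
    proof
      fix j assume "j \<in> {..<card J}"
      then show "c j = 0" using 0[of "h j"] h by (auto simp: bij_betw_def)
    qed
  qed simp
  moreover have "bihomog a b ((e \<circ> h) j)" if "j < card J" for j
    using assms(2) h that by (auto simp: bij_betw_def)
  ultimately show ?thesis by blast
qed

lemma hilb_ge:
  assumes I: "is_ideal I" and e: "indep_mod I J e" "\<And>j. j \<in> J \<Longrightarrow> bihomog a b (e j)"
  shows "card J \<le> hilb I a b"
  unfolding hilb_def
proof (rule Greatest_le_nat[where b = "card {m. bideg m = (a, b)}"])
  show "\<exists>e. indep_mod I {..<card J} e \<and> (\<forall>j<card J. bihomog a b (e j))"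
    using e by (rule indep_reindex)
next
  fix n :: nat assume "\<exists>e. indep_mod I {..<n} e \<and> (\<forall>j<n. bihomog a b (e j))"
  then obtain e where "indep_mod I {..<n} e" "\<And>j. j \<in> {..<n} \<Longrightarrow> bihomog a b (e j)" by auto
  then show "n \<le> card {m. bideg m = (a, b)}"
    using indep_le_span[OF I _ _ span_monomials[OF I]] by (metis card_lessThan)
qed

lemma hilb_basis:
  assumes I: "is_ideal I"
  obtains e where "indep_mod I {..<hilb I a b} e" "\<And>j. j < hilb I a b \<Longrightarrow> bihomog a b (e j)"
    "span_mod I a b {..<hilb I a b} e"
proof -
  let ?P = "\<lambda>n. \<exists>e. indep_mod I {..<n} e \<and> (\<forall>j<n. bihomog a b (e j))"
  have "?P (0 :: nat)" by (intro exI[of _ "\<lambda>_. 0"]) (auto simp: indep_mod_def)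
  moreover have "n \<le> card {m. bideg m = (a, b)}" if P: "?P n" for n :: nat
  proof -
    obtain e where "indep_mod I {..<n} e" "\<And>j. j \<in> {..<n} \<Longrightarrow> bihomog a b (e j)" using P by auto
    then show "n \<le> card {m. bideg m = (a, b)}"
      using indep_le_span[OF I _ _ span_monomials[OF I]] by (metis card_lessThan)
  qed
  ultimately have "?P (hilb I a b)"
    unfolding hilb_def by (rule GreatestI_nat[of ?P])
  then obtain e where e: "indep_mod I {..<hilb I a b} e" "\<And>j. j < hilb I a b \<Longrightarrow> bihomog a b (e j)" by blast
  let ?n = "hilb I a b"
  have "span_mod I a b {..<?n} e"
    unfolding span_mod_def
  proof (intro conjI allI impI)
    fix f :: "'a bipoly" assume f: "bihomog a b f"
    define e' where "e' = e(?n := f)"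
    have "\<not> indep_mod I {..<Suc ?n} e'"
    proof
      assume "indep_mod I {..<Suc ?n} e'"
      then have "card {..<Suc ?n} \<le> ?n"
        using e(2) f by (intro hilb_ge[OF I, of _ e']) (auto simp: e'_def)
      then show False by simp
    qed
    then obtain c where c: "(\<Sum>j<Suc ?n. cst (c j) * e' j) \<in> I" "\<exists>j<Suc ?n. c j \<noteq> 0"
      by (auto simp: indep_mod_def)
    have "(\<Sum>j<?n. cst (c j) * e' j) = (\<Sum>j<?n. cst (c j) * e j)"
      by (intro sum.cong) (auto simp: e'_def)
    then have c': "(\<Sum>j<?n. cst (c j) * e j) + cst (c ?n) * f \<in> I"
      using c(1) by (simp add: e'_def)
    have cn: "c ?n \<noteq> 0"
    proof
      assume 0: "c ?n = 0"
      then have "\<forall>j\<in>{..<?n}. c j = 0" using c' e(1) by (auto simp: indep_mod_def)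
      then show False using c(2) 0 by (auto simp: less_Suc_eq)
    qed
    let ?d = "\<lambda>j. - c j / c ?n"
    have "cst (1 / c ?n) * ((\<Sum>j<?n. cst (c j) * e j) + cst (c ?n) * f) =
        (\<Sum>j<?n. cst (c j / c ?n) * e j) + f"
      using cn by (simp add: distrib_left sum_distrib_left mult.assoc[symmetric] cst_mult)
    also have "\<dots> = f - (\<Sum>j<?n. cst (?d j) * e j)"
      by (simp add: single_uminus sum_negf)
    finally have "f - (\<Sum>j<?n. cst (?d j) * e j) \<in> I"
      using is_idealD(3)[OF I c', of "cst (1 / c ?n)"] by simp
    then show "\<exists>c. f - (\<Sum>j<?n. cst (c j) * e j) \<in> I" by (rule exI[of _ ?d])
  qed simp
  then show ?thesis using e that by blast
qed

lemma hilb_le: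
  assumes I: "is_ideal I" and "span_mod I a b K g"
  shows "hilb I a b \<le> card K"
proof -
  obtain e where "indep_mod I {..<hilb I a b} e" "\<And>j. j < hilb I a b \<Longrightarrow> bihomog a b (e j)"
    using hilb_basis[OF I] by blast
  then show ?thesis using indep_le_span[OF I, of "{..<hilb I a b}" e a b K g] assms by simp
qed

lemma hilb_antimono:
  assumes "is_ideal I" "is_ideal J" "I \<subseteq> J"
  shows "hilb J a b \<le> hilb I a b"
proof -
  obtain e where e: "indep_mod J {..<hilb J a b} e" "\<And>j. j < hilb J a b \<Longrightarrow> bihomog a b (e j)"
    using hilb_basis[OF assms(2)] by blast
  have "indep_mod I {..<hilb J a b} e" using e(1) assms(3) by (auto simp: indep_mod_def)
  then show ?thesis using hilb_ge[OF assms(1), of "{..<hilb J a b}" e a b] e(2) by simp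
qed

lemma hilb_eq_0:
  assumes "is_ideal I" "\<And>f. bihomog a b f \<Longrightarrow> f \<in> I"
  shows "hilb I a b = 0"
proof -
  have "span_mod I a b {} (\<lambda>_ :: nat. 0)" using assms(2) by (auto simp: span_mod_def)
  then show ?thesis using hilb_le[OF assms(1)] by fastforce
qed

lemma hilb_pos:
  assumes "is_ideal I" "bihomog a b f" "f \<notin> I"
  shows "1 \<le> hilb I a b"
proof -
  have "c = 0" if "cst c * f \<in> I" for c
  proof (rule ccontr)
    assume "c \<noteq> 0"
    then have "cst (1 / c) * (cst c * f) = f" by (simp add: mult.assoc[symmetric] cst_mult)
    then show False using is_idealD(3)[OF assms(1) that, of "cst (1 / c)"] assms(3) by simp
  qed
  then have "indep_mod I {()} (\<lambda>_. f)" by (simp add: indep_mod_def)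
  then have "card {()} \<le> hilb I a b" using assms by (intro hilb_ge) auto
  then show ?thesis by simp
qed

text \<open>Multiplication by a form \<open>h\<close> identifies \<open>S / (I : h)\<close>, with a shifted grading, with the
  kernel of \<open>S / I \<rightarrow> S / (I + h S)\<close>.\<close>

lemma hilb_adjoin:
  assumes I: "bihomog_ideal I" and h: "bihomog c d h"
  shows "hilb I a b = hilb (adjoin I h) a b + (if c \<le> a \<and> d \<le> b then hilb (colon I h) (a - c) (b - d) else 0)"
proof -
  note i = bihomog_idealD(1)[OF I]
  let ?P = "c \<le> a \<and> d \<le> b"
  define m where "m = (if ?P then hilb (colon I h) (a - c) (b - d) else 0)"
  let ?n = "hilb (adjoin I h) a b"
  obtain e where e: "indep_mod (adjoin I h) {..<?n} e" "\<And>j. j < ?n \<Longrightarrow> bihomog a b (e j)"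
      "span_mod (adjoin I h) a b {..<?n} e"
    using hilb_basis[OF is_ideal_adjoin[OF i]] by blast
  obtain g where g: "indep_mod (colon I h) {..<m} g" "\<And>j. j < m \<Longrightarrow> ?P \<and> bihomog (a - c) (b - d) (g j)"
      "?P \<Longrightarrow> span_mod (colon I h) (a - c) (b - d) {..<m} g"
  proof (cases ?P)
    case True
    obtain g where "indep_mod (colon I h) {..<m} g" "\<And>j. j < m \<Longrightarrow> bihomog (a - c) (b - d) (g j)"
      "span_mod (colon I h) (a - c) (b - d) {..<m} g"
      using hilb_basis[OF is_ideal_colon[OF i, of h], of "a - c" "b - d"] True by (auto simp: m_def)
    then show ?thesis using that True by blast
  next
    case False
    then have "m = 0" by (auto simp: m_def)
    then show ?thesis using that[of "\<lambda>_. 0"] False by (auto simp: indep_mod_def)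
  qed
  let ?J = "{..<?n} <+> {..<m}"
  let ?f = "case_sum e (\<lambda>j. g j * h)"
  have split: "(\<Sum>j\<in>?J. cst (x j) * ?f j) =
      (\<Sum>j<?n. cst (x (Inl j)) * e j) + (\<Sum>j<m. cst (x (Inr j)) * g j) * h" for x
    by (subst sum.Plus) (auto simp: sum_distrib_right mult.assoc)
  have "indep_mod I ?J ?f"
    unfolding indep_mod_def
  proof (intro conjI allI impI)
    fix x assume x: "(\<Sum>j\<in>?J. cst (x j) * ?f j) \<in> I"
    have "(\<Sum>j<?n. cst (x (Inl j)) * e j) =
      (\<Sum>j\<in>?J. cst (x j) * ?f j) + (- (\<Sum>j<m. cst (x (Inr j)) * g j)) * h"
      unfolding split by simp
    then have "(\<Sum>j<?n. cst (x (Inl j)) * e j) \<in> adjoin I h" using x unfolding adjoin_def by blast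
    from indep_modD[OF e(1) this] have 0: "\<forall>j\<in>{..<?n}. x (Inl j) = 0" by blast
    then have "(\<Sum>j<m. cst (x (Inr j)) * g j) * h \<in> I" using x unfolding split by simp
    then have "\<forall>j\<in>{..<m}. x (Inr j) = 0" using g(1) by (auto simp: indep_mod_def colon_def)
    then show "\<forall>j\<in>?J. x j = 0" using 0 by auto
  qed auto
  moreover have "bihomog a b (?f j)" if "j \<in> ?J" for j
  proof (cases j)
    case (Inr k)
    then have "?P" "bihomog (a - c) (b - d) (g k)" using that g(2) by auto
    then have "bihomog (a - c + c) (b - d + d) (g k * h)" using h by (intro bihomog_mult)
    then show ?thesis using Inr \<open>?P\<close> by simp
  qed (use that e(2) in auto)
  ultimately have "card ?J \<le> hilb I a b" using i by (intro hilb_ge)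
  moreover have "span_mod I a b ?J ?f"
    unfolding span_mod_def
  proof (intro conjI allI impI)
    fix f :: "'a bipoly" assume f: "bihomog a b f"
    obtain x where x: "f - (\<Sum>j<?n. cst (x j) * e j) \<in> adjoin I h"
      using e(3) f by (auto simp: span_mod_def)
    define f' where "f' = f - (\<Sum>j<?n. cst (x j) * e j)"
    have f': "bihomog a b f'" unfolding f'_def
      using e(2) f by (intro bihomog_diff bihomog_sum bihomog_cst_mult) auto
    obtain i0 r where ir: "f' = i0 + r * h" "i0 \<in> I" using x unfolding f'_def adjoin_def by blast
    have pf: "f' = part a b i0 + part a b (h * r)"
      using part_bihomog[OF f', of a b] ir(1) by (simp add: part_add mult.commute)
    have pi: "part a b i0 \<in> I" using bihomog_idealD(2)[OF I ir(2)] .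
    show "\<exists>c. f - (\<Sum>j\<in>?J. cst (c j) * ?f j) \<in> I"
    proof (cases ?P)
      case True
      let ?r = "part (a - c) (b - d) r"
      obtain y where y: "?r - (\<Sum>j<m. cst (y j) * g j) \<in> colon I h"
        using g(3)[OF True] bihomog_part[of "a - c" "b - d" r] unfolding span_mod_def by blast
      have "f - (\<Sum>j\<in>?J. cst (case_sum x y j) * ?f j) = f' - (\<Sum>j<m. cst (y j) * g j) * h"
        unfolding split f'_def by simp
      also have "\<dots> = part a b i0 + (?r - (\<Sum>j<m. cst (y j) * g j)) * h"
        using True by (simp add: pf part_form_mult[OF h] algebra_simps)
      also have "\<dots> \<in> I" using pi y i by (intro is_idealD(2)) (auto simp: colon_def)
      finally show ?thesis by blast
    next
      case False
      then have "m = 0" by (auto simp: m_def)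
      have "f - (\<Sum>j\<in>?J. cst (case_sum x (\<lambda>_. 0) j) * ?f j) = f'"
        unfolding split f'_def by simp
      moreover have "part a b (h * r) = 0" using False part_form_mult[OF h, of a b r] by presburger
      ultimately have "f - (\<Sum>j\<in>?J. cst (case_sum x (\<lambda>_. 0) j) * ?f j) \<in> I" using pf pi by simp
      then show ?thesis by (rule exI[of _ "case_sum x (\<lambda>_. 0)"])
    qed
  qed auto
  then have "hilb I a b \<le> card ?J" using i by (intro hilb_le)
  ultimately show ?thesis by (simp add: card_Plus m_def)
qed

section \<open>Noetherian induction and prime filtrations\<close>

lemma nat_seq_incseq:
  fixes s :: "nat \<Rightarrow> nat"
  shows "\<exists>r. strict_mono r \<and> incseq (\<lambda>i. s (r i))"
proof -
  obtain f where f: "strict_mono f" "monoseq (\<lambda>n. s (f n))" using seq_monosub by blast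
  show ?thesis
  proof (cases "incseq (\<lambda>n. s (f n))")
    case False
    then have dec: "decseq (\<lambda>n. s (f n))" using f(2) by (auto simp: monoseq_iff)
    obtain N where N: "\<And>n. s (f N) \<le> s (f n)"
      using ex_has_least_nat[of "\<lambda>_. True" 0 "\<lambda>n. s (f n)"] by auto
    have "s (f (N + n)) = s (f N)" for n
      using N[of "N + n"] decseqD[OF dec, of N "N + n"] by simp
    moreover have "strict_mono (\<lambda>n. f (N + n))" using f(1) by (simp add: strict_mono_def)
    ultimately show ?thesis by (intro exI[of _ "\<lambda>n. f (N + n)"]) (simp add: incseq_def)
  qed (use f in blast)
qed

text \<open>Pass to subsequences that are nondecreasing in one coordinate after the other.\<close>

lemma dickson:
  fixes l :: "nat \<Rightarrow> 'v::finite \<Rightarrow> nat"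
  shows "\<exists>i j. i < j \<and> (\<forall>v. l i v \<le> l j v)"
proof -
  have "\<exists>r. strict_mono r \<and> (\<forall>v\<in>V. incseq (\<lambda>i. l (r i) v))" if "finite V" for V :: "'v set"
    using that
  proof induction
    case empty
    show ?case by (intro exI[of _ "\<lambda>n. n"]) (simp add: strict_mono_def)
  next
    case (insert v V)
    then obtain r where r: "strict_mono r" "\<And>v. v \<in> V \<Longrightarrow> incseq (\<lambda>i. l (r i) v)" by blast
    obtain q where q: "strict_mono q" "incseq (\<lambda>i. l (r (q i)) v)"
      using nat_seq_incseq[of "\<lambda>i. l (r i) v"] by blast
    have "incseq (\<lambda>i. l (r (q i)) w)" if "w \<in> V" for w
      using r(2)[OF that] q(1) by (simp add: incseq_def strict_mono_less_eq)
    moreover have "strict_mono (\<lambda>i. r (q i))" using r(1) q(1) by (simp add: strict_mono_def)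
    ultimately show ?case using q(2) by (intro exI[of _ "\<lambda>i. r (q i)"]) auto
  qed
  from this[of UNIV] obtain r where r: "strict_mono r" "\<And>v. incseq (\<lambda>i. l (r i) v)" by auto
  have "r 0 < r 1" using r(1) by (simp add: strict_mono_def)
  moreover have "l (r 0) v \<le> l (r 1) v" for v using r(2)[of v] by (simp add: incseq_def)
  ultimately show ?thesis by blast
qed

text \<open>The exponent of the image of the monomial \<open>m\<close> under the substitution of the monomial with exponent
  \<open>e v\<close> for each variable \<open>v\<close>.\<close>

definition expo :: "('v::finite \<Rightarrow> nat \<Rightarrow>\<^sub>0 nat) \<Rightarrow> ('v \<Rightarrow>\<^sub>0 nat) \<Rightarrow> nat \<Rightarrow>\<^sub>0 nat" where
  "expo e m = (\<Sum>v\<in>UNIV. Poly_Mapping.map ((*) (lookup m v)) (e v))"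

lemma lookup_expo: "lookup (expo e m) k = (\<Sum>v\<in>UNIV. lookup m v * lookup (e v) k)"
  unfolding expo_def lookup_sum by (intro sum.cong) (auto simp: Poly_Mapping.map.rep_eq when_def)

lemma expo_add: "expo e (m + n) = expo e m + expo e n"
  by (rule poly_mapping_eqI) (simp add: lookup_expo lookup_add distrib_right sum.distrib)

lemma expo_zero [simp]: "expo e 0 = 0"
  by (rule poly_mapping_eqI) (simp add: lookup_expo)

definition var_index :: "3 + 3 \<Rightarrow> nat" where
  "var_index = (SOME f. inj f)"

lemma inj_var_index: "inj var_index"
proof -
  have "\<exists>f :: 3 + 3 \<Rightarrow> nat. inj f"
    using finite_imp_inj_to_nat_seg[of "UNIV :: (3 + 3) set"] by auto
  then show ?thesis unfolding var_index_def by (rule someI_ex)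
qed

text \<open>The lexicographic order on \<open>nat \<Rightarrow>\<^sub>0 nat\<close> makes this embedding a monomial order.\<close>

definition mon_key :: "(3 + 3 \<Rightarrow>\<^sub>0 nat) \<Rightarrow> nat \<Rightarrow>\<^sub>0 nat" where
  "mon_key = expo (\<lambda>v. single (var_index v) 1)"

lemma lookup_mon_key: "lookup (mon_key m) (var_index v) = lookup m v"
proof -
  have "lookup (mon_key m) (var_index v) = (\<Sum>w\<in>UNIV. if w = v then lookup m w else 0)"
    unfolding mon_key_def lookup_expo
    by (intro sum.cong) (auto simp: lookup_single when_def inj_eq[OF inj_var_index])
  then show ?thesis by simp
qed

lemma inj_mon_key: "mon_key m = mon_key n \<Longrightarrow> m = n"
  by (rule poly_mapping_eqI) (metis lookup_mon_key)

lemma mon_key_add: "mon_key (m + n) = mon_key m + mon_key n"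
  by (simp add: mon_key_def expo_add)

lemma lead_exists:
  assumes "f \<noteq> 0"
  shows "\<exists>m\<in>keys f. mon_key m = Max (mon_key ` keys f)"
proof -
  have "Max (mon_key ` keys f) \<in> mon_key ` keys f" using assms by (intro Max_in) auto
  then show ?thesis by auto
qed

text \<open>In each step choose a new form whose leading monomial is as small as possible for its bidegree.  By
  Dickson's lemma one of these leading monomials divides a later one, and cancelling the later leading
  term by a multiple of the earlier form produces a smaller new form.\<close>

lemma no_ascending_chain:
  fixes I :: "nat \<Rightarrow> 'k::field bipoly set"
  assumes I: "\<And>n. bihomog_ideal (I n)" and asc: "\<And>n. I n \<subset> I (Suc n)"
  shows False
proof -
  note i = bihomog_idealD(1)[OF I]
  let ?M = "\<lambda>f :: 'k bipoly. Max (mon_key ` keys f)"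
  have "\<exists>a b f. bihomog a b f \<and> f \<in> I (Suc n) \<and> f \<notin> I n \<and>
      (\<forall>g. bihomog a b g \<longrightarrow> g \<in> I (Suc n) \<longrightarrow> g \<notin> I n \<longrightarrow> ?M f \<le> ?M g)" for n
  proof -
    have "\<not> I (Suc n) \<subseteq> I n" using asc[of n] by auto
    then obtain a b f where f: "bihomog a b f" "f \<in> I (Suc n)" "f \<notin> I n"
      using form_in_diff[OF I i] by blast
    let ?F = "{f. bihomog a b f \<and> f \<in> I (Suc n) \<and> f \<notin> I n}"
    have "?M ` ?F \<subseteq> mon_key ` {m. bideg m = (a, b)}"
    proof
      fix x assume "x \<in> ?M ` ?F"
      then obtain g where g: "x = ?M g" "bihomog a b g" "g \<notin> I n" by auto
      then have "g \<noteq> 0" using is_idealD(1)[OF i] by auto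
      then show "x \<in> mon_key ` {m. bideg m = (a, b)}"
        using lead_exists[of g] g by (metis (mono_tags, lifting) bihomog_iff image_eqI mem_Collect_eq)
    qed
    then have fin: "finite (?M ` ?F)" by (rule finite_subset) (simp add: finite_bideg)
    have "Min (?M ` ?F) \<in> ?M ` ?F" using f fin by (intro Min_in) auto
    then obtain g where g: "g \<in> ?F" "?M g = Min (?M ` ?F)" by auto
    have "?M g \<le> ?M h" if "h \<in> ?F" for h using g(2) fin that by (auto intro: Min_le)
    then show ?thesis using g(1) by blast
  qed
  then obtain a b f where f: "\<And>n. bihomog (a n) (b n) (f n)" "\<And>n. f n \<in> I (Suc n)" "\<And>n. f n \<notin> I n"
    "\<And>n g. bihomog (a n) (b n) g \<Longrightarrow> g \<in> I (Suc n) \<Longrightarrow> g \<notin> I n \<Longrightarrow> ?M (f n) \<le> ?M g"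
    by metis
  have "f n \<noteq> 0" for n using f(3) is_idealD(1)[OF i] by metis
  then have "\<forall>n. \<exists>m. m \<in> keys (f n) \<and> mon_key m = ?M (f n)" using lead_exists by blast
  then obtain l where l: "\<And>n. l n \<in> keys (f n)" "\<And>n. mon_key (l n) = ?M (f n)" by metis
  obtain i j where ij: "i < j" "\<And>v. lookup (l i) v \<le> lookup (l j) v"
    using dickson[of "\<lambda>n. lookup (l n)"] by blast
  \<comment> \<open>The multiple of \<open>f i\<close> with the same leading term as \<open>f j\<close>.\<close>
  define m where "m = l j - l i"
  have m: "m + l i = l j" by (rule poly_mapping_eqI) (simp add: m_def lookup_add lookup_minus ij(2))
  have mono: "I p \<subseteq> I q" if "p \<le> q" for p q using that
    by (rule lift_Suc_mono_le[of I, rotated]) (use asc in blast)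
  define c where "c = lookup (f j) (l j) / lookup (f i) (l i)"
  define q where "q = single m c * f i"
  define g where "g = f j - q"
  have "f i \<in> I j" using f(2)[of i] mono[of "Suc i" j] ij(1) by auto
  then have q: "q \<in> I j" unfolding q_def using i by (intro is_idealD(3))
  have keysq: "keys q \<subseteq> (\<lambda>n. m + n) ` keys (f i)" unfolding q_def by (rule keys_single_mult)
  have deg: "bideg (l n) = (a n, b n)" for n using f(1)[of n] l(1)[of n] by (simp add: bihomog_iff)
  have "bihomog (a j) (b j) q"
    unfolding bihomog_iff
  proof
    fix k assume "k \<in> keys q"
    then obtain n where n: "k = m + n" "n \<in> keys (f i)" using keysq by auto
    then have "bideg n = bideg (l i)" using f(1)[of i] deg[of i] by (simp add: bihomog_iff)
    then have "bideg k = bideg (m + l i)" using n by (simp add: bideg_add)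
    then show "bideg k = (a j, b j)" using m deg by simp
  qed
  then have gb: "bihomog (a j) (b j) g" unfolding g_def using f(1) by (intro bihomog_diff)
  have gin: "g \<in> I (Suc j)" unfolding g_def using f(2)[of j] q mono[of j "Suc j"] i
    by (intro is_idealD(6)) auto
  have gnotin: "g \<notin> I j"
  proof
    assume "g \<in> I j"
    then have "g + q \<in> I j" using q i by (intro is_idealD(2))
    then show False using f(3)[of j] by (simp add: g_def)
  qed
  then have "g \<noteq> 0" using is_idealD(1)[OF i] by auto
  have "lookup q (l j) = c * lookup (f i) (l i)" unfolding q_def m[symmetric] by (rule lookup_single_mult)
  also have "\<dots> = lookup (f j) (l j)" using l(1)[of i] by (simp add: c_def in_keys_iff)
  finally have lj: "l j \<notin> keys g" by (simp add: g_def in_keys_iff lookup_minus)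
  have le: "mon_key k \<le> mon_key (l n)" if "k \<in> keys (f n)" for k n
    unfolding l(2) using that by (intro Max_ge) auto
  have less: "mon_key k < mon_key (l j)" if k: "k \<in> keys g" for k
  proof -
    have "k \<in> keys (f j) \<union> keys q" using k keys_diff[of "f j" q] by (auto simp: g_def in_keys_iff lookup_minus)
    then have "mon_key k \<le> mon_key (l j)"
    proof
      assume "k \<in> keys q"
      then obtain n where n: "k = m + n" "n \<in> keys (f i)" using keysq by auto
      then show ?thesis using le[OF n(2)] by (simp add: m[symmetric] mon_key_add add_left_mono)
    qed (rule le)
    moreover have "mon_key k \<noteq> mon_key (l j)" using lj k inj_mon_key by auto
    ultimately show ?thesis by simp
  qed
  have "?M g < mon_key (l j)"
    using lead_exists[OF \<open>g \<noteq> 0\<close>] less by fastforce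
  moreover have "?M (f j) \<le> ?M g" using f(4)[OF gb gin gnotin] .
  ultimately show False using l(2)[of j] by simp
qed

lemma wf_bihomog_ideals: "wf {(J, I). bihomog_ideal J \<and> bihomog_ideal I \<and> I \<subset> (J :: 'k::field bipoly set)}"
  unfolding wf_iff_no_infinite_down_chain
proof (rule notI, elim exE)
  fix I :: "nat \<Rightarrow> 'k bipoly set"
  assume "\<forall>n. (I (Suc n), I n) \<in> {(J, I). bihomog_ideal J \<and> bihomog_ideal I \<and> I \<subset> J}"
  then show False using no_ascending_chain[of I] by blast
qed

definition gprime :: "'k::field bipoly set \<Rightarrow> bool" where
  "gprime Q \<longleftrightarrow> bihomog_ideal Q \<and> 1 \<notin> Q \<and> (\<forall>f g. f * g \<in> Q \<longrightarrow> f \<in> Q \<or> g \<in> Q)"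

lemma gprimeD:
  assumes "gprime Q"
  shows "bihomog_ideal Q" "is_ideal Q" "1 \<notin> Q" "f * g \<in> Q \<Longrightarrow> f \<in> Q \<or> g \<in> Q"
  using assms bihomog_idealD(1) by (auto simp: gprime_def)

lemma gprime_power: "gprime Q \<Longrightarrow> f ^ n \<in> Q \<Longrightarrow> f \<in> Q"
  by (induction n) (auto dest: gprimeD)

lemma colon_prime:
  assumes "gprime Q" "h \<notin> Q"
  shows "colon Q h = Q"
  using gprimeD(4)[OF assms(1)] assms(2) is_idealD(4)[OF gprimeD(2)[OF assms(1)]]
  by (auto simp: colon_def)

text \<open>A maximal element among the annihilators of forms is prime.\<close>

lemma associated_prime:
  fixes I :: "'k::field bipoly set"
  assumes I: "bihomog_ideal I" and "1 \<notin> I"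
  shows "\<exists>c d h. bihomog c d h \<and> h \<notin> I \<and> gprime (colon I h)"
proof -
  let ?X = "{colon I h |h. \<exists>c d. bihomog c d h \<and> h \<notin> I}"
  have "colon I 1 \<in> ?X" using assms bihomog_one by blast
  from wfE_min[OF wf_bihomog_ideals this] obtain Q where Q: "Q \<in> ?X" "\<And>J. (J, Q) \<in> {(J, I). bihomog_ideal J \<and> bihomog_ideal I \<and> I \<subset> (J :: 'k bipoly set)} \<Longrightarrow> J \<notin> ?X"
    by blast
  obtain c d h where h: "Q = colon I h" "bihomog c d h" "h \<notin> I" using Q(1) by blast
  have bQ: "bihomog_ideal Q" unfolding h(1) using I h(2) by (rule bihomog_ideal_colon)
  have "f \<in> Q \<or> g \<in> Q" if f: "bihomog p q f" and g: "bihomog r s g" and fg: "f * g \<in> Q" for p q r s f g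
  proof (rule disjCI)
    assume "g \<notin> Q"
    then have gh: "g * h \<notin> I" by (simp add: h(1) colon_def)
    have bgh: "bihomog (r + c) (s + d) (g * h)" using g h(2) by (rule bihomog_mult)
    have "colon I (g * h) \<in> ?X" using gh bgh by blast
    then have "\<not> Q \<subset> colon I (g * h)"
      using Q(2) bQ bihomog_ideal_colon[OF I bgh] by blast
    moreover have "Q \<subseteq> colon I (g * h)"
      using is_idealD(3)[OF bihomog_idealD(1)[OF I], of _ g] by (auto simp: h(1) colon_def mult.left_commute[of _ g])
    ultimately have "Q = colon I (g * h)" by blast
    moreover have "f \<in> colon I (g * h)" using fg by (simp add: h(1) colon_def mult.assoc)
    ultimately show "f \<in> Q" by simp
  qed
  then have "gprime Q"
    unfolding gprime_def using bQ h(1,3) prime_if_prime_on_forms[OF bQ] by (auto simp: colon_def)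
  then show ?thesis using h by blast
qed

text \<open>A filtration of \<open>S / I\<close> with factors \<open>S / Q\<close>, where \<open>Q = I : h\<close> is prime and \<open>(c, d)\<close> is the bidegree of
  the generator \<open>h\<close> of the factor.\<close>

inductive filtration :: "'k::field bipoly set \<Rightarrow> (nat \<times> nat \<times> 'k bipoly set) list \<Rightarrow> bool" where
  filtration_UNIV: "filtration UNIV []"
| filtration_step: "bihomog_ideal I \<Longrightarrow> bihomog c d h \<Longrightarrow> h \<notin> I \<Longrightarrow> gprime (colon I h) \<Longrightarrow>
    filtration (adjoin I h) L \<Longrightarrow> filtration I ((c, d, colon I h) # L)"

lemma filtration_exists: "bihomog_ideal I \<Longrightarrow> \<exists>L. filtration I L"
proof (induction I rule: wf_induct_rule[OF wf_bihomog_ideals])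
  case (1 I)
  show ?case
  proof (cases "1 \<in> I")
    case True
    then have "I = UNIV" using is_idealD(3)[OF bihomog_idealD(1)[OF 1(2)], of 1] by auto
    then show ?thesis using filtration_UNIV by blast
  next
    case False
    then obtain c d h where h: "bihomog c d h" "h \<notin> I" "gprime (colon I h)"
      using associated_prime 1(2) by blast
    have "bihomog_ideal (adjoin I h)" using 1(2) h(1) by (rule bihomog_ideal_adjoin)
    moreover have "I \<subset> adjoin I h"
      using adjoin_superset[of I h] in_adjoin[OF bihomog_idealD(1)[OF 1(2)], of h] h(2) by blast
    ultimately obtain L where "filtration (adjoin I h) L" using 1 by blast
    then show ?thesis using filtration_step[OF 1(2) h] by blast
  qed
qed

lemma filtration_hilb:
  "filtration I L \<Longrightarrow>
     hilb I a b = (\<Sum>(c, d, Q)\<leftarrow>L. if c \<le> a \<and> d \<le> b then hilb Q (a - c) (b - d) else 0)"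
proof (induction rule: filtration.induct)
  case filtration_UNIV
  have "hilb (UNIV :: 'a bipoly set) a b = 0" by (rule hilb_eq_0) (simp_all add: is_ideal_def)
  then show ?case by simp
next
  case (filtration_step I c d h L)
  then show ?case by (simp add: hilb_adjoin[of I c d h a b])
qed

lemma filtration_primes:
  "filtration I L \<Longrightarrow> (c, d, Q) \<in> set L \<Longrightarrow> gprime Q \<and> I \<subseteq> Q"
proof (induction arbitrary: c d Q rule: filtration.induct)
  case (filtration_step I c' d' h L)
  then show ?case
    using colon_superset[of I h] adjoin_superset[of I h] bihomog_idealD(1) by fastforce
qed simp

section \<open>Orders of vanishing\<close>

lemma chain_length_eqI:
  assumes "\<exists>c. (\<forall>i\<le>n. c i \<in> C) \<and> (\<forall>i<n. c i \<subset> c (Suc i))"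
    and "\<And>m c. (\<forall>i\<le>m. c i \<in> C) \<Longrightarrow> (\<forall>i<m. c i \<subset> c (Suc i)) \<Longrightarrow> m \<le> n"
  shows "chain_length C = enat n"
  unfolding chain_length_def
proof (rule antisym)
  show "Sup (enat ` {n. \<exists>c. (\<forall>i\<le>n. c i \<in> C) \<and> (\<forall>i<n. c i \<subset> c (Suc i))}) \<le> enat n"
    using assms(2) by (intro Sup_least) auto
  show "enat n \<le> Sup (enat ` {n. \<exists>c. (\<forall>i\<le>n. c i \<in> C) \<and> (\<forall>i<n. c i \<subset> c (Suc i))})"
    using assms(1) by (intro Sup_upper) auto
qed

definition local_above :: "'k::field bipoly set \<Rightarrow> 'k bipoly set \<Rightarrow> 'k bipoly set set" where
  "local_above Z I = {J \<in> local_ideals Z. I \<subseteq> J}"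

lemma local_idealsD:
  assumes "J \<in> local_ideals Z"
  shows "bihomog_ideal J" "is_ideal J" "bihomog c d s \<Longrightarrow> s \<notin> Z \<Longrightarrow> s * a \<in> J \<Longrightarrow> a \<in> J"
  using assms bihomog_idealD(1) unfolding local_ideals_def by blast+

text \<open>The extension of \<open>I\<close> to the local ring along \<open>Z\<close>, contracted to \<open>S\<close>.\<close>

definition saturate :: "'k::field bipoly set \<Rightarrow> 'k bipoly set \<Rightarrow> 'k bipoly set" where
  "saturate Z I = {a. \<exists>s c d. bihomog c d s \<and> s \<notin> Z \<and> s * a \<in> I}"

lemma saturate_superset: "gprime Z \<Longrightarrow> I \<subseteq> saturate Z I"
  unfolding saturate_def using bihomog_one gprimeD(3) by (metis (mono_tags, lifting) mem_Collect_eq mult_1 subsetI)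

lemma saturate_local:
  assumes Z: "gprime Z" and I: "bihomog_ideal I"
  shows "saturate Z I \<in> local_ideals Z"
proof -
  note i = bihomog_idealD(1)[OF I]
  have "is_ideal (saturate Z I)"
    unfolding is_ideal_def
  proof (intro conjI ballI allI)
    show "0 \<in> saturate Z I" using saturate_superset[OF Z, of I] is_idealD(1)[OF i] by auto
  next
    fix a b assume "a \<in> saturate Z I" "b \<in> saturate Z I"
    then obtain s t c d p q where *: "bihomog c d s" "s \<notin> Z" "s * a \<in> I" "bihomog p q t" "t \<notin> Z" "t * b \<in> I"
      by (auto simp: saturate_def)
    have "bihomog (c + p) (d + q) (s * t)" using * by (intro bihomog_mult)
    moreover have "s * t \<notin> Z" using * gprimeD(4)[OF Z] by blast
    moreover have "s * t * (a + b) \<in> I"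
    proof -
      have "s * t * (a + b) = t * (s * a) + s * (t * b)" by (simp add: algebra_simps)
      then show ?thesis using * i by (auto intro: is_idealD)
    qed
    ultimately show "a + b \<in> saturate Z I" by (auto simp: saturate_def)
  next
    fix r a assume "a \<in> saturate Z I"
    then obtain s c d where s: "bihomog c d s" "s \<notin> Z" "s * a \<in> I" by (auto simp: saturate_def)
    have "s * (r * a) \<in> I" using is_idealD(3)[OF i s(3), of r] by (simp add: mult.left_commute)
    then show "r * a \<in> saturate Z I" using s by (auto simp: saturate_def)
  qed
  moreover have "part p q f \<in> saturate Z I" if f: "f \<in> saturate Z I" for f p q
  proof -
    obtain s c d where s: "bihomog c d s" "s \<notin> Z" "s * f \<in> I" using f unfolding saturate_def by blast
    have "part (c + p) (d + q) (s * f) \<in> I" using bihomog_idealD(2)[OF I s(3)] .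
    then have "s * part p q f \<in> I" by (simp add: part_form_mult[OF s(1)])
    then show ?thesis using s by (auto simp: saturate_def)
  qed
  moreover have "a \<in> saturate Z I" if s: "bihomog c d s" "s \<notin> Z" "s * a \<in> saturate Z I" for a c d s
  proof -
    obtain t p q where t: "bihomog p q t" "t \<notin> Z" "t * (s * a) \<in> I" using s by (auto simp: saturate_def)
    have "bihomog (p + c) (q + d) (t * s)" using t s by (intro bihomog_mult)
    moreover have "t * s \<notin> Z" using s t gprimeD(4)[OF Z] by blast
    moreover have "t * s * a \<in> I" using t by (simp add: mult.assoc)
    ultimately show ?thesis by (auto simp: saturate_def)
  qed
  ultimately show ?thesis by (auto simp: local_ideals_def bihomog_ideal_iff)
qed

lemma saturate_least: "J \<in> local_ideals Z \<Longrightarrow> I \<subseteq> J \<Longrightarrow> saturate Z I \<subseteq> J"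
  unfolding saturate_def using local_idealsD(3) by blast

lemma saturate_mono: "I \<subseteq> J \<Longrightarrow> saturate Z I \<subseteq> saturate Z J"
  by (auto simp: saturate_def)

lemma saturate_local_eq: "gprime Z \<Longrightarrow> J \<in> local_ideals Z \<Longrightarrow> saturate Z J = J"
  using saturate_superset saturate_least by blast

lemma prime_local: "gprime Z \<Longrightarrow> Z \<in> local_ideals Z"
  by (auto simp: local_ideals_def gprime_def)

lemma UNIV_local: "UNIV \<in> local_ideals Z"
  by (auto simp: local_ideals_def bihomog_ideal_iff is_ideal_def)

lemma local_maximal:
  assumes "J \<in> local_ideals Z" "is_ideal Z" "\<not> J \<subseteq> Z"
  shows "J = UNIV"
proof -
  obtain a b f where f: "bihomog a b f" "f \<in> J" "f \<notin> Z"
    using form_in_diff[OF local_idealsD(1)[OF assms(1)] assms(2,3)] by blast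
  have "1 \<in> J" using local_idealsD(3)[OF assms(1) f(1,3), of 1] f(2) by simp
  then show ?thesis using is_idealD(3)[OF local_idealsD(2)[OF assms(1)], of 1] by auto
qed

lemma colon_local:
  assumes "J \<in> local_ideals Z" "bihomog c d h"
  shows "colon J h \<in> local_ideals Z"
  using assms bihomog_ideal_colon[OF local_idealsD(1)[OF assms(1)] assms(2)]
  by (auto simp: local_ideals_def colon_def mult.assoc)

definition mult_in :: "'k::field bipoly set \<Rightarrow> (nat \<times> nat \<times> 'k bipoly set) list \<Rightarrow> nat" where
  "mult_in Z L = length (filter (\<lambda>(c, d, Q). Q = Z) L)"

text \<open>The length of the localized quotient.  Steps with \<open>I : h\<close> different from \<open>Z\<close> disappear in the
  local ring.  In a step with \<open>I : h = Z\<close>, the map that adjoins \<open>h\<close> and saturates can identify two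
  comparable local ideals only if \<open>h\<close> lies in the larger and not in the smaller one; adding 1 to the
  rank of the ideals that contain \<open>h\<close> therefore keeps the rank strictly monotone.\<close>

lemma filtration_length:
  assumes "filtration I L" and Z: "gprime Z" and "\<forall>(c, d, Q)\<in>set L. Q = Z \<or> \<not> Q \<subseteq> Z"
  shows "(\<exists>l :: _ \<Rightarrow> nat. (\<forall>J\<in>local_above Z I. l J \<le> mult_in Z L) \<and>
      (\<forall>J\<in>local_above Z I. \<forall>K\<in>local_above Z I. J \<subset> K \<longrightarrow> l J < l K)) \<and>
    (\<exists>c. (\<forall>i\<le>mult_in Z L. c i \<in> local_above Z I) \<and> (\<forall>i<mult_in Z L. c i \<subset> c (Suc i)))"
  using assms(1,3)
proof (induction rule: filtration.induct)
  case filtration_UNIV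
  show ?case
    by (rule conjI, rule exI[of _ "\<lambda>_. 0"], force simp: local_above_def, rule exI[of _ "\<lambda>_. UNIV"])
      (simp add: local_above_def UNIV_local mult_in_def)
next
  case (filtration_step I c d h L)
  note i = bihomog_idealD(1)[OF filtration_step(1)]
  have "\<forall>(c, d, Q)\<in>set L. Q = Z \<or> \<not> Q \<subseteq> Z" using filtration_step(7) by simp
  note IH = filtration_step(6)[OF this]
  from conjunct1[OF IH] obtain l :: "_ \<Rightarrow> nat" where
    l0: "(\<forall>J\<in>local_above Z (adjoin I h). l J \<le> mult_in Z L) \<and>
      (\<forall>J\<in>local_above Z (adjoin I h). \<forall>K\<in>local_above Z (adjoin I h). J \<subset> K \<longrightarrow> l J < l K)"
    by (rule exE)
  have l: "\<And>J. J \<in> local_above Z (adjoin I h) \<Longrightarrow> l J \<le> mult_in Z L"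
       "\<And>J K. J \<in> local_above Z (adjoin I h) \<Longrightarrow> K \<in> local_above Z (adjoin I h) \<Longrightarrow> J \<subset> K \<Longrightarrow> l J < l K"
    using l0 by blast+
  obtain ch where
    ch: "\<And>i. i \<le> mult_in Z L \<Longrightarrow> ch i \<in> local_above Z (adjoin I h)" "\<And>i. i < mult_in Z L \<Longrightarrow> ch i \<subset> ch (Suc i)"
    using IH by blast
  have local_above_adj: "local_above Z (adjoin I h) = {J \<in> local_above Z I. h \<in> J}"
    using adjoin_superset[of I h] in_adjoin[OF i, of h] adjoin_least local_idealsD(2)
    unfolding local_above_def by blast
  show ?case
  proof (cases "colon I h = Z")
    case False
    then have "\<not> colon I h \<subseteq> Z" using filtration_step(7) by auto
    then obtain p q s where s: "bihomog p q s" "s \<in> colon I h" "s \<notin> Z"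
      using form_in_diff[OF gprimeD(1)[OF filtration_step(4)] gprimeD(2)[OF Z]] by blast
    have "h \<in> J" if "J \<in> local_above Z I" for J
      using that s local_idealsD(3)[of J Z p q s h] by (auto simp: local_above_def colon_def)
    then have "local_above Z (adjoin I h) = local_above Z I" using local_above_adj by blast
    moreover have "mult_in Z ((c, d, colon I h) # L) = mult_in Z L" using False by (simp add: mult_in_def)
    ultimately show ?thesis using IH by simp
  next
    case True
    then have mult: "mult_in Z ((c, d, colon I h) # L) = Suc (mult_in Z L)" by (simp add: mult_in_def)
    define up where "up J = saturate Z (adjoin J h)" for J
    have up: "up J \<in> local_above Z (adjoin I h)" if "J \<in> local_above Z I" for J
    proof -
      have J: "J \<in> local_ideals Z" "I \<subseteq> J" using that by (auto simp: local_above_def)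
      have "adjoin I h \<subseteq> adjoin J h" using J by (auto simp: adjoin_def)
      also have "\<dots> \<subseteq> up J" unfolding up_def by (rule saturate_superset[OF Z])
      finally show ?thesis
        using saturate_local[OF Z bihomog_ideal_adjoin[OF local_idealsD(1)[OF J(1)] filtration_step(2)]]
        by (auto simp: local_above_def up_def)
    qed
    have up_eq: "up J = J" if "J \<in> local_above Z I" "h \<in> J" for J
    proof -
      have J: "J \<in> local_ideals Z" using that by (auto simp: local_above_def)
      have "adjoin J h = J" using adjoin_least[OF local_idealsD(2)[OF J], of J h] adjoin_superset that by blast
      then show ?thesis using saturate_local_eq[OF Z J] by (simp add: up_def)
    qed
    have up_mono: "up J \<subseteq> up K" if "J \<subseteq> K" for J K
      unfolding up_def using that by (intro saturate_mono) (auto simp: adjoin_def)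
    have up_strict: "up J \<subset> up K" if JK: "J \<in> local_above Z I" "K \<in> local_above Z I" "J \<subset> K" "h \<notin> K" for J K
    proof (rule ccontr)
      assume "\<not> up J \<subset> up K"
      then have eq: "up J = up K" using up_mono[of J K] JK by blast
      have J: "J \<in> local_ideals Z" "I \<subseteq> J" and K: "K \<in> local_ideals Z" "I \<subseteq> K" using JK by (auto simp: local_above_def)
      note jd = local_idealsD[OF J(1)] and kd = local_idealsD[OF K(1)]
      obtain a where a: "a \<in> K" "a \<notin> J" using JK by blast
      have "K \<subseteq> up K" unfolding up_def using saturate_superset[OF Z] adjoin_superset by blast
      then have "a \<in> saturate Z (adjoin J h)" using a eq by (auto simp: up_def)
      then obtain s p q j r where s: "bihomog p q s" "s \<notin> Z" "s * a = j + r * h" "j \<in> J"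
        by (auto simp: saturate_def adjoin_def)
      have "s * a - j \<in> K" using a s JK by (intro is_idealD(6)[OF kd(2)] is_idealD(3)[OF kd(2)]) auto
      then have "r \<in> colon K h" using s by (simp add: colon_def)
      have "1 \<notin> colon K h" using JK by (simp add: colon_def)
      then have "colon K h \<subseteq> Z"
        using local_maximal[OF colon_local[OF K(1) filtration_step(2)] gprimeD(2)[OF Z]] by auto
      then have "r * h \<in> I" using \<open>r \<in> colon K h\<close> True by (auto simp: colon_def)
      then have "s * a \<in> J" using s J by (auto intro: is_idealD(2)[OF jd(2)])
      then show False using jd(3)[OF s(1,2)] a by blast
    qed
    define l' where "l' J = l (up J) + (if h \<in> J then 1 else 0)" for J
    have "l' J \<le> Suc (mult_in Z L)" if "J \<in> local_above Z I" for J
      using l(1)[OF up[OF that]] by (simp add: l'_def)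
    moreover have "l' J < l' K" if JK: "J \<in> local_above Z I" "K \<in> local_above Z I" "J \<subset> K" for J K
    proof (cases "h \<in> K")
      case hK: True
      show ?thesis
      proof (cases "h \<in> J")
        case True
        then show ?thesis using up_eq JK hK l(2)[of J K] up[OF JK(1)] up[OF JK(2)] by (simp add: l'_def)
      next
        case False
        have "up J \<subseteq> up K" using up_mono JK(3) by blast
        then have "l (up J) \<le> l (up K)"
          using l(2)[OF up[OF JK(1)] up[OF JK(2)]] by (cases "up J = up K") (auto simp: psubset_eq)
        then show ?thesis using hK False by (simp add: l'_def)
      qed
    next
      case False
      then show ?thesis
        using up_strict[OF JK False] l(2)[OF up[OF JK(1)] up[OF JK(2)]] JK(3) by (auto simp: l'_def)
    qed
    ultimately have 1: "\<exists>l :: _ \<Rightarrow> nat. (\<forall>J\<in>local_above Z I. l J \<le> Suc (mult_in Z L)) \<and>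
      (\<forall>J\<in>local_above Z I. \<forall>K\<in>local_above Z I. J \<subset> K \<longrightarrow> l J < l K)" by blast
    define ch' where "ch' = case_nat (saturate Z I) ch"
    have bot: "saturate Z I \<in> local_above Z I"
      using saturate_superset[OF Z] saturate_local[OF Z filtration_step(1)] by (simp add: local_above_def)
    have "h \<notin> saturate Z I" using True by (auto simp: saturate_def colon_def)
    then have "saturate Z I \<subset> ch 0"
      using ch(1)[of 0] saturate_least[of "ch 0" Z I] unfolding local_above_adj by (auto simp: local_above_def)
    moreover have "ch i \<in> local_above Z I" if "i \<le> mult_in Z L" for i
      using ch(1)[OF that] unfolding local_above_adj by blast
    ultimately have "ch' i \<in> local_above Z I" if "i \<le> Suc (mult_in Z L)" for i
      using that bot by (cases i) (simp_all add: ch'_def)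
    moreover have "ch' i \<subset> ch' (Suc i)" if "i < Suc (mult_in Z L)" for i
      using that ch(2) \<open>saturate Z I \<subset> ch 0\<close> by (cases i) (simp_all add: ch'_def)
    ultimately have "(\<forall>i\<le>Suc (mult_in Z L). ch' i \<in> local_above Z I) \<and> (\<forall>i<Suc (mult_in Z L). ch' i \<subset> ch' (Suc i))"
      by blast
    then show ?thesis using 1 unfolding mult by blast
  qed
qed

lemma chain_le_rank:
  fixes l :: "'a set \<Rightarrow> nat"
  assumes "\<And>J. J \<in> C \<Longrightarrow> l J \<le> n" "\<And>J K. J \<in> C \<Longrightarrow> K \<in> C \<Longrightarrow> J \<subset> K \<Longrightarrow> l J < l K"
    and "\<forall>i\<le>m. c i \<in> C" "\<forall>i<m. c i \<subset> c (Suc i)"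
  shows "m \<le> n"
proof -
  have "i \<le> l (c i)" if "i \<le> m" for i
    using that
  proof (induction i)
    case (Suc i)
    have "l (c i) < l (c (Suc i))" using Suc.prems assms(3,4) by (intro assms(2)) auto
    then show ?case using Suc by simp
  qed simp
  from this[of m] show ?thesis using assms(1)[of "c m"] assms(3) by simp
qed

lemma ord_along_filtration:
  assumes V: "bihomog_ideal V" and f: "bihomog a b f" and L: "filtration (adjoin V f) L" and Z: "gprime Z"
    and "\<forall>(c, d, Q)\<in>set L. Q = Z \<or> \<not> Q \<subseteq> Z"
  shows "ord_along V Z f = int (mult_in Z L)"
proof -
  note v = bihomog_idealD(1)[OF V]
  have eq: "{J \<in> local_ideals Z. V \<subseteq> J \<and> f \<in> J} = local_above Z (adjoin V f)"
    using adjoin_superset[of V f] in_adjoin[OF v, of f] adjoin_least local_idealsD(2)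
    unfolding local_above_def by blast
  note fl = filtration_length[OF L Z assms(5)]
  obtain l :: "_ \<Rightarrow> nat" where
    l: "\<forall>J\<in>local_above Z (adjoin V f). l J \<le> mult_in Z L"
       "\<forall>J\<in>local_above Z (adjoin V f). \<forall>K\<in>local_above Z (adjoin V f). J \<subset> K \<longrightarrow> l J < l K"
    using fl by blast
  have "chain_length (local_above Z (adjoin V f)) = enat (mult_in Z L)"
  proof (rule chain_length_eqI)
    show "\<exists>c. (\<forall>i\<le>mult_in Z L. c i \<in> local_above Z (adjoin V f)) \<and> (\<forall>i<mult_in Z L. c i \<subset> c (Suc i))"
      using fl by blast
    show "m \<le> mult_in Z L" if "\<forall>i\<le>m. c i \<in> local_above Z (adjoin V f)" "\<forall>i<m. c i \<subset> c (Suc i)" for m c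
      using chain_le_rank[of "local_above Z (adjoin V f)" l _ m c] l that by blast
  qed
  then show ?thesis by (simp add: ord_along_def eq)
qed

section \<open>Dimension and growth of the Hilbert function\<close>

lemma UNIV3: "UNIV = {0, 1, 2 :: 3}"
proof -
  have "x = 0 \<or> x = 1 \<or> x = 2" for x :: 3
  proof (induct x)
    case (of_int z)
    then have "z = 0 \<or> z = 1 \<or> z = 2" by auto
    then show ?case by auto
  qed
  then show ?thesis by auto
qed

lemma sum3: "(\<Sum>i\<in>UNIV. f i) = f 0 + f 1 + f (2 :: 3)"
  unfolding UNIV3 by (simp add: add.assoc)

lemma all3: "(\<forall>i :: 3. P i) \<longleftrightarrow> P 0 \<and> P 1 \<and> P 2"
proof -
  have "(\<forall>i :: 3. P i) \<longleftrightarrow> (\<forall>i\<in>{0, 1, 2}. P i)" by (simp flip: UNIV3)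
  then show ?thesis by simp
qed

lemma subvariety_iff: "subvariety Q \<longleftrightarrow> gprime Q \<and> (\<exists>i. Var (Inl i) \<notin> Q) \<and> (\<exists>j. Var (Inr j) \<notin> Q)"
  by (auto simp: subvariety_def gprime_def primeideal_class_iff bihomog_ideal_iff)

lemma subvariety_gprime: "subvariety Q \<Longrightarrow> gprime Q"
  by (simp add: subvariety_iff)

lemma subvariety_subset: "gprime Q \<Longrightarrow> Q \<subseteq> Z \<Longrightarrow> subvariety Z \<Longrightarrow> subvariety Q"
  by (auto simp: subvariety_iff)

lemma bideg_single_Inl: "bideg (single (Inl i) n) = (n, 0)"
  by (simp add: bideg_def lookup_single when_def)

lemma bideg_single_Inr: "bideg (single (Inr i) n) = (0, n)"
  by (simp add: bideg_def lookup_single when_def)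

lemma bihomog_Inl: "bihomog 1 0 (Var (Inl i))"
  unfolding Var_def by (rule bihomog_single) (rule bideg_single_Inl)

lemma bihomog_Inr: "bihomog 0 1 (Var (Inr i))"
  unfolding Var_def by (rule bihomog_single) (rule bideg_single_Inr)

lemma subvariety_form:
  assumes "subvariety Q"
  obtains h where "bihomog a b h" "h \<notin> Q"
proof -
  obtain i j where ij: "Var (Inl i) \<notin> Q" "Var (Inr j) \<notin> Q" using assms by (auto simp: subvariety_iff)
  have "bihomog (a * 1 + b * 0) (a * 0 + b * 1) (Var (Inl i) ^ a * Var (Inr j) ^ b)"
    by (intro bihomog_mult bihomog_power bihomog_Inl bihomog_Inr)
  then have "bihomog a b (Var (Inl i) ^ a * Var (Inr j) ^ b)" by simp
  moreover have "Var (Inl i) ^ a * Var (Inr j) ^ b \<notin> Q"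
    using ij gprimeD(4) gprime_power subvariety_gprime[OF assms] by metis
  ultimately show ?thesis using that by blast
qed

lemma hilb_adjoin_prime:
  assumes "gprime Q" "bihomog c d h" "h \<notin> Q"
  shows "hilb Q a b = hilb (adjoin Q h) a b + (if c \<le> a \<and> d \<le> b then hilb Q (a - c) (b - d) else 0)"
  using hilb_adjoin[OF gprimeD(1)[OF assms(1)] assms(2)] colon_prime[OF assms(1,3)] by simp

lemma hilb_mono:
  assumes "subvariety Q" "a \<le> a'" "b \<le> b'"
  shows "hilb Q a b \<le> hilb Q a' b'"
proof -
  obtain h where "bihomog (a' - a) (b' - b) h" "h \<notin> Q" using subvariety_form[OF assms(1)] by blast
  from hilb_adjoin_prime[OF subvariety_gprime[OF assms(1)] this, of a' b'] show ?thesis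
    using assms by simp
qed

lemma single_Var_factor:
  assumes "lookup m v > 0"
  shows "single m c = single (m - single v 1) c * Var v"
proof -
  have "m - single v 1 + single v 1 = m"
    using assms by (intro poly_mapping_eqI) (auto simp: lookup_add lookup_minus lookup_single when_def)
  then show ?thesis by (simp add: Var_def mult_single)
qed

lemma hilb_irrelevant:
  assumes Q: "gprime Q" "\<not> subvariety Q" and ab: "a > 0" "b > 0"
  shows "hilb Q a b = 0"
proof (rule hilb_eq_0[OF gprimeD(2)[OF Q(1)]])
  fix f :: "'a bipoly" assume f: "bihomog a b f"
  note i = gprimeD(2)[OF Q(1)]
  have "single m c \<in> Q" if m: "bideg m = (a, b)" for m c
  proof -
    have pos: "\<exists>i. g i > 0" if "(\<Sum>i\<in>UNIV. g i) > 0" for g :: "3 \<Rightarrow> nat"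
      using that by (metis less_numeral_extra(3) neq0_conv sum.neutral)
    obtain i j where "lookup m (Inl i) > 0" "lookup m (Inr j) > 0"
      using pos[of "\<lambda>i. lookup m (Inl i)"] pos[of "\<lambda>i. lookup m (Inr i)"] m ab by (auto simp: bideg_def)
    then have "\<exists>v. lookup m v > 0 \<and> Var v \<in> Q" using Q by (auto simp: subvariety_iff)
    then show ?thesis using single_Var_factor is_idealD(3)[OF i] by metis
  qed
  then have "(\<Sum>m\<in>keys f. single m (lookup f m)) \<in> Q"
    using f by (intro is_ideal_sum i) (auto simp: bihomog_iff)
  then show "f \<in> Q" using sum_singles[of f] by simp
qed

text \<open>Every strict inclusion of primes raises the growth of the Hilbert function by one degree: a form
  \<open>h\<close> of bidegree \<open>(e', e')\<close> in the larger prime only gives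
  \<open>H\<^sub>0(k + e') \<ge> H\<^sub>0(k) + H\<^sub>1(k + e')\<close> on the diagonal.\<close>

lemma chain_growth:
  assumes "\<forall>i\<le>r. subvariety (c i)" "\<forall>i<r. c i \<subset> c (Suc i)"
  shows "\<exists>e\<ge>1. \<forall>k. k choose r \<le> hilb (c 0) (e * k) (e * k)"
  using assms
proof (induction r arbitrary: c)
  case 0
  have "1 \<le> hilb (c 0) k k" for k
  proof -
    obtain h where "bihomog k k h" "h \<notin> c 0" using subvariety_form[of "c 0"] 0 by blast
    then show ?thesis using hilb_pos[OF gprimeD(2)[OF subvariety_gprime[of "c 0"]]] 0 by simp
  qed
  then show ?case by (intro exI[of _ 1]) auto
next
  case (Suc r)
  obtain e where e: "e \<ge> 1" "\<And>k. k choose r \<le> hilb (c 1) (e * k) (e * k)"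
    using Suc.IH[of "\<lambda>i. c (Suc i)"] Suc.prems by auto
  have sv: "subvariety (c 0)" "subvariety (c 1)" and sub: "c 0 \<subset> c 1" using Suc.prems by auto
  note gp = subvariety_gprime[OF sv(1)] and gp1 = subvariety_gprime[OF sv(2)]
  obtain a b f where f: "bihomog a b f" "f \<in> c 1" "f \<notin> c 0"
    using form_in_diff[of "c 1" "c 0"] sub gprimeD(1)[OF gp1] gprimeD(2)[OF gp] by blast
  define e' where "e' = e * Suc (a + b)"
  have ee: "a \<le> e'" "b \<le> e'" "e \<le> e'" "1 \<le> e'"
    using e(1) mult_le_mono1[OF e(1), of "Suc (a + b)"] by (auto simp: e'_def)
  obtain g where g: "bihomog (e' - a) (e' - b) g" "g \<notin> c 0" using subvariety_form[OF sv(1)] by blast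
  define h where "h = f * g"
  have h: "bihomog e' e' h" "h \<notin> c 0" "h \<in> c 1"
    using bihomog_mult[OF f(1) g(1)] ee gprimeD(4)[OF gp, of f g] f g is_idealD(4)[OF gprimeD(2)[OF gp1]]
    by (auto simp: h_def)
  have step: "hilb (c 0) (e' * k) (e' * k) + (Suc k choose r) \<le> hilb (c 0) (e' * Suc k) (e' * Suc k)" for k
  proof -
    have "Suc k choose r \<le> hilb (c 1) (e * Suc k) (e * Suc k)" by (rule e(2))
    also have "\<dots> \<le> hilb (c 1) (e' * Suc k) (e' * Suc k)" using ee(3) by (intro hilb_mono sv mult_le_mono1)
    also have "\<dots> \<le> hilb (adjoin (c 0) h) (e' * Suc k) (e' * Suc k)"
    proof (rule hilb_antimono)
      show "adjoin (c 0) h \<subseteq> c 1" using h(3) sub by (intro adjoin_least gprimeD(2)[OF gp1]) auto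
    qed (use gp gp1 in \<open>auto intro: gprimeD is_ideal_adjoin\<close>)
    finally show ?thesis using hilb_adjoin_prime[OF gp h(1,2), of "e' * Suc k" "e' * Suc k"] by simp
  qed
  have "k choose Suc r \<le> hilb (c 0) (e' * k) (e' * k)" for k
  proof (induction k)
    case (Suc k)
    have "Suc k choose Suc r \<le> (k choose Suc r) + (Suc k choose r)"
      by (simp add: binomial_right_mono)
    then show ?case using Suc step[of k] by linarith
  qed simp
  then show ?case using ee(4) by blast
qed

lemma card_bideg_le: "card {m. bideg m = (k, k)} \<le> (k + 1) ^ 4"
proof -
  let ?f = "\<lambda>m. (lookup m (Inl (0 :: 3)), lookup m (Inl (1 :: 3)), lookup m (Inr (0 :: 3)), lookup m (Inr (1 :: 3)))"
  have "card {m. bideg m = (k, k)} \<le> card ({..k} \<times> {..k} \<times> {..k} \<times> {..k})"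
  proof (rule card_inj_on_le)
    show "inj_on ?f {m. bideg m = (k, k)}"
    proof (intro inj_onI poly_mapping_eqI)
      fix m n v assume *: "m \<in> {m. bideg m = (k, k)}" "n \<in> {m. bideg m = (k, k)}" "?f m = ?f n"
      have "lookup m (Inl i) = lookup n (Inl i) \<and> lookup m (Inr i) = lookup n (Inr i)" for i
        using * UNIV3 by (cases "i = 0 \<or> i = 1 \<or> i = 2") (auto simp: bideg_def sum3)
      then show "lookup m v = lookup n v" by (cases v) auto
    qed
  qed (auto simp: bideg_def sum3)
  also have "\<dots> = (k + 1) ^ 4" by (simp add: card_cartesian_product power4_eq_xxxx)
  finally show ?thesis .
qed

text \<open>Since \<open>S\<close> itself grows like the fourth power of the degree, chains have length at most 4.\<close>

lemma chain_bounded: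
  fixes c :: "nat \<Rightarrow> 'k::field bipoly set"
  assumes "\<forall>i\<le>r. subvariety (c i)" "\<forall>i<r. c i \<subset> c (Suc i)"
  shows "r \<le> 4"
proof (rule ccontr)
  assume "\<not> r \<le> 4"
  then have "\<forall>i\<le>5. subvariety (c i)" "\<forall>i<5. c i \<subset> c (Suc i)" using assms by auto
  then obtain e where e: "e \<ge> 1" "\<And>k. k choose 5 \<le> hilb (c 0) (e * k) (e * k)"
    using chain_growth[of 5 c] by blast
  note i = gprimeD(2)[OF subvariety_gprime[of "c 0"]]
  \<comment> \<open>Large enough for \<open>(k / 5) ^ 5\<close>, a lower bound for \<open>k choose 5\<close>, to exceed \<open>((e + 1) k) ^ 4\<close>.\<close>
  define k where "k = 5 ^ 5 * (e + 1) ^ 4 + 5"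
  have "k choose 5 \<le> (e * k + 1) ^ 4"
  proof -
    have "hilb (c 0) (e * k) (e * k) \<le> card {m. bideg m = (e * k, e * k)}"
      using assms(1) by (intro hilb_le[OF i span_monomials[OF i]]) auto
    also have "\<dots> \<le> (e * k + 1) ^ 4" by (rule card_bideg_le)
    finally show ?thesis using e(2)[of k] by simp
  qed
  also have "\<dots> \<le> ((e + 1) * k) ^ 4" by (intro power_mono) (auto simp: k_def)
  finally have "real (k choose 5) \<le> real (((e + 1) * k) ^ 4)" by (simp only: of_nat_le_iff)
  moreover have "(real k / real 5) ^ 5 \<le> real (k choose 5)"
    by (rule binomial_ge_n_over_k_pow_k) (simp add: k_def)
  ultimately have "(real k / 5) ^ 5 \<le> real (((e + 1) * k) ^ 4)" by simp
  then have "real k ^ 5 / 5 ^ 5 \<le> real (e + 1) ^ 4 * real k ^ 4"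
    unfolding power_divide of_nat_power of_nat_mult power_mult_distrib .
  then have "real k ^ 5 \<le> (5 ^ 5 * real (e + 1) ^ 4) * real k ^ 4"
    by (simp only: pos_divide_le_eq zero_less_power zero_less_numeral mult.assoc mult.commute[of _ "5 ^ 5 :: real"])
  moreover have "real k ^ 5 = real k * real k ^ 4" by (simp add: power_numeral_reduce)
  ultimately have "real k * real k ^ 4 \<le> (5 ^ 5 * real (e + 1) ^ 4) * real k ^ 4" by (simp only:)
  moreover have "k > 0" by (simp add: k_def)
  ultimately have "real k \<le> 5 ^ 5 * real (e + 1) ^ 4"
    using mult_right_le_imp_le[of "real k" "real k ^ 4"] by simp
  then have "real k \<le> real (5 ^ 5 * (e + 1) ^ 4)" by simp
  then have "k \<le> 5 ^ 5 * (e + 1) ^ 4" by (simp only: of_nat_le_iff)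
  then show False by (simp add: k_def)
qed

definition dimv :: "'k::field bipoly set \<Rightarrow> nat" where
  "dimv P = Max {n. \<exists>c. (\<forall>i\<le>n. subvariety (c i) \<and> P \<subseteq> c i) \<and> (\<forall>i<n. c i \<subset> c (Suc i))}"

lemma dimv:
  fixes P :: "'k::field bipoly set"
  assumes P: "subvariety P"
  shows vdim_dimv: "vdim P = enat (dimv P)" and dimv_le_4: "dimv P \<le> 4"
    and dimv_chain: "\<exists>c. (\<forall>i\<le>dimv P. subvariety (c i) \<and> P \<subseteq> c i) \<and> (\<forall>i<dimv P. c i \<subset> c (Suc i))"
    and dimv_ge: "\<And>n c. \<lbrakk>\<forall>i\<le>n. subvariety (c i) \<and> P \<subseteq> c i; \<forall>i<n. c i \<subset> c (Suc i)\<rbrakk> \<Longrightarrow> n \<le> dimv P"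
proof -
  let ?N = "{n. \<exists>c. (\<forall>i\<le>n. subvariety (c i) \<and> P \<subseteq> c i) \<and> (\<forall>i<n. c i \<subset> c (Suc i))}"
  have "0 \<in> ?N" using P by (auto intro: exI[of _ "\<lambda>_. P"])
  moreover have le: "?N \<subseteq> {..4}" using chain_bounded by blast
  ultimately have fin: "finite ?N" "?N \<noteq> {}" using finite_subset by auto
  have in_N: "dimv P \<in> ?N" unfolding dimv_def using fin by (rule Max_in)
  then show "dimv P \<le> 4" using le by blast
  show ch: "\<exists>c. (\<forall>i\<le>dimv P. subvariety (c i) \<and> P \<subseteq> c i) \<and> (\<forall>i<dimv P. c i \<subset> c (Suc i))"
    using in_N by blast
  show ge: "n \<le> dimv P" if "\<forall>i\<le>n. subvariety (c i) \<and> P \<subseteq> c i" "\<forall>i<n. c i \<subset> c (Suc i)" for n c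
    unfolding dimv_def using that fin by (intro Max_ge) auto
  show "vdim P = enat (dimv P)"
    unfolding vdim_def by (rule chain_length_eqI) (use ch ge in auto)
qed

lemma dimv_less:
  assumes "subvariety P" "subvariety Q" "P \<subset> Q"
  shows "dimv Q < dimv P"
proof -
  obtain c where c: "\<forall>i\<le>dimv Q. subvariety (c i) \<and> Q \<subseteq> c i" "\<forall>i<dimv Q. c i \<subset> c (Suc i)"
    using dimv_chain[OF assms(2)] by blast
  have "Suc (dimv Q) \<le> dimv P"
  proof (rule dimv_ge[OF assms(1), of _ "case_nat P c"])
    have sub: "P \<subset> c i" if "i \<le> dimv Q" for i using c(1) assms(3) that by blast
    show "\<forall>i\<le>Suc (dimv Q). subvariety (case_nat P c i) \<and> P \<subseteq> case_nat P c i"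
    proof (intro allI impI)
      fix i assume "i \<le> Suc (dimv Q)"
      then show "subvariety (case_nat P c i) \<and> P \<subseteq> case_nat P c i"
        using c(1) assms(1) sub by (cases i) (auto dest: psubset_imp_subset)
    qed
    show "\<forall>i<Suc (dimv Q). case_nat P c i \<subset> case_nat P c (Suc i)"
    proof (intro allI impI)
      fix i assume "i < Suc (dimv Q)"
      then show "case_nat P c i \<subset> case_nat P c (Suc i)"
        using c(2) sub[of 0] by (cases i) simp_all
    qed
  qed
  then show ?thesis by simp
qed

lemma dimv_eq_imp_eq:
  assumes "subvariety P" "subvariety Q" "P \<subseteq> Q" "dimv Q = dimv P"
  shows "P = Q"
  using dimv_less[OF assms(1,2)] assms(3,4) by auto

subsection \<open>Growth\<close>

definition growth :: "nat \<Rightarrow> (nat \<Rightarrow> nat) \<Rightarrow> bool" where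
  "growth n f \<longleftrightarrow> (\<exists>C. \<forall>k. f k \<le> C * (k + 1) ^ n)"

lemma growth_add:
  assumes "growth n f" "growth n g"
  shows "growth n (\<lambda>k. f k + g k)"
proof -
  obtain C D where C: "\<And>k. f k \<le> C * (k + 1) ^ n" "\<And>k. g k \<le> D * (k + 1) ^ n"
    using assms by (auto simp: growth_def)
  have "f k + g k \<le> (C + D) * (k + 1) ^ n" for k
    using add_mono[OF C(1)[of k] C(2)[of k]] by (simp add: distrib_right)
  then show ?thesis unfolding growth_def by blast
qed

lemma growth_le: "growth n g \<Longrightarrow> (\<And>k. f k \<le> g k) \<Longrightarrow> growth n f"
  unfolding growth_def using order_trans by blast

lemma growth_eventually_0:
  assumes "\<And>k. k \<ge> K \<Longrightarrow> f k = 0"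
  shows "growth n f"
proof -
  have "f k \<le> (\<Sum>i<K. f i) * (k + 1) ^ n" for k
  proof (cases "k < K")
    case True
    have "f k \<le> (\<Sum>i<K. f i)" using True by (intro member_le_sum) auto
    also have "\<dots> \<le> (\<Sum>i<K. f i) * (k + 1) ^ n" by simp
    finally show ?thesis .
  qed (use assms in auto)
  then show ?thesis unfolding growth_def by blast
qed

lemma growth_sum_list: "(\<And>x. x \<in> set L \<Longrightarrow> growth n (f x)) \<Longrightarrow> growth n (\<lambda>k. \<Sum>x\<leftarrow>L. f x k)"
  by (induction L) (auto intro: growth_add growth_eventually_0[of 0])

lemma growth_telescope:
  assumes "growth n g" "\<And>k. h (Suc k) \<le> h k + g (Suc k)"
  shows "growth (Suc n) h"
proof -
  obtain C where C: "\<And>k. g k \<le> C * (k + 1) ^ n" using assms by (auto simp: growth_def)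
  have "h k \<le> (h 0 + C) * (k + 1) ^ Suc n" for k
  proof (induction k)
    case (Suc k)
    have "h (Suc k) \<le> (h 0 + C) * (k + 1) ^ Suc n + C * (Suc k + 1) ^ n"
      using assms(2)[of k] Suc C[of "Suc k"] by linarith
    also have "\<dots> \<le> (h 0 + C) * ((k + 1) * (Suc k + 1) ^ n) + (h 0 + C) * (Suc k + 1) ^ n"
      unfolding power_Suc by (intro add_mono mult_le_mono power_mono) simp_all
    also have "\<dots> = (h 0 + C) * (Suc k + 1) ^ Suc n" by (simp add: algebra_simps)
    finally show ?case .
  qed simp
  then show ?thesis unfolding growth_def by blast
qed

abbreviation shifted :: "nat \<Rightarrow> nat \<Rightarrow> nat \<times> nat \<times> 'k::field bipoly set \<Rightarrow> nat" where
  "shifted a b x \<equiv> (case x of (c, d, Q) \<Rightarrow> if c \<le> a \<and> d \<le> b then hilb Q (a - c) (b - d) else 0)"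

context
  fixes s t :: nat
  assumes s: "s \<ge> 1" and t: "t \<ge> 1"
begin

lemma ge_index: "s * k \<ge> k" "t * k \<ge> k"
  using s t by auto

lemma shifted_irrelevant:
  assumes "gprime Q" "\<not> subvariety Q" "k > c + d"
  shows "shifted (s * k) (t * k) (c, d, Q) = 0"
  using hilb_irrelevant[OF assms(1,2), of "s * k - c" "t * k - d"] assms(3) ge_index[of k] by auto

text \<open>The Hilbert function of a prime of dimension at most \<open>n\<close> is a sum of the Hilbert functions of
  quotients by a form of bidegree \<open>(s, t)\<close>, whose prime filtrations have factors of smaller
  dimension.  Irrelevant primes contribute only in small degrees.\<close>

lemma hilb_growth:
  assumes "subvariety Q" "dimv Q \<le> n"
  shows "growth n (\<lambda>k. hilb Q (s * k) (t * k))"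
    and "bihomog a b h \<Longrightarrow> h \<notin> Q \<Longrightarrow> n > 0 \<Longrightarrow> growth (n - 1) (\<lambda>k. hilb (adjoin Q h) (s * k) (t * k))"
proof -
  have "growth n (\<lambda>k. hilb Q (s * k) (t * k)) \<and>
      (\<forall>a b h. bihomog a b h \<longrightarrow> h \<notin> Q \<longrightarrow> n > 0 \<longrightarrow> growth (n - 1) (\<lambda>k. hilb (adjoin Q h) (s * k) (t * k)))"
    using assms
  proof (induction n arbitrary: Q)
    case (0 Q)
    obtain h where h: "bihomog s t h" "h \<notin> Q" using subvariety_form[OF 0(1)] by blast
    note gp = subvariety_gprime[OF 0(1)]
    obtain L where L: "filtration (adjoin Q h) L"
      using filtration_exists bihomog_ideal_adjoin[OF gprimeD(1)[OF gp] h(1)] by blast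
    define K where "K = (\<Sum>(c, d, P)\<leftarrow>L. c + d + 1)"
    have zero: "hilb (adjoin Q h) (s * k) (t * k) = 0" if k: "k \<ge> K" for k
    proof -
      have "shifted (s * k) (t * k) x = 0" if x: "x \<in> set L" for x
      proof -
        obtain c d P where P: "x = (c, d, P)" by (cases x)
        note fp = filtration_primes[OF L, of c d P]
        have "\<not> subvariety P"
        proof
          assume "subvariety P"
          moreover have "Q \<subset> P"
            using fp P x adjoin_superset[of Q h] in_adjoin[OF gprimeD(2)[OF gp], of h] h(2) by blast
          ultimately show False using dimv_less[OF 0(1), of P] 0(2) by simp
        qed
        moreover have "c + d + 1 \<le> K"
          unfolding K_def using x P by (intro member_le_sum_list) (force simp: image_iff)+
        moreover have "gprime P" using fp P x by blast
        ultimately show ?thesis using shifted_irrelevant[of P c d k] P k by simp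
      qed
      then show ?thesis using filtration_hilb[OF L, of "s * k" "t * k"]
        by (metis (no_types, lifting) map_eq_conv sum_list_0)
    qed
    let ?H = "\<lambda>k. hilb Q (s * k) (t * k)"
    have step: "?H (Suc k) = hilb (adjoin Q h) (s * Suc k) (t * Suc k) + ?H k" for k
      using hilb_adjoin_prime[OF gp h, of "s * Suc k" "t * Suc k"] by simp
    have bound: "?H k \<le> ?H K" for k
    proof (cases "k \<le> K")
      case True
      then show ?thesis by (intro hilb_mono 0) auto
    next
      case False
      then have "K \<le> k" by simp
      then show ?thesis
      proof (induction k rule: dec_induct)
        case (step n)
        then show ?case using \<open>?H (Suc n) = _\<close> zero[of "Suc n"] by simp
      qed simp
    qed
    then show ?case by (auto simp: growth_def)
  next
    case (Suc n Q)
    note gp = subvariety_gprime[OF Suc.prems(1)]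
    have adj: "growth n (\<lambda>k. hilb (adjoin Q h) (s * k) (t * k))" if h: "bihomog a b h" "h \<notin> Q" for a b h
    proof -
      obtain L where L: "filtration (adjoin Q h) L"
        using filtration_exists bihomog_ideal_adjoin[OF gprimeD(1)[OF gp] h(1)] by blast
      have "growth n (\<lambda>k. shifted (s * k) (t * k) x)" if x: "x \<in> set L" for x
      proof -
        obtain c d P where P: "x = (c, d, P)" by (cases x)
        note fp = filtration_primes[OF L, of c d P]
        show ?thesis
        proof (cases "subvariety P")
          case True
          have "Q \<subset> P"
            using fp P x adjoin_superset[of Q h] in_adjoin[OF gprimeD(2)[OF gp], of h] h(2) by blast
          then have "dimv P \<le> n" using dimv_less[OF Suc.prems(1) True] Suc.prems(2) by simp
          then have "growth n (\<lambda>k. hilb P (s * k) (t * k))" using Suc.IH True by blast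
          then show ?thesis
            by (rule growth_le) (use hilb_mono[OF True] in \<open>auto simp: P\<close>)
        next
          case False
          show ?thesis
          proof (rule growth_eventually_0[of "c + d + 1"])
            have "gprime P" using fp P x by blast
            fix k assume "k \<ge> c + d + 1"
            then show "shifted (s * k) (t * k) x = 0"
              using shifted_irrelevant[OF \<open>gprime P\<close> False, of c d k] P by simp
          qed
        qed
      qed
      then have "growth n (\<lambda>k. \<Sum>x\<leftarrow>L. shifted (s * k) (t * k) x)" by (rule growth_sum_list)
      then show ?thesis using filtration_hilb[OF L] by simp
    qed
    obtain h where h: "bihomog s t h" "h \<notin> Q" using subvariety_form[OF Suc.prems(1)] by blast
    have "growth (Suc n) (\<lambda>k. hilb Q (s * k) (t * k))"
    proof (rule growth_telescope[OF adj[OF h]])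
      fix k
      show "hilb Q (s * Suc k) (t * Suc k) \<le> hilb Q (s * k) (t * k) + hilb (adjoin Q h) (s * Suc k) (t * Suc k)"
        using hilb_adjoin_prime[OF gp h, of "s * Suc k" "t * Suc k"] by simp
    qed
    then show ?case using adj by auto
  qed
  then show "growth n (\<lambda>k. hilb Q (s * k) (t * k))"
    "bihomog a b h \<Longrightarrow> h \<notin> Q \<Longrightarrow> n > 0 \<Longrightarrow> growth (n - 1) (\<lambda>k. hilb (adjoin Q h) (s * k) (t * k))"
    by blast+
qed

end

subsection \<open>The degree of a cycle\<close>

definition at_most_linear :: "(nat \<Rightarrow> int) \<Rightarrow> bool" where
  "at_most_linear f \<longleftrightarrow> (\<exists>C. \<forall>k. \<bar>f k\<bar> \<le> C * (int k + 1))"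

lemma at_most_linear_zero: "at_most_linear (\<lambda>k. 0)"
  unfolding at_most_linear_def by (rule exI[of _ 0]) simp

lemma at_most_linear_add:
  assumes "at_most_linear f" "at_most_linear g"
  shows "at_most_linear (\<lambda>k. f k + g k)"
proof -
  obtain C D where C: "\<And>k. \<bar>f k\<bar> \<le> C * (int k + 1)" "\<And>k. \<bar>g k\<bar> \<le> D * (int k + 1)"
    using assms by (auto simp: at_most_linear_def)
  have "\<bar>f k + g k\<bar> \<le> (C + D) * (int k + 1)" for k
    using C(1)[of k] C(2)[of k] by (simp add: distrib_right)
  then show ?thesis unfolding at_most_linear_def by blast
qed

lemma at_most_linear_uminus: "at_most_linear f \<Longrightarrow> at_most_linear (\<lambda>k. - f k)"
  by (simp add: at_most_linear_def)

lemma at_most_linear_diff: "at_most_linear f \<Longrightarrow> at_most_linear g \<Longrightarrow> at_most_linear (\<lambda>k. f k - g k)"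
  using at_most_linear_add[of f "\<lambda>k. - g k"] at_most_linear_uminus[of g] by simp

lemma at_most_linear_growth:
  assumes "growth 1 f" shows "at_most_linear (\<lambda>k. int (f k))"
proof -
  obtain C where "\<And>k. f k \<le> C * (k + 1) ^ 1" using assms by (auto simp: growth_def)
  then have "int (f k) \<le> int (C * (k + 1) ^ 1)" for k by (simp only: of_nat_le_iff)
  then have "\<bar>int (f k)\<bar> \<le> int C * (int k + 1)" for k
    using \<open>\<And>k. int (f k) \<le> int (C * (k + 1) ^ 1)\<close>[of k] by (simp add: algebra_simps)
  then show ?thesis unfolding at_most_linear_def by blast
qed

lemma at_most_linear_eventually:
  assumes "at_most_linear g" "\<And>k. k \<ge> K \<Longrightarrow> f k = g k"
  shows "at_most_linear f"
proof -
  have "growth 1 (\<lambda>k. nat \<bar>f k - g k\<bar>)" by (rule growth_eventually_0[of K]) (use assms in auto)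
  from at_most_linear_growth[OF this] have "at_most_linear (\<lambda>k. f k - g k)"
    by (simp add: at_most_linear_def)
  from at_most_linear_add[OF this assms(1)] show ?thesis by simp
qed

text \<open>Modulo functions of linear growth this replaces the intersection number with the class
  \<open>(s h\<^sub>1 + t h\<^sub>2)\<^sup>2 / 2\<close>, as leading coefficient of the Hilbert function along the ray \<open>(s, t)\<close>.\<close>

definition cdeg :: "nat \<Rightarrow> nat \<Rightarrow> ('k::field bipoly set \<Rightarrow>\<^sub>0 int) \<Rightarrow> nat \<Rightarrow> int" where
  "cdeg s t \<alpha> k = (\<Sum>Z\<in>keys \<alpha>. lookup \<alpha> Z * int (hilb Z (s * k) (t * k)))"

lemma cdeg_superset:
  "finite A \<Longrightarrow> keys \<alpha> \<subseteq> A \<Longrightarrow> cdeg s t \<alpha> k = (\<Sum>Z\<in>A. lookup \<alpha> Z * int (hilb Z (s * k) (t * k)))"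
  unfolding cdeg_def by (intro sum.mono_neutral_left) (auto simp: in_keys_iff)

lemma cdeg_zero [simp]: "cdeg s t 0 k = 0"
  by (simp add: cdeg_def)

lemma cdeg_add: "cdeg s t (\<alpha> + \<beta>) k = cdeg s t \<alpha> k + cdeg s t \<beta> k"
  using keys_add[of \<alpha> \<beta>]
  by (simp add: cdeg_superset[of "keys \<alpha> \<union> keys \<beta>"] lookup_add distrib_right sum.distrib)

lemma cdeg_uminus: "cdeg s t (- \<alpha>) k = - cdeg s t \<alpha> k"
  using cdeg_add[of s t \<alpha> "- \<alpha>" k] by simp

lemma cdeg_frag_of: "cdeg s t (frag_of Z) k = int (hilb Z (s * k) (t * k))"
  by (simp add: cdeg_def keys_frag_of)

lemma cdeg_frag_cmul: "cdeg s t (frag_cmul c \<alpha>) k = c * cdeg s t \<alpha> k"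
  by (subst cdeg_superset[OF _ keys_cmul]) (simp_all add: cdeg_def sum_distrib_left mult.assoc)

context
  fixes s t :: nat
  assumes s: "s \<ge> 1" and t: "t \<ge> 1"
begin

text \<open>For large \<open>k\<close> the difference is, up to sign, the Hilbert function of the section of \<open>Q\<close> by a form of
  bidegree \<open>(c, d)\<close>, which has dimension at most one.\<close>

lemma shifted_surface:
  assumes Q: "subvariety Q" "dimv Q \<le> 2"
  shows "at_most_linear (\<lambda>k. int (shifted (s * k) (t * k) (c, d, Q)) - int (hilb Q (s * k) (t * k)))"
proof -
  obtain h where h: "bihomog c d h" "h \<notin> Q" using subvariety_form[OF Q(1)] by blast
  have "growth (2 - 1) (\<lambda>k. hilb (adjoin Q h) (s * k) (t * k))"
    by (rule hilb_growth(2)[OF s t Q h]) simp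
  then have "at_most_linear (\<lambda>k. - int (hilb (adjoin Q h) (s * k) (t * k)))"
    by (intro at_most_linear_uminus at_most_linear_growth) simp
  then show ?thesis
  proof (rule at_most_linear_eventually[where K = "c + d"])
    fix k assume "k \<ge> c + d"
    then have "c \<le> s * k" "d \<le> t * k" using ge_index[OF s t, of k] by linarith+
    then show "int (shifted (s * k) (t * k) (c, d, Q)) - int (hilb Q (s * k) (t * k)) =
        - int (hilb (adjoin Q h) (s * k) (t * k))"
      using hilb_adjoin_prime[OF subvariety_gprime[OF Q(1)] h, of "s * k" "t * k"] by simp
  qed
qed

text \<open>Only the surfaces in a filtration contribute quadratic terms to the Hilbert function.\<close>

lemma filtration_surfaces:
  assumes "finite A" "\<And>Z. Z \<in> A \<Longrightarrow> subvariety Z \<and> dimv Z = 2"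
    and "\<forall>(c, d, Q)\<in>set L. gprime Q \<and> (subvariety Q \<longrightarrow> dimv Q \<le> 2 \<and> (dimv Q = 2 \<longrightarrow> Q \<in> A))"
  shows "at_most_linear (\<lambda>k. int (\<Sum>x\<leftarrow>L. shifted (s * k) (t * k) x) -
    (\<Sum>Z\<in>A. int (mult_in Z L) * int (hilb Z (s * k) (t * k))))"
  using assms(3)
proof (induction L)
  case Nil
  show ?case by (simp add: mult_in_def at_most_linear_zero)
next
  case (Cons x L)
  obtain c d Q where x: "x = (c, d, Q)" by (cases x)
  have gp: "gprime Q" and Q: "subvariety Q \<Longrightarrow> dimv Q \<le> 2" "subvariety Q \<Longrightarrow> dimv Q = 2 \<Longrightarrow> Q \<in> A"
    using Cons.prems x by auto
  have IH: "at_most_linear (\<lambda>k. int (\<Sum>x\<leftarrow>L. shifted (s * k) (t * k) x) -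
    (\<Sum>Z\<in>A. int (mult_in Z L) * int (hilb Z (s * k) (t * k))))"
    using Cons by simp
  have mult: "mult_in Z (x # L) = mult_in Z L + (if Z = Q then 1 else 0)" for Z
    by (simp add: mult_in_def x)
  have sum: "(\<Sum>Z\<in>A. int (mult_in Z (x # L)) * int (hilb Z (s * k) (t * k))) =
    (\<Sum>Z\<in>A. int (mult_in Z L) * int (hilb Z (s * k) (t * k))) +
    (if Q \<in> A then int (hilb Q (s * k) (t * k)) else 0)" for k
  proof -
    have "(\<Sum>Z\<in>A. int (mult_in Z (x # L)) * int (hilb Z (s * k) (t * k))) =
      (\<Sum>Z\<in>A. int (mult_in Z L) * int (hilb Z (s * k) (t * k)) +
        (if Z = Q then int (hilb Z (s * k) (t * k)) else 0))"
      by (intro sum.cong refl) (simp add: mult distrib_right)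
    then show ?thesis using assms(1) by (simp add: sum.distrib)
  qed
  have "at_most_linear (\<lambda>k. int (shifted (s * k) (t * k) x) - (if Q \<in> A then int (hilb Q (s * k) (t * k)) else 0))"
  proof (cases "Q \<in> A")
    case True
    then show ?thesis using shifted_surface[of Q c d] assms(2) x by auto
  next
    case False
    show ?thesis
    proof (cases "subvariety Q")
      case True
      then have "dimv Q \<le> 1" using Q False by force
      then have "growth 1 (\<lambda>k. hilb Q (s * k) (t * k))" by (rule hilb_growth(1)[OF s t True])
      then have "growth 1 (\<lambda>k. shifted (s * k) (t * k) x)"
        by (rule growth_le) (use hilb_mono[OF True] in \<open>auto simp: x\<close>)
      then show ?thesis using at_most_linear_growth False by simp
    next
      case nsv: False
      have "growth 1 (\<lambda>k. shifted (s * k) (t * k) x)"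
        by (rule growth_eventually_0[of "c + d + 1"]) (use shifted_irrelevant[OF s t gp nsv] in \<open>auto simp: x\<close>)
      then show ?thesis using at_most_linear_growth False by simp
    qed
  qed
  from at_most_linear_add[OF this IH] show ?case
    unfolding sum by (simp add: algebra_simps)
qed

lemma divisor_degree:
  assumes V: "subvariety V" "dimv V = 3" and f: "bihomog a b f" "f \<notin> V"
  shows "\<exists>B. finite B \<and> (\<forall>Z\<in>B. subvariety Z \<and> dimv Z = 2) \<and>
    (\<forall>A. finite A \<longrightarrow> B \<subseteq> A \<longrightarrow> (\<forall>Z\<in>A. subvariety Z \<and> dimv Z = 2) \<longrightarrow>
      at_most_linear (\<lambda>k. int (hilb (adjoin V f) (s * k) (t * k)) -
        (\<Sum>Z\<in>A. ord_along V Z f * int (hilb Z (s * k) (t * k)))))"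
proof -
  note gp = subvariety_gprime[OF V(1)]
  obtain L where L: "filtration (adjoin V f) L"
    using filtration_exists bihomog_ideal_adjoin[OF gprimeD(1)[OF gp] f(1)] by blast
  have prime: "gprime Q \<and> V \<subset> Q" if "(c, d, Q) \<in> set L" for c d Q
    using filtration_primes[OF L that] adjoin_superset[of V f] in_adjoin[OF gprimeD(2)[OF gp], of f] f(2) by blast
  define B where "B = {Q \<in> (snd \<circ> snd) ` set L. subvariety Q \<and> dimv Q = 2}"
  have le2: "dimv Q \<le> 2" if "(c, d, Q) \<in> set L" "subvariety Q" for c d Q
    using dimv_less[OF V(1) that(2)] prime[OF that(1)] V(2) by simp
  have ord: "ord_along V Z f = int (mult_in Z L)" if Z: "subvariety Z" "dimv Z = 2" for Z
  proof (rule ord_along_filtration[OF gprimeD(1)[OF gp] f(1) L subvariety_gprime[OF Z(1)]])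
    have "Q = Z" if Q: "(c, d, Q) \<in> set L" "Q \<subseteq> Z" for c d Q
    proof (rule ccontr)
      assume "Q \<noteq> Z"
      have sQ: "subvariety Q" using subvariety_subset prime[OF Q(1)] Q(2) Z(1) by blast
      have "Q \<subset> Z" using Q(2) \<open>Q \<noteq> Z\<close> by blast
      then have "dimv Z < dimv Q" using dimv_less[OF sQ Z(1)] by blast
      then show False using le2[OF Q(1) sQ] Z(2) by simp
    qed
    then show "\<forall>(c, d, Q)\<in>set L. Q = Z \<or> \<not> Q \<subseteq> Z" by blast
  qed
  show ?thesis
  proof (intro exI[of _ B] conjI allI impI)
    show "finite B" by (simp add: B_def)
    show "\<forall>Z\<in>B. subvariety Z \<and> dimv Z = 2" by (simp add: B_def)
    fix A assume "finite A" "B \<subseteq> A" "\<forall>Z\<in>A. subvariety Z \<and> dimv Z = 2"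
    then have A: "finite A" "B \<subseteq> A" "\<And>Z. Z \<in> A \<Longrightarrow> subvariety Z \<and> dimv Z = 2" by auto
    have "at_most_linear (\<lambda>k. int (\<Sum>x\<leftarrow>L. shifted (s * k) (t * k) x) -
      (\<Sum>Z\<in>A. int (mult_in Z L) * int (hilb Z (s * k) (t * k))))"
    proof (rule filtration_surfaces[OF A(1,3)], assumption)
      show "\<forall>(c, d, Q)\<in>set L. gprime Q \<and> (subvariety Q \<longrightarrow> dimv Q \<le> 2 \<and> (dimv Q = 2 \<longrightarrow> Q \<in> A))"
        using prime le2 A(2) by (force simp: B_def)
    qed
    moreover have "(\<Sum>Z\<in>A. int (mult_in Z L) * int (hilb Z (s * k) (t * k))) =
        (\<Sum>Z\<in>A. ord_along V Z f * int (hilb Z (s * k) (t * k)))" for k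
      using A(3) ord by (intro sum.cong refl) simp
    ultimately show "at_most_linear (\<lambda>k. int (hilb (adjoin V f) (s * k) (t * k)) -
        (\<Sum>Z\<in>A. ord_along V Z f * int (hilb Z (s * k) (t * k))))"
      by (simp add: filtration_hilb[OF L])
  qed
qed

text \<open>The Hilbert functions of \<open>S / (V + f S)\<close> and \<open>S / (V + g S)\<close> agree when \<open>f\<close> and \<open>g\<close> have
  the same bidegree.\<close>

lemma principal_cycle_degree:
  assumes "\<alpha> \<in> principal_cycles 2"
  shows "at_most_linear (cdeg s t \<alpha>)"
proof -
  obtain V f g a b where keys: "keys \<alpha> \<subseteq> {Z. subvariety Z \<and> vdim Z = enat 2}"
    and V: "subvariety V" "vdim V = enat 3" and f: "bihomog a b f" "f \<notin> V" and g: "bihomog a b g" "g \<notin> V"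
    and \<alpha>: "\<And>Z. subvariety Z \<Longrightarrow> vdim Z = enat 2 \<Longrightarrow> lookup \<alpha> Z = ord_along V Z f - ord_along V Z g"
    using assms by (auto simp: principal_cycles_def cycle_group_def)
  have V3: "dimv V = 3" using vdim_dimv[OF V(1)] V(2) by simp
  from divisor_degree[OF V(1) V3 f] obtain B where B: "finite B" "\<forall>Z\<in>B. subvariety Z \<and> dimv Z = 2"
    "\<forall>A. finite A \<longrightarrow> B \<subseteq> A \<longrightarrow> (\<forall>Z\<in>A. subvariety Z \<and> dimv Z = 2) \<longrightarrow>
      at_most_linear (\<lambda>k. int (hilb (adjoin V f) (s * k) (t * k)) -
        (\<Sum>Z\<in>A. ord_along V Z f * int (hilb Z (s * k) (t * k))))"
    by (elim exE conjE)
  from divisor_degree[OF V(1) V3 g] obtain D where D: "finite D" "\<forall>Z\<in>D. subvariety Z \<and> dimv Z = 2"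
    "\<forall>A. finite A \<longrightarrow> D \<subseteq> A \<longrightarrow> (\<forall>Z\<in>A. subvariety Z \<and> dimv Z = 2) \<longrightarrow>
      at_most_linear (\<lambda>k. int (hilb (adjoin V g) (s * k) (t * k)) -
        (\<Sum>Z\<in>A. ord_along V Z g * int (hilb Z (s * k) (t * k))))"
    by (elim exE conjE)
  define A where "A = keys \<alpha> \<union> B \<union> D"
  have finA: "finite A" using B(1) D(1) by (simp add: A_def)
  have "dimv Z = 2 \<and> subvariety Z" if "Z \<in> keys \<alpha>" for Z
  proof -
    have Z: "subvariety Z" "vdim Z = enat 2" using keys that by auto
    then show ?thesis using vdim_dimv[OF Z(1)] by simp
  qed
  then have "subvariety Z \<and> dimv Z = 2" if "Z \<in> A" for Z
    using that B(2) D(2) unfolding A_def by blast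
  note A = finA this
  have same: "hilb (adjoin V f) p q = hilb (adjoin V g) p q" for p q
    using hilb_adjoin_prime[OF subvariety_gprime[OF V(1)] f, of p q]
      hilb_adjoin_prime[OF subvariety_gprime[OF V(1)] g, of p q] by simp
  have "cdeg s t \<alpha> k = (\<Sum>Z\<in>A. ord_along V Z f * int (hilb Z (s * k) (t * k))) -
      (\<Sum>Z\<in>A. ord_along V Z g * int (hilb Z (s * k) (t * k)))" for k
  proof -
    have "cdeg s t \<alpha> k = (\<Sum>Z\<in>A. lookup \<alpha> Z * int (hilb Z (s * k) (t * k)))"
      using A(1) by (intro cdeg_superset) (auto simp: A_def)
    also have "\<dots> = (\<Sum>Z\<in>A. (ord_along V Z f - ord_along V Z g) * int (hilb Z (s * k) (t * k)))"
    proof (intro sum.cong refl)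
      fix Z assume "Z \<in> A"
      then have Z: "subvariety Z" "dimv Z = 2" using A(2) by auto
      show "lookup \<alpha> Z * int (hilb Z (s * k) (t * k)) =
          (ord_along V Z f - ord_along V Z g) * int (hilb Z (s * k) (t * k))"
        using \<alpha>[OF Z(1)] vdim_dimv[OF Z(1)] Z(2) by simp
    qed
    finally show ?thesis by (simp add: left_diff_distrib sum_subtractf)
  qed
  moreover have "at_most_linear (\<lambda>k. (\<Sum>Z\<in>A. ord_along V Z f * int (hilb Z (s * k) (t * k))) -
      (\<Sum>Z\<in>A. ord_along V Z g * int (hilb Z (s * k) (t * k))))"
  proof -
    have "\<forall>Z\<in>A. subvariety Z \<and> dimv Z = 2" "B \<subseteq> A" "D \<subseteq> A" using A(2) by (auto simp: A_def)
    then have "at_most_linear (\<lambda>k. int (hilb (adjoin V f) (s * k) (t * k)) -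
        (\<Sum>Z\<in>A. ord_along V Z f * int (hilb Z (s * k) (t * k))))"
      "at_most_linear (\<lambda>k. int (hilb (adjoin V g) (s * k) (t * k)) -
        (\<Sum>Z\<in>A. ord_along V Z g * int (hilb Z (s * k) (t * k))))"
      using B(3) D(3) A(1) by blast+
    from at_most_linear_diff[OF this(2,1)] show ?thesis by (simp add: same)
  qed
  ultimately show ?thesis by presburger
qed

lemma rationally_trivial_degree:
  assumes "\<alpha> \<in> generate (cycle_group 2) (principal_cycles 2)"
  shows "at_most_linear (cdeg s t \<alpha>)"
  using assms
proof (induction rule: generate.induct)
  case one
  show ?case by (simp add: cycle_group_def at_most_linear_zero)
next
  case (incl h)
  then show ?case by (rule principal_cycle_degree)
next
  case (inv h)
  then have "inv\<^bsub>cycle_group 2\<^esub> h = - h"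
    by (simp add: principal_cycles_def cycle_group_def)
  then show ?case using at_most_linear_uminus[OF principal_cycle_degree[OF inv]]
    by (simp add: cdeg_uminus[abs_def])
next
  case (eng h1 h2)
  then show ?case using at_most_linear_add by (simp add: cycle_group_def cdeg_add[abs_def])
qed

lemma chow_class_degree:
  assumes "chow_class 2 \<alpha> = chow_class 2 \<beta>"
  shows "at_most_linear (\<lambda>k. cdeg s t \<alpha> k - cdeg s t \<beta> k)"
proof -
  have "0 \<in> generate (cycle_group 2) (principal_cycles 2)"
    using generate.one[of "cycle_group 2" "principal_cycles 2"] by (simp add: cycle_group_def)
  then have "\<alpha> \<in> chow_class 2 \<alpha>"
    unfolding chow_class_def r_coset_def by (force simp: cycle_group_def)
  then obtain \<gamma> where "\<gamma> \<in> generate (cycle_group 2) (principal_cycles 2)" "\<alpha> = \<gamma> + \<beta>"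
    unfolding assms unfolding chow_class_def r_coset_def by (auto simp: cycle_group_def)
  then show ?thesis using rationally_trivial_degree[of \<gamma>] by (simp add: cdeg_add)
qed

end

lemma subgroup_rationally_trivial:
  "subgroup (generate (cycle_group 2) (principal_cycles 2)) (cycle_group 2)"
  unfolding cycle_group_def
  by (rule group.generate_is_subgroup) (auto simp: principal_cycles_def cycle_group_def)

lemma chow_class_eqI:
  assumes "\<alpha> - \<beta> \<in> generate (cycle_group 2) (principal_cycles 2)"
  shows "chow_class 2 \<alpha> = chow_class 2 \<beta>"
proof -
  let ?G = "generate (cycle_group 2) (principal_cycles 2)"
  have inv: "- x \<in> ?G" if "x \<in> ?G" for x
    using subgroup.m_inv_closed[OF subgroup_rationally_trivial that]
      subgroup.mem_carrier[OF subgroup_rationally_trivial that] by (simp add: cycle_group_def)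
  have add: "x + y \<in> ?G" if "x \<in> ?G" "y \<in> ?G" for x y
    using generate.eng[OF that] by (simp add: cycle_group_def)
  have "x + \<alpha> \<in> (\<lambda>h. h + \<beta>) ` ?G" if "x \<in> ?G" for x
    using add[OF that assms] by (rule rev_image_eqI) simp
  moreover have "x + \<beta> \<in> (\<lambda>h. h + \<alpha>) ` ?G" if "x \<in> ?G" for x
    using add[OF that inv[OF assms]] by (rule rev_image_eqI) simp
  ultimately have "(\<lambda>h. h + \<alpha>) ` ?G = (\<lambda>h. h + \<beta>) ` ?G" by blast
  then show ?thesis
    unfolding chow_class_def r_coset_def by (simp add: cycle_group_def UNION_singleton_eq_range)
qed

section \<open>Toric ideals\<close>

definition avoids :: "(3 + 3) set \<Rightarrow> (3 + 3 \<Rightarrow>\<^sub>0 nat) \<Rightarrow> bool" where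
  "avoids W m \<longleftrightarrow> (\<forall>v\<in>W. lookup m v = 0)"

definition texp :: "(3 + 3 \<Rightarrow> 3 + 3 \<Rightarrow> nat) \<Rightarrow> (3 + 3 \<Rightarrow>\<^sub>0 nat) \<Rightarrow> nat \<Rightarrow>\<^sub>0 nat" where
  "texp E = expo (\<lambda>v. \<Sum>w\<in>UNIV. single (var_index w) (E v w))"

lemma texp_add: "texp E (m + n) = texp E m + texp E n"
  by (simp add: texp_def expo_add)

lemma texp_zero [simp]: "texp E 0 = 0"
  by (simp add: texp_def)

lemma lookup_texp: "lookup (texp E m) (var_index w) = (\<Sum>v\<in>UNIV. lookup m v * E v w)"
proof -
  have "lookup (\<Sum>w\<in>UNIV. single (var_index w) (E v w)) (var_index w) = E v w" for v
  proof -
    have "lookup (\<Sum>w\<in>UNIV. single (var_index w) (E v w)) (var_index w) =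
        (\<Sum>w'\<in>UNIV. if w' = w then E v w' else 0)"
      unfolding lookup_sum by (intro sum.cong) (auto simp: lookup_single when_def inj_eq[OF inj_var_index])
    then show ?thesis by simp
  qed
  then show ?thesis by (simp add: texp_def lookup_expo)
qed

lemma lookup_texp_out: "k \<notin> range var_index \<Longrightarrow> lookup (texp E m) k = 0"
  unfolding texp_def lookup_expo lookup_sum by (auto simp: lookup_single when_def intro!: sum.neutral)

lemma texp_eq_iff:
  "texp E m = texp E n \<longleftrightarrow> (\<forall>w. (\<Sum>v\<in>UNIV. lookup m v * E v w) = (\<Sum>v\<in>UNIV. lookup n v * E v w))"
proof
  assume "texp E m = texp E n"
  then show "\<forall>w. (\<Sum>v\<in>UNIV. lookup m v * E v w) = (\<Sum>v\<in>UNIV. lookup n v * E v w)"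
    by (simp flip: lookup_texp)
next
  assume *: "\<forall>w. (\<Sum>v\<in>UNIV. lookup m v * E v w) = (\<Sum>v\<in>UNIV. lookup n v * E v w)"
  show "texp E m = texp E n"
  proof (rule poly_mapping_eqI)
    fix k show "lookup (texp E m) k = lookup (texp E n) k"
      using * by (cases "k \<in> range var_index") (auto simp: lookup_texp lookup_texp_out)
  qed
qed

interpretation const_hom: scalar_hom "single 0 :: 'k::field \<Rightarrow> ('m::comm_monoid_add) \<Rightarrow>\<^sub>0 'k"
  by unfold_locales (simp_all add: single_add mult_single)

text \<open>The homomorphism that sends the variables in \<open>W\<close> to \<open>0\<close> and every other variable \<open>v\<close> to the
  monomial with exponent vector \<open>E v\<close>.  Its target is a domain, so its kernel is prime.\<close>

definition torus_hom :: "(3 + 3) set \<Rightarrow> (3 + 3 \<Rightarrow> 3 + 3 \<Rightarrow> nat) \<Rightarrow> 'k::field bipoly \<Rightarrow> (nat \<Rightarrow>\<^sub>0 nat) \<Rightarrow>\<^sub>0 'k" where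
  "torus_hom W E = lin_ext (single 0) (\<lambda>m. if avoids W m then single (texp E m) 1 else 0)"

definition tker :: "(3 + 3) set \<Rightarrow> (3 + 3 \<Rightarrow> 3 + 3 \<Rightarrow> nat) \<Rightarrow> 'k::field bipoly set" where
  "tker W E = {f. torus_hom W E f = 0}"

lemma single_eq_0: "single m c = 0 \<longleftrightarrow> c = 0"
  by (metis keys_eq_empty keys_single insert_not_empty single_zero)

lemma torus_hom_add: "torus_hom W E (f + g) = torus_hom W E f + torus_hom W E g"
  by (simp add: torus_hom_def const_hom.lin_ext_add)

lemma torus_hom_zero [simp]: "torus_hom W E 0 = 0"
  by (simp add: torus_hom_def)

lemma torus_hom_diff: "torus_hom W E (f - g) = torus_hom W E f - torus_hom W E g"
  using torus_hom_add[of W E "f - g" g] by simp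

lemma torus_hom_mult: "torus_hom W E (f * g) = torus_hom W E f * torus_hom W E g"
  unfolding torus_hom_def
  by (rule const_hom.lin_ext_mult) (auto simp: avoids_def texp_add lookup_add mult_single)

lemma torus_hom_single: "torus_hom W E (single m c) = (if avoids W m then single (texp E m) c else 0)"
  by (simp add: torus_hom_def const_hom.lin_ext_single mult_single)

lemma torus_hom_one: "torus_hom W E 1 = 1"
  using torus_hom_single[of W E 0 1] by (simp add: avoids_def)

lemma torus_hom_sum: "torus_hom W E (\<Sum>i\<in>A. f i) = (\<Sum>i\<in>A. torus_hom W E (f i))"
  by (induction A rule: infinite_finite_induct) (auto simp: torus_hom_add)

lemma is_ideal_tker: "is_ideal (tker W E)"
  by (auto simp: is_ideal_def tker_def torus_hom_add torus_hom_mult)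

lemma monomial_in_tker: "single m 1 \<in> tker W E \<longleftrightarrow> \<not> avoids W m"
  by (simp add: tker_def torus_hom_single single_eq_0)

lemma binomial_in_tker:
  assumes "avoids W m" "avoids W n"
  shows "(single m 1 - single n 1 :: 'a::field bipoly) \<in> tker W E \<longleftrightarrow> texp E m = texp E n"
proof -
  have "single p (1 :: 'a) = single q 1 \<Longrightarrow> p = q" for p q :: "nat \<Rightarrow>\<^sub>0 nat"
    by (metis lookup_single_eq lookup_single_not_eq zero_neq_one)
  then show ?thesis using assms by (auto simp: tker_def torus_hom_diff torus_hom_single)
qed

lemma keys_torus_hom: "keys (torus_hom W E f) \<subseteq> texp E ` {m \<in> keys f. avoids W m}"
proof -
  have "keys (torus_hom W E f) \<subseteq> (\<Union>m\<in>keys f. keys (single 0 (lookup f m) * (if avoids W m then single (texp E m) 1 else 0)))"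
    unfolding torus_hom_def lin_ext_def by (rule keys_sum)
  also have "\<dots> \<subseteq> texp E ` {m \<in> keys f. avoids W m}"
    by (auto simp: mult_single split: if_splits)
  finally show ?thesis .
qed

text \<open>Modulo an ideal containing the monomials and binomials of the kernel, every polynomial is
  congruent to a combination of chosen representatives that is determined by its image.\<close>

definition tnormal :: "((nat \<Rightarrow>\<^sub>0 nat) \<Rightarrow> 3 + 3 \<Rightarrow>\<^sub>0 nat) \<Rightarrow> (3 + 3) set \<Rightarrow> (3 + 3 \<Rightarrow> 3 + 3 \<Rightarrow> nat) \<Rightarrow>
    'k::field bipoly \<Rightarrow> 'k bipoly" where
  "tnormal \<rho> W E f = lin_ext (single 0) (\<lambda>g. single (\<rho> g) 1) (torus_hom W E f)"

lemma minus_tnormal: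
  assumes J: "is_ideal J" and mon: "\<And>m. \<not> avoids W m \<Longrightarrow> single m 1 \<in> J"
    and bin: "\<And>m. m \<in> keys f \<Longrightarrow> avoids W m \<Longrightarrow> single m 1 - single (\<rho> (texp E m)) 1 \<in> J"
  shows "f - tnormal \<rho> W E f \<in> J"
proof -
  have single: "single m c - tnormal \<rho> W E (single m c) \<in> J" if m: "m \<in> keys f" for m c
  proof -
    have "single m c - tnormal \<rho> W E (single m c) =
        cst c * (if avoids W m then single m 1 - single (\<rho> (texp E m)) 1 else single m 1)"
      by (simp add: tnormal_def torus_hom_single const_hom.lin_ext_single right_diff_distrib mult_single)
    then show ?thesis using mon bin m J by (auto intro: is_idealD(3))
  qed
  have "tnormal \<rho> W E f = (\<Sum>m\<in>keys f. tnormal \<rho> W E (single m (lookup f m)))"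
    by (subst sum_singles[of f]) (simp add: tnormal_def torus_hom_sum const_hom.lin_ext_sum)
  then have "f - tnormal \<rho> W E f = (\<Sum>m\<in>keys f. single m (lookup f m) - tnormal \<rho> W E (single m (lookup f m)))"
    by (subst (1) sum_singles[of f]) (simp add: sum_subtractf)
  also have "\<dots> \<in> J" using single by (intro is_ideal_sum J)
  finally show ?thesis .
qed

lemma tker_least:
  assumes J: "is_ideal J" and mon: "\<And>m. \<not> avoids W m \<Longrightarrow> single m 1 \<in> J"
    and bin: "\<And>m n. avoids W m \<Longrightarrow> avoids W n \<Longrightarrow> texp E m = texp E n \<Longrightarrow> single m 1 - single n 1 \<in> J"
  shows "tker W E \<subseteq> J"
proof
  fix f :: "'a bipoly" assume f: "f \<in> tker W E"
  define \<rho> where "\<rho> g = (SOME m. avoids W m \<and> texp E m = g)" for g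
  have \<rho>: "avoids W (\<rho> (texp E m)) \<and> texp E (\<rho> (texp E m)) = texp E m" if "avoids W m" for m
    unfolding \<rho>_def by (rule someI[of _ m]) (use that in simp)
  have "f - tnormal \<rho> W E f \<in> J"
    using \<rho> by (intro minus_tnormal J mon bin) auto
  moreover have "tnormal \<rho> W E f = 0" using f by (simp add: tker_def tnormal_def)
  ultimately show "f \<in> J" by simp
qed

definition graded_exp :: "(3 + 3) set \<Rightarrow> (3 + 3 \<Rightarrow> 3 + 3 \<Rightarrow> nat) \<Rightarrow> bool" where
  "graded_exp W E \<longleftrightarrow> (\<forall>m n. avoids W m \<longrightarrow> avoids W n \<longrightarrow> texp E m = texp E n \<longrightarrow> bideg m = bideg n)"

text \<open>Homogeneity: by the grading hypothesis, distinct bihomogeneous parts have images with disjoint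
  supports.\<close>

lemma gprime_tker:
  assumes "graded_exp W E"
  shows "gprime (tker W E)"
proof -
  have "part a b f \<in> tker W E" if f: "f \<in> tker W E" for a b and f :: "'a bipoly"
  proof -
    let ?t = "torus_hom W E (part a b f)" and ?s = "torus_hom W E (f - part a b f)"
    have "keys ?t \<inter> keys ?s = {}"
    proof (rule ccontr)
      assume "keys ?t \<inter> keys ?s \<noteq> {}"
      then obtain m n where mn: "m \<in> keys (part a b f)" "n \<in> keys (f - part a b f)" "avoids W m" "avoids W n"
        "texp E m = texp E n"
      proof -
        obtain g where "g \<in> keys ?t" "g \<in> keys ?s" using \<open>keys ?t \<inter> keys ?s \<noteq> {}\<close> by blast
        then have "g \<in> texp E ` {m \<in> keys (part a b f). avoids W m}"
          "g \<in> texp E ` {m \<in> keys (f - part a b f). avoids W m}"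
          using keys_torus_hom by blast+
        then obtain m n where "m \<in> keys (part a b f)" "avoids W m" "g = texp E m"
          "n \<in> keys (f - part a b f)" "avoids W n" "g = texp E n"
          by (elim imageE) blast
        then show ?thesis using that[of m n] by simp
      qed
      then have "bideg m = bideg n" using assms unfolding graded_exp_def by blast
      moreover have "bideg m = (a, b)" using mn(1) bihomog_part[of a b f] by (simp add: bihomog_iff)
      moreover have "bideg n \<noteq> (a, b)"
        using mn(2) by (auto simp: in_keys_iff lookup_minus lookup_part)
      ultimately show False by simp
    qed
    moreover have "?t + ?s = 0" using f by (simp add: tker_def flip: torus_hom_add)
    then have "?s = - ?t" by (simp add: eq_neg_iff_add_eq_0 add.commute)
    ultimately have "keys ?t = {}" by simp
    then have "?t = 0" by (metis poly_mapping_eqI in_keys_iff empty_iff lookup_zero)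
    then show ?thesis by (simp add: tker_def)
  qed
  moreover have "1 \<notin> tker W E" by (simp add: tker_def torus_hom_one)
  moreover have "f \<in> tker W E \<or> g \<in> tker W E" if "f * g \<in> tker W E" for f g :: "'a bipoly"
    using that by (simp add: tker_def torus_hom_mult)
  ultimately show ?thesis
    unfolding gprime_def bihomog_ideal_iff using is_ideal_tker[of W E] by blast
qed

lemma Var_eq: "Var v = single (single v 1) 1"
  by (simp add: Var_def)

lemma Var_in_tker: "Var v \<in> tker W E \<longleftrightarrow> v \<in> W"
  unfolding Var_eq monomial_in_tker by (auto simp: avoids_def lookup_single when_def)

lemma subvariety_tker:
  assumes "graded_exp W E" "Inl i \<notin> W" "Inr j \<notin> W"
  shows "subvariety (tker W E)"
  using gprime_tker[OF assms(1)] assms(2,3) by (auto simp: subvariety_iff Var_in_tker)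

text \<open>Representatives of the monomials with distinct nonzero images form a basis of the quotient.\<close>

lemma hilb_tker:
  fixes W E
  defines "M \<equiv> \<lambda>a b. {m. bideg m = (a, b) \<and> avoids W m}"
  shows "hilb (tker W E :: 'k::field bipoly set) a b = card (texp E ` M a b)"
proof (rule antisym)
  let ?G = "texp E ` M a b"
  let ?I = "tker W E :: 'k bipoly set"
  define \<rho> where "\<rho> g = (SOME m. m \<in> M a b \<and> texp E m = g)" for g
  have \<rho>: "\<rho> (texp E m) \<in> M a b \<and> texp E (\<rho> (texp E m)) = texp E m" if "m \<in> M a b" for m
    unfolding \<rho>_def by (rule someI[of _ m]) (use that in simp)
  have fin: "finite ?G"
    unfolding M_def using finite_bideg by (intro finite_imageI) (rule finite_subset[OF _ finite_bideg], auto)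
  have "span_mod ?I a b ?G (\<lambda>g. single (\<rho> g) 1)"
    unfolding span_mod_def
  proof (intro conjI fin allI impI)
    fix f :: "'k bipoly" assume f: "bihomog a b f"
    have K: "m \<in> M a b" if "m \<in> keys f" "avoids W m" for m
      using that f by (auto simp: M_def bihomog_iff)
    have "f - tnormal \<rho> W E f \<in> ?I"
    proof (rule minus_tnormal[OF is_ideal_tker])
      show "single m 1 \<in> ?I" if "\<not> avoids W m" for m using that by (simp add: monomial_in_tker)
      show "single m 1 - single (\<rho> (texp E m)) 1 \<in> ?I" if "m \<in> keys f" "avoids W m" for m
        using \<rho>[OF K[OF that]] that(2) by (subst binomial_in_tker) (auto simp: M_def)
    qed
    moreover have "tnormal \<rho> W E f = (\<Sum>g\<in>?G. cst (lookup (torus_hom W E f) g) * single (\<rho> g) 1)"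
      unfolding tnormal_def using keys_torus_hom[of W E f] K
      by (intro const_hom.lin_ext_superset fin) fastforce
    ultimately show "\<exists>c. f - (\<Sum>g\<in>?G. cst (c g) * single (\<rho> g) 1) \<in> ?I" by auto
  qed
  then show "hilb ?I a b \<le> card ?G" by (rule hilb_le[OF is_ideal_tker])
  have "indep_mod ?I ?G (\<lambda>g. single (\<rho> g) 1)"
    unfolding indep_mod_def
  proof (intro conjI fin allI impI ballI)
    fix c h assume c: "(\<Sum>g\<in>?G. cst (c g) * single (\<rho> g) 1) \<in> ?I" and h: "h \<in> ?G"
    have img: "torus_hom W E (cst (c g) * single (\<rho> g) 1) = single g (c g)" if g: "g \<in> ?G" for g
    proof -
      obtain m where "m \<in> M a b" "g = texp E m" using g by blast
      then show ?thesis using \<rho>[of m] by (simp add: mult_single torus_hom_single M_def)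
    qed
    have "(\<Sum>g\<in>?G. single g (c g)) = 0"
      using c img by (simp add: tker_def torus_hom_sum)
    then have "0 = lookup (\<Sum>g\<in>?G. single g (c g)) h" by simp
    also have "\<dots> = (\<Sum>g\<in>?G. if g = h then c g else 0)"
      unfolding lookup_sum by (intro sum.cong refl) (simp add: lookup_single when_def)
    also have "\<dots> = c h" using h fin by (simp add: sum.delta)
    finally show "c h = 0" by simp
  qed
  then show "card ?G \<le> hilb ?I a b"
    by (rule hilb_ge[OF is_ideal_tker]) (use \<rho> in \<open>auto intro!: bihomog_single simp: M_def\<close>)
qed

subsection \<open>Coordinate subvarieties\<close>

definition id_exp :: "3 + 3 \<Rightarrow> 3 + 3 \<Rightarrow> nat" where
  "id_exp v w = (if v = w then 1 else 0)"

lemma texp_id_exp: "texp id_exp m = texp id_exp n \<longleftrightarrow> m = n"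
proof
  assume "texp id_exp m = texp id_exp n"
  then have "(\<Sum>v\<in>UNIV. lookup m v * id_exp v w) = (\<Sum>v\<in>UNIV. lookup n v * id_exp v w)" for w
    by (simp add: texp_eq_iff)
  moreover have "(\<Sum>v\<in>UNIV. lookup k v * id_exp v w) = lookup k w" for k w
    by (simp add: id_exp_def if_distrib cong: if_cong)
  ultimately show "m = n" by (intro poly_mapping_eqI) simp
qed simp

definition coord :: "(3 + 3) set \<Rightarrow> 'k::field bipoly set" where
  "coord W = genideal cring_class_ops (Var ` W)"

lemma is_ideal_coord: "is_ideal (coord W)"
  by (simp add: coord_def is_ideal_genideal)

lemma coord_least: "is_ideal J \<Longrightarrow> (\<And>v. v \<in> W \<Longrightarrow> Var v \<in> J) \<Longrightarrow> coord W \<subseteq> J"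
  unfolding coord_def by (rule genideal_minimal) auto

lemma coord_eq_tker: "coord W = tker W id_exp"
proof
  show "coord W \<subseteq> tker W id_exp"
    by (rule coord_least) (simp_all add: is_ideal_tker Var_in_tker)
  have Var: "Var v \<in> coord W" if "v \<in> W" for v
    unfolding coord_def using genideal_superset that by fast
  show "tker W id_exp \<subseteq> coord W"
  proof (rule tker_least[OF is_ideal_coord])
    fix m assume "\<not> avoids W m"
    then obtain v where v: "v \<in> W" "lookup m v > 0" by (auto simp: avoids_def)
    show "single m 1 \<in> coord W"
      unfolding single_Var_factor[OF v(2), of 1] using is_ideal_coord Var[OF v(1)] by (rule is_idealD(3))
  qed (simp add: texp_id_exp is_idealD(1)[OF is_ideal_coord])
qed

lemma graded_id_exp: "graded_exp W id_exp"
  by (simp add: graded_exp_def texp_id_exp)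

lemma subvariety_coord: "Inl i \<notin> W \<Longrightarrow> Inr j \<notin> W \<Longrightarrow> subvariety (coord W)"
  unfolding coord_eq_tker by (rule subvariety_tker[OF graded_id_exp])

lemma Var_in_coord: "Var v \<in> coord W \<longleftrightarrow> v \<in> W"
  by (simp add: coord_eq_tker Var_in_tker)

lemma coord_strict: "W \<subset> W' \<Longrightarrow> coord W \<subset> coord W'"
proof -
  assume W: "W \<subset> W'"
  then obtain v where "v \<in> W'" "v \<notin> W" by blast
  moreover have "coord W \<subseteq> coord W'"
    using W by (intro coord_least is_ideal_coord) (auto simp: Var_in_coord)
  ultimately show ?thesis using Var_in_coord[of v W] Var_in_coord[of v W'] by blast
qed

lemma coord_empty: "coord {} = {0}"
proof -
  have "is_ideal {0 :: 'a bipoly}" by (simp add: is_ideal_def)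
  then show ?thesis using coord_least[of "{0}" "{}"] is_idealD(1)[OF is_ideal_coord] by blast
qed

lemma subvariety_zero: "subvariety {0}"
  using subvariety_coord[of 0 "{}" 0] by (simp add: coord_empty)

lemma dimv_less_4:
  assumes "subvariety V" "V \<noteq> {0}"
  shows "dimv V < 4"
proof -
  have "{0} \<subset> V" using assms is_idealD(1)[OF gprimeD(2)[OF subvariety_gprime[OF assms(1)]]] by blast
  then show ?thesis using dimv_less[OF subvariety_zero assms(1)] dimv_le_4[OF subvariety_zero] by (metis less_le_trans)
qed

lemma inj_sum_3: "\<exists>i. f (i :: 3) \<notin> W" if "inj f" "card W < 3" "finite W"
proof (rule ccontr)
  assume "\<nexists>i. f i \<notin> W"
  then have "range f \<subseteq> W" by auto
  then have "card (range f) \<le> card W" using that by (intro card_mono)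
  then show False using that by (simp add: card_image)
qed

text \<open>Adding the variables one at a time gives a chain of coordinate subvarieties of the greatest possible
  length, in which every inclusion lowers the dimension by exactly one.\<close>

lemma coord_surface:
  fixes v w :: "3 + 3"
  defines "S \<equiv> coord {v, w} :: 'k::field bipoly set" and "H \<equiv> coord {v} :: 'k bipoly set"
  assumes "v \<noteq> w"
  shows "subvariety S" "dimv S = 2" "subvariety H" "dimv H = 3"
proof -
  let ?c = "coord :: _ \<Rightarrow> 'k bipoly set"
  have W: "card {v, w} < 3" "finite {v, w}" using assms by auto
  obtain i where i: "Inl i \<notin> {v, w}" using inj_sum_3[OF _ W, of Inl] by auto
  obtain j where j: "Inr j \<notin> {v, w}" using inj_sum_3[OF _ W, of Inr] by auto
  define U where "U = (UNIV :: (3 + 3) set) - {Inl i, Inr j}"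
  have "card (U - {v, w}) = 2"
  proof -
    have "card (UNIV :: (3 + 3) set) = 6" by simp
    moreover have "U - {v, w} = UNIV - {Inl i, Inr j, v, w}" by (auto simp: U_def)
    moreover have "card {Inl i, Inr j, v, w} = 4" using i j assms by auto
    ultimately show ?thesis by (simp add: card_Diff_subset)
  qed
  then obtain p q where pq: "U - {v, w} = {p, q}" "p \<noteq> q" by (auto simp: card_2_iff)
  have sv: "subvariety (?c T)" if "T \<subseteq> U" for T
    using that by (intro subvariety_coord[of i _ j]) (auto simp: U_def)
  have vw: "{v, w} \<subseteq> U" using i j by (auto simp: U_def)
  have s: "subvariety (?c {v})" "subvariety (?c {v, w})" "subvariety (?c (insert p {v, w}))"
    "subvariety (?c (insert q (insert p {v, w})))"
    using vw pq(1) by (auto intro!: sv)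
  have sub: "?c {v} \<subset> ?c {v, w}" "?c {v, w} \<subset> ?c (insert p {v, w})"
    "?c (insert p {v, w}) \<subset> ?c (insert q (insert p {v, w}))"
  proof -
    have "p \<notin> {v, w}" "q \<notin> {v, w}" using pq(1) by blast+
    moreover have "w \<notin> {v}" "q \<notin> insert p {v, w}" using assms pq(2) \<open>q \<notin> {v, w}\<close> by auto
    moreover have "?c W \<subset> ?c (insert u W)" if "u \<notin> W" for u W
      using that by (intro coord_strict) auto
    ultimately show "?c {v} \<subset> ?c {v, w}" "?c {v, w} \<subset> ?c (insert p {v, w})"
      "?c (insert p {v, w}) \<subset> ?c (insert q (insert p {v, w}))"
      using insert_commute[of v w "{}"] by metis+
  qed
  note less = dimv_less[OF s(1,2) sub(1)] dimv_less[OF s(2,3) sub(2)] dimv_less[OF s(3,4) sub(3)]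
 have "?c {v} \<noteq> {0}" using coord_strict[of "{}" "{v}"] by (auto simp: coord_empty)
  then have "dimv (?c {v}) < 4" by (rule dimv_less_4[OF s(1)])
  then show "dimv S = 2" "dimv H = 3" using less unfolding S_def H_def by linarith+
  show "subvariety S" "subvariety H" using s by (auto simp: S_def H_def)
qed

lemma eq_coord_surface:
  assumes "subvariety Z" "dimv Z = 2" "Var v \<in> Z" "Var w \<in> Z" "v \<noteq> w"
  shows "Z = coord {v, w}"
proof -
  have "coord {v, w} \<subseteq> Z"
    using assms gprimeD(2)[OF subvariety_gprime] by (intro coord_least) auto
  then show ?thesis using dimv_eq_imp_eq[OF coord_surface(1) assms(1)] coord_surface(2) assms by metis
qed

lemma coordinate_subvariety_eq: "coordinate_subvariety A B = coord (Inl ` A \<union> Inr ` B)"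
  by (simp add: coordinate_subvariety_def coord_def image_Un image_image)

lemma monomial_in_prime:
  assumes Z: "gprime Z" shows "single m 1 \<in> Z \<longleftrightarrow> (\<exists>v. lookup m v > 0 \<and> Var v \<in> Z)"
proof
  assume m: "single m 1 \<in> Z"
  show "\<exists>v. lookup m v > 0 \<and> Var v \<in> Z"
    using m
  proof (induction "\<Sum>v\<in>UNIV. lookup m v" arbitrary: m)
    case 0
    then have "m = 0" by (intro poly_mapping_eqI) simp
    then show ?case using 0 gprimeD(3)[OF Z] by simp
  next
    case (Suc n)
    have "\<exists>v. lookup m v > 0"
    proof (rule ccontr)
      assume "\<nexists>v. lookup m v > 0"
      then have "(\<Sum>v\<in>UNIV. lookup m v) = 0" by simp
      then show False using Suc(2) by simp
    qed
    then obtain v where v: "lookup m v > 0" by blast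
    let ?m = "m - single v 1"
    have le: "lookup ?m w \<le> lookup m w" for w by (simp add: lookup_minus)
    have "single ?m 1 \<in> Z \<or> Var v \<in> Z"
      using Suc(3) gprimeD(4)[OF Z] unfolding single_Var_factor[OF v, of 1] by blast
    then show ?case
    proof
      assume *: "single ?m 1 \<in> Z"
      have "(\<Sum>w\<in>UNIV. lookup m w) = (\<Sum>w\<in>UNIV. lookup ?m w + (if w = v then 1 else 0))"
        using v by (intro sum.cong) (auto simp: lookup_minus lookup_single when_def)
      then have "n = (\<Sum>w\<in>UNIV. lookup ?m w)" using Suc(2) by (simp add: sum.distrib)
      then obtain w where "lookup ?m w > 0" "Var w \<in> Z" using Suc(1)[OF _ *] by blast
      then show ?thesis using le[of w] by (meson less_le_trans)
    qed (use v in blast)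
  qed
next
  assume "\<exists>v. lookup m v > 0 \<and> Var v \<in> Z"
  then show "single m 1 \<in> Z" using single_Var_factor is_idealD(3)[OF gprimeD(2)[OF Z]] by metis
qed

section \<open>Explicit rational equivalences\<close>

lemma ord_along_eq_0:
  assumes "\<And>J. J \<in> local_ideals Z \<Longrightarrow> V \<subseteq> J \<Longrightarrow> f \<in> J \<Longrightarrow> 1 \<in> J"
  shows "ord_along V Z f = 0"
proof -
  have J: "J = UNIV" if "J \<in> local_ideals Z" "V \<subseteq> J" "f \<in> J" for J
    using is_idealD(3)[OF local_idealsD(2)[OF that(1)] assms[OF that]] by auto
  have eq: "{J \<in> local_ideals Z. V \<subseteq> J \<and> f \<in> J} = {UNIV}"
  proof (intro equalityI subsetI)
    fix K assume "K \<in> {J \<in> local_ideals Z. V \<subseteq> J \<and> f \<in> J}"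
    then show "K \<in> {UNIV}" using J by blast
  next
    fix K :: "'a bipoly set" assume "K \<in> {UNIV}"
    then show "K \<in> {J \<in> local_ideals Z. V \<subseteq> J \<and> f \<in> J}" using UNIV_local by simp
  qed
  have "chain_length {UNIV :: 'a bipoly set} = enat 0"
  proof (rule chain_length_eqI)
    show "\<exists>c. (\<forall>i\<le>0. c i \<in> {UNIV}) \<and> (\<forall>i<0. c i \<subset> c (Suc i :: nat))"
      by (rule exI[of _ "\<lambda>_. UNIV"]) simp
    show "m \<le> 0" if "\<forall>i\<le>m. c i \<in> {UNIV}" "\<forall>i<m. c i \<subset> c (Suc i)" for m and c :: "nat \<Rightarrow> 'a bipoly set"
      using that chain_le_rank[of "{UNIV}" "\<lambda>_. 0" 0 m c] by simp
  qed
  then show ?thesis by (simp add: ord_along_def eq)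
qed

text \<open>Under the last hypothesis \<open>Z\<close> and the unit ideal are the only local ideals that contain \<open>V\<close> and
  \<open>f\<close>.\<close>

lemma ord_along_eq_1:
  assumes Z: "gprime Z" and "V \<subseteq> Z" "f \<in> Z"
    and least: "\<And>J. J \<in> local_ideals Z \<Longrightarrow> V \<subseteq> J \<Longrightarrow> f \<in> J \<Longrightarrow> Z \<subseteq> J"
  shows "ord_along V Z f = 1"
proof -
  have J: "J = Z \<or> J = UNIV" if "J \<in> local_ideals Z" "V \<subseteq> J" "f \<in> J" for J
    using local_maximal[OF that(1) gprimeD(2)[OF Z]] least[OF that] by blast
  have eq: "{J \<in> local_ideals Z. V \<subseteq> J \<and> f \<in> J} = {Z, UNIV}" (is "?L = _")
  proof (intro equalityI subsetI)
    fix K assume "K \<in> ?L"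
    then show "K \<in> {Z, UNIV}" using J by blast
  next
    fix K assume "K \<in> {Z, UNIV}"
    then show "K \<in> ?L" using assms(2,3) prime_local[OF Z] UNIV_local by auto
  qed
  have "Z \<noteq> UNIV" using gprimeD(3)[OF Z] by blast
  have "chain_length {Z, UNIV} = enat 1"
  proof (rule chain_length_eqI)
    show "\<exists>c. (\<forall>i\<le>1. c i \<in> {Z, UNIV}) \<and> (\<forall>i<1. c i \<subset> c (Suc i :: nat))"
      by (rule exI[of _ "\<lambda>i. if i = 0 then Z else UNIV"]) (use \<open>Z \<noteq> UNIV\<close> in auto)
    show "m \<le> 1" if "\<forall>i\<le>m. c i \<in> {Z, UNIV}" "\<forall>i<m. c i \<subset> c (Suc i)" for m c
    proof (rule chain_le_rank[OF _ _ that])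
      show "(if J = UNIV then 1 else 0 :: nat) \<le> 1" for J :: "'a bipoly set" by simp
      show "(if J = UNIV then 1 else 0 :: nat) < (if K = UNIV then 1 else 0)"
        if "J \<in> {Z, UNIV}" "K \<in> {Z, UNIV}" "J \<subset> K" for J K :: "'a bipoly set"
        using that by auto
    qed
  qed
  then show ?thesis by (simp add: ord_along_def eq)
qed

lemma local_unit:
  assumes "J \<in> local_ideals Z" "bihomog a b f" "f \<in> J" "f \<notin> Z"
  shows "1 \<in> J"
  using local_idealsD(3)[OF assms(1,2,4), of 1] assms(3) by simp

lemma bihomog_Var: "\<exists>a b. bihomog a b (Var v)"
  using bihomog_Inl bihomog_Inr by (cases v) blast+

lemma ord_along_coord:
  assumes vw: "v \<noteq> w" and Z: "subvariety Z" "dimv Z = 2"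
  shows "ord_along (coord {v}) Z (Var w) = (if Z = coord {v, w} then 1 else 0)"
proof (cases "Z = coord {v, w}")
  case True
  have "ord_along (coord {v}) Z (Var w) = 1"
  proof (rule ord_along_eq_1[OF subvariety_gprime[OF Z(1)]])
    show "coord {v} \<subseteq> Z" unfolding True by (rule coord_least[OF is_ideal_coord]) (simp add: Var_in_coord)
    show "Var w \<in> Z" unfolding True by (simp add: Var_in_coord)
    show "Z \<subseteq> J" if "J \<in> local_ideals Z" "coord {v} \<subseteq> J" "Var w \<in> J" for J
      unfolding True using that(2,3) Var_in_coord[of v "{v}"]
      by (intro coord_least local_idealsD(2)[OF that(1)]) auto
  qed
  then show ?thesis using True by simp
next
  case False
  then have "Var v \<notin> Z \<or> Var w \<notin> Z" using eq_coord_surface[OF Z _ _ vw] by blast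
  then have "ord_along (coord {v}) Z (Var w) = 0"
    using Var_in_coord[of v "{v}"] bihomog_Var local_unit by (intro ord_along_eq_0) blast
  then show ?thesis using False by simp
qed

abbreviation rat_triv :: "('k::field bipoly set \<Rightarrow>\<^sub>0 int) set" where
  "rat_triv \<equiv> generate (cycle_group 2) (principal_cycles 2)"

lemma rat_triv_zero: "0 \<in> rat_triv"
  using generate.one[of "cycle_group 2" "principal_cycles 2"] by (simp add: cycle_group_def)

lemma rat_triv_add: "x \<in> rat_triv \<Longrightarrow> y \<in> rat_triv \<Longrightarrow> x + y \<in> rat_triv"
  using generate.eng[of x "cycle_group 2" "principal_cycles 2" y] by (simp add: cycle_group_def)

lemma rat_triv_uminus: "x \<in> rat_triv \<Longrightarrow> - x \<in> rat_triv"
  using subgroup.m_inv_closed[OF subgroup_rationally_trivial, of x]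
    subgroup.mem_carrier[OF subgroup_rationally_trivial, of x] by (simp add: cycle_group_def)

lemma rat_triv_diff: "x \<in> rat_triv \<Longrightarrow> y \<in> rat_triv \<Longrightarrow> x - y \<in> rat_triv"
  using rat_triv_add[OF _ rat_triv_uminus, of x y] by simp

lemma rat_triv_cmul: "x \<in> rat_triv \<Longrightarrow> frag_cmul c x \<in> rat_triv"
proof (induction c rule: int_induct[where k = 0])
  case base
  show ?case by (simp add: rat_triv_zero)
next
  case (step1 i)
  then show ?case by (simp add: frag_cmul_distrib rat_triv_add)
next
  case (step2 i)
  then show ?case by (simp add: frag_cmul_diff_distrib rat_triv_diff)
qed

lemma principal_rat_triv:
  assumes keys: "\<And>Z. Z \<in> keys \<alpha> \<Longrightarrow> subvariety Z \<and> dimv Z = 2"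
    and V: "subvariety V" "dimv V = 3" and f: "bihomog a b f" "f \<notin> V" and g: "bihomog a b g" "g \<notin> V"
    and "\<And>Z. subvariety Z \<Longrightarrow> dimv Z = 2 \<Longrightarrow> lookup \<alpha> Z = ord_along V Z f - ord_along V Z g"
  shows "\<alpha> \<in> rat_triv"
proof (rule generate.incl)
  show "\<alpha> \<in> principal_cycles 2"
    unfolding principal_cycles_def
  proof (intro CollectI conjI exI)
    show "\<alpha> \<in> carrier (cycle_group 2)"
    proof -
      have "vdim Z = enat 2" if "Z \<in> keys \<alpha>" for Z using keys[OF that] vdim_dimv[of Z] by simp
      then show ?thesis using keys by (auto simp: cycle_group_def)
    qed
    show "vdim V = enat (2 + 1)" using vdim_dimv[OF V(1)] V(2) by simp
    show "\<forall>Z. subvariety Z \<and> vdim Z = enat 2 \<longrightarrow> lookup \<alpha> Z = ord_along V Z f - ord_along V Z g"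
    proof (intro allI impI, elim conjE)
      fix Z :: "'a bipoly set" assume Z: "subvariety Z" "vdim Z = enat 2"
      then have "dimv Z = 2" using vdim_dimv[OF Z(1)] by simp
      then show "lookup \<alpha> Z = ord_along V Z f - ord_along V Z g" using assms(8) Z(1) by blast
    qed
  qed (use V f g in auto)
qed

text \<open>On the hyperplane \<open>v = 0\<close> the function \<open>w / w'\<close> has divisor \<open>[v = w = 0] - [v = w' = 0]\<close>.\<close>

lemma coord_equiv:
  assumes "v \<noteq> w" "v \<noteq> w'" "bihomog a b (Var w :: 'k bipoly)" "bihomog a b (Var w' :: 'k bipoly)"
  shows "frag_of (coord {v, w}) - frag_of (coord {v, w'}) \<in> (rat_triv :: ('k::field bipoly set \<Rightarrow>\<^sub>0 int) set)"
proof (rule principal_rat_triv[where V = "coord {v}" and f = "Var w" and g = "Var w'" and a = a and b = b])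
  show "subvariety (coord {v} :: 'k bipoly set)" "dimv (coord {v} :: 'k bipoly set) = 3"
    using coord_surface(3,4)[OF assms(1)] by simp_all
  show "Var w \<notin> (coord {v} :: 'k bipoly set)" "Var w' \<notin> (coord {v} :: 'k bipoly set)"
    using assms by (auto simp: Var_in_coord)
  show "subvariety Z \<and> dimv Z = 2" if "Z \<in> keys (frag_of (coord {v, w}) - frag_of (coord {v, w'}))" for Z :: "'k bipoly set"
    using that keys_diff[of "frag_of (coord {v, w} :: 'k bipoly set)" "frag_of (coord {v, w'})"]
      coord_surface(1,2)[OF assms(1)] coord_surface(1,2)[OF assms(2)] by (auto simp: keys_frag_of)
  show "lookup (frag_of (coord {v, w}) - frag_of (coord {v, w'})) Z =
      ord_along (coord {v}) Z (Var w) - ord_along (coord {v}) Z (Var w')"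
    if "subvariety Z" "dimv Z = 2" for Z :: "'k bipoly set"
    using ord_along_coord[OF assms(1) that] ord_along_coord[OF assms(2) that]
    by (auto simp: lookup_minus lookup_single when_def)
qed (fact assms(3,4))+

definition std_cycle :: "int \<Rightarrow> int \<Rightarrow> int \<Rightarrow> 'k::field bipoly set \<Rightarrow>\<^sub>0 int" where
  "std_cycle x y z = frag_cmul x (frag_of (coordinate_subvariety {} {0, 1})) +
     frag_cmul y (frag_of (coordinate_subvariety {0} {0})) +
     frag_cmul z (frag_of (coordinate_subvariety {0, 1} {}))"

lemma std_cycle_add: "std_cycle x y z + std_cycle x' y' z' = std_cycle (x + x') (y + y') (z + z')"
  by (simp add: std_cycle_def frag_cmul_distrib)

lemma std_cycle_cmul: "frag_cmul c (std_cycle x y z) = std_cycle (c * x) (c * y) (c * z)"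
  by (simp add: std_cycle_def frag_cmul_distrib2)

definition std_span :: "('k::field bipoly set \<Rightarrow>\<^sub>0 int) set" where
  "std_span = {\<alpha>. \<exists>x y z. \<alpha> - std_cycle x y z \<in> rat_triv}"

lemma std_span_zero: "0 \<in> std_span"
proof -
  have "0 - std_cycle 0 0 0 = (0 :: 'a bipoly set \<Rightarrow>\<^sub>0 int)" by (simp add: std_cycle_def)
  then show ?thesis unfolding std_span_def using rat_triv_zero by (metis (mono_tags, lifting) mem_Collect_eq)
qed

lemma std_span_add:
  assumes "\<alpha> \<in> std_span" "\<beta> \<in> std_span" shows "\<alpha> + \<beta> \<in> std_span"
proof -
  obtain x y z x' y' z' where "\<alpha> - std_cycle x y z \<in> rat_triv" "\<beta> - std_cycle x' y' z' \<in> rat_triv"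
    using assms unfolding std_span_def by blast
  then have "(\<alpha> - std_cycle x y z) + (\<beta> - std_cycle x' y' z') \<in> rat_triv" by (rule rat_triv_add)
  then have "\<alpha> + \<beta> - std_cycle (x + x') (y + y') (z + z') \<in> rat_triv"
    by (simp add: algebra_simps flip: std_cycle_add)
  then show ?thesis unfolding std_span_def by blast
qed

lemma std_span_cmul:
  assumes "\<alpha> \<in> std_span" shows "frag_cmul c \<alpha> \<in> std_span"
proof -
  obtain x y z where "\<alpha> - std_cycle x y z \<in> rat_triv"
    using assms unfolding std_span_def by blast
  then have "frag_cmul c (\<alpha> - std_cycle x y z) \<in> rat_triv" by (rule rat_triv_cmul)
  moreover have "frag_cmul c (\<alpha> - \<beta>) = frag_cmul c \<alpha> - frag_cmul c \<beta>" for \<beta>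
    by (rule poly_mapping_eqI) (simp add: lookup_minus right_diff_distrib)
  ultimately have "frag_cmul c \<alpha> - std_cycle (c * x) (c * y) (c * z) \<in> rat_triv"
    by (simp add: std_cycle_cmul)
  then show ?thesis unfolding std_span_def by blast
qed

lemma std_span_sum: "(\<And>i. i \<in> A \<Longrightarrow> f i \<in> std_span) \<Longrightarrow> (\<Sum>i\<in>A. f i) \<in> std_span"
  by (induction A rule: infinite_finite_induct) (auto intro: std_span_zero std_span_add)

lemma std_span_equiv:
  assumes "\<alpha> - \<beta> \<in> rat_triv" "\<beta> \<in> std_span" shows "\<alpha> \<in> std_span"
proof -
  obtain x y z where "\<beta> - std_cycle x y z \<in> rat_triv" using assms unfolding std_span_def by blast
  from rat_triv_add[OF assms(1) this] have "\<alpha> - std_cycle x y z \<in> rat_triv" by simp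
  then show ?thesis unfolding std_span_def by blast
qed

lemma coord_in_std_span:
  assumes "v \<noteq> w"
  shows "frag_of (coord {v, w}) \<in> (std_span :: ('k::field bipoly set \<Rightarrow>\<^sub>0 int) set)"
proof -
  let ?S = "std_span :: ('k bipoly set \<Rightarrow>\<^sub>0 int) set"
  have base: "frag_of (coord {Inr 0, Inr 1}) \<in> ?S" "frag_of (coord {Inl 0, Inr 0}) \<in> ?S"
    "frag_of (coord {Inl 0, Inl 1}) \<in> ?S"
  proof -
    have "frag_of (coord {Inr 0, Inr 1}) - std_cycle 1 0 0 = (0 :: 'k bipoly set \<Rightarrow>\<^sub>0 int)"
      "frag_of (coord {Inl 0, Inr 0}) - std_cycle 0 1 0 = (0 :: 'k bipoly set \<Rightarrow>\<^sub>0 int)"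
      "frag_of (coord {Inl 0, Inl 1}) - std_cycle 0 0 1 = (0 :: 'k bipoly set \<Rightarrow>\<^sub>0 int)"
      by (simp_all add: std_cycle_def coordinate_subvariety_eq insert_commute)
    then show "frag_of (coord {Inr 0, Inr 1}) \<in> ?S"
      "frag_of (coord {Inl 0, Inr 0}) \<in> ?S"
      "frag_of (coord {Inl 0, Inl 1}) \<in> ?S"
      unfolding std_span_def using rat_triv_zero by (metis (mono_tags, lifting) mem_Collect_eq)+
  qed
  have move: "frag_of (coord {u, Inl i}) \<in> ?S \<Longrightarrow> u \<noteq> Inl i \<Longrightarrow> u \<noteq> Inl j \<Longrightarrow> frag_of (coord {u, Inl j}) \<in> ?S"
    "frag_of (coord {u, Inr i}) \<in> ?S \<Longrightarrow> u \<noteq> Inr i \<Longrightarrow> u \<noteq> Inr j \<Longrightarrow> frag_of (coord {u, Inr j}) \<in> ?S" for u i j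
    using coord_equiv[OF _ _ bihomog_Inl bihomog_Inl, of u j i] coord_equiv[OF _ _ bihomog_Inr bihomog_Inr, of u j i]
      std_span_equiv by blast+
  have same: "frag_of (coord {\<iota> i, \<iota> j}) \<in> ?S"
    if \<iota>: "\<iota> = Inl \<or> \<iota> = Inr" and "i \<noteq> j" for \<iota> :: "3 \<Rightarrow> 3 + 3" and i j
  proof -
    have move': "frag_of (coord {\<iota> k, \<iota> n}) \<in> ?S"
      if "frag_of (coord {\<iota> k, \<iota> l}) \<in> ?S" "k \<noteq> l" "k \<noteq> n" for k l n
      using \<iota> that move(1)[of "\<iota> k" l n] move(2)[of "\<iota> k" l n] by auto
    have "frag_of (coord {\<iota> 0, \<iota> 1}) \<in> ?S" using \<iota> base by auto
    then have 0: "frag_of (coord {\<iota> 0, \<iota> k}) \<in> ?S" if "k \<noteq> 0" for k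
      using move'[of 0 1 k] that by auto
    show ?thesis
    proof (cases "i = 0")
      case True
      then show ?thesis using 0[of j] \<open>i \<noteq> j\<close> by simp
    next
      case False
      then have "frag_of (coord {\<iota> i, \<iota> 0}) \<in> ?S" using 0[of i] by (subst insert_commute) simp
      then show ?thesis using move'[of i 0 j] False \<open>i \<noteq> j\<close> by simp
    qed
  qed
  have lr: "frag_of (coord {Inl i, Inr j}) \<in> ?S" for i j
  proof -
    have "frag_of (coord {Inl 0, Inr j}) \<in> ?S" using move(2)[OF base(2), of j] by simp
    then have "frag_of (coord {Inr j, Inl 0}) \<in> ?S" by (simp add: insert_commute)
    from move(1)[OF this, of i] show ?thesis by (simp add: insert_commute)
  qed
  show ?thesis
  proof (cases v; cases w)
    fix i j assume "v = Inr i" "w = Inl j"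
    then show ?thesis using lr[of j i] by (simp add: insert_commute)
  qed (use assms same[of Inl] same[of Inr] lr in auto)
qed

section \<open>The graph of a monomial map\<close>

definition monf :: "(3 + 3 \<Rightarrow> nat) \<Rightarrow> 3 + 3 \<Rightarrow>\<^sub>0 nat" where
  "monf f = Abs_poly_mapping f"

lemma lookup_monf [simp]: "lookup (monf f) v = f v"
  by (simp add: monf_def)

lemma monf_lookup [simp]: "monf (lookup m) = m"
  by (rule poly_mapping_eqI) simp

lemma monf_add: "monf (\<lambda>v. f v + g v) = monf f + monf g"
  by (rule poly_mapping_eqI) (simp add: lookup_add)

definition bicong :: "'k::field bipoly set \<Rightarrow> (3 + 3 \<Rightarrow> nat) \<Rightarrow> (3 + 3 \<Rightarrow> nat) \<Rightarrow> bool" where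
  "bicong J f g \<longleftrightarrow> single (monf f) 1 - single (monf g) 1 \<in> J"

context
  fixes J :: "'k::field bipoly set"
  assumes J: "is_ideal J"
begin

lemma bicong_refl: "bicong J f f"
  using is_idealD(1)[OF J] by (simp add: bicong_def)

lemma bicong_sym: "bicong J f g \<Longrightarrow> bicong J g f"
  unfolding bicong_def using is_idealD(5)[OF J] by fastforce

lemma bicong_trans: "bicong J f g \<Longrightarrow> bicong J g h \<Longrightarrow> bicong J f h"
  unfolding bicong_def using is_idealD(2)[OF J] by fastforce

lemma bicong_add:
  assumes "bicong J f g" "bicong J f' g'"
  shows "bicong J (\<lambda>v. f v + f' v) (\<lambda>v. g v + g' v)"
proof -
  let ?m = "\<lambda>f. single (monf f) (1 :: 'k)"
  have "?m (\<lambda>v. f v + f' v) - ?m (\<lambda>v. g v + g' v) = ?m f' * (?m f - ?m g) + ?m g * (?m f' - ?m g')"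
    by (simp add: monf_add mult_single right_diff_distrib add.commute)
  then show ?thesis using assms is_idealD(2,3)[OF J] by (simp add: bicong_def)
qed

lemma bicong_scale: "bicong J f g \<Longrightarrow> bicong J (\<lambda>v. n * f v) (\<lambda>v. n * g v)"
proof (induction n)
  case 0
  show ?case by (simp add: bicong_refl)
next
  case (Suc n)
  then show ?case using bicong_add[of f g "\<lambda>v. n * f v" "\<lambda>v. n * g v"] by simp
qed

end

definition unitv :: "3 \<Rightarrow> 3 \<Rightarrow> nat" where
  "unitv j k = (if k = j then 1 else 0)"

text \<open>The parametrization \<open>x\<^sub>i \<mapsto> X\<^sub>i\<close>, \<open>y\<^sub>j \<mapsto> C X\<^sup>a\<^sup>j\<close> of the cone over the graph; the slot \<open>Inl i\<close> stands for
  \<open>X\<^sub>i\<close> and \<open>Inr 0\<close> for \<open>C\<close>.\<close>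

definition gam_exp :: "(3 \<Rightarrow> 3 \<Rightarrow> nat) \<Rightarrow> 3 + 3 \<Rightarrow> 3 + 3 \<Rightarrow> nat" where
  "gam_exp a = case_sum (\<lambda>i. case_sum (unitv i) (\<lambda>_. 0)) (\<lambda>j. case_sum (a j) (unitv 0))"

text \<open>The parametrization \<open>x\<^sub>i \<mapsto> X\<^sub>i\<close>, \<open>y\<^sub>0 \<mapsto> C X\<^sup>q\<close>, \<open>y\<^sub>1 \<mapsto> C X\<^sup>p\<close>, \<open>y\<^sub>2 \<mapsto> D\<close> of the threefold
  \<open>y\<^sub>0 x\<^sup>p = y\<^sub>1 x\<^sup>q\<close>; the slots \<open>Inr 0\<close> and \<open>Inr 1\<close> stand for \<open>C\<close> and \<open>D\<close>.\<close>

definition hyp_exp :: "(3 \<Rightarrow> nat) \<Rightarrow> (3 \<Rightarrow> nat) \<Rightarrow> 3 + 3 \<Rightarrow> 3 + 3 \<Rightarrow> nat" where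
  "hyp_exp p q = case_sum (\<lambda>i. case_sum (unitv i) (\<lambda>_. 0))
     (\<lambda>j. if j = 0 then case_sum q (unitv 0) else if j = 1 then case_sum p (unitv 0) else case_sum (\<lambda>_. 0) (unitv 1))"

lemma sum_3_3: "(\<Sum>v\<in>(UNIV :: (3 + 3) set). F v) = (\<Sum>i\<in>UNIV. F (Inl i)) + (\<Sum>j\<in>UNIV. F (Inr j))"
  using sum.Plus[of "UNIV :: 3 set" "UNIV :: 3 set" F] by (simp add: UNIV_Plus_UNIV)

lemma all_3_3: "(\<forall>w :: 3 + 3. P w) \<longleftrightarrow> (\<forall>i. P (Inl i)) \<and> (\<forall>j. P (Inr j))"
  by (metis sum.exhaust)

lemma sum_unitv: "(\<Sum>i\<in>UNIV. f i * unitv i k) = f k"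
proof -
  have "(\<Sum>i\<in>UNIV. f i * unitv i k) = (\<Sum>i\<in>UNIV. if i = k then f i else 0)"
    by (intro sum.cong) (auto simp: unitv_def)
  then show ?thesis by simp
qed

lemma sum_unitv_left: "(\<Sum>j\<in>UNIV. unitv i j * f j) = f i"
proof -
  have "(\<Sum>j\<in>UNIV. unitv i j * f j) = (\<Sum>j\<in>UNIV. if j = i then f j else 0)"
    by (intro sum.cong) (auto simp: unitv_def)
  then show ?thesis by simp
qed

lemma sum_unitv_one: "(\<Sum>j\<in>UNIV. unitv i j) = 1"
  unfolding unitv_def by simp

lemma distinct3 [simp]: "(0::3) \<noteq> 1" "(0::3) \<noteq> 2" "(1::3) \<noteq> 2" "(1::3) \<noteq> 0" "(2::3) \<noteq> 0" "(2::3) \<noteq> 1"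
  by simp_all

lemma texp_gam_iff:
  "texp (gam_exp a) m = texp (gam_exp a) n \<longleftrightarrow>
    (\<forall>k. lookup m (Inl k) + (\<Sum>j\<in>UNIV. lookup m (Inr j) * a j k) =
         lookup n (Inl k) + (\<Sum>j\<in>UNIV. lookup n (Inr j) * a j k)) \<and>
    (\<Sum>j\<in>UNIV. lookup m (Inr j)) = (\<Sum>j\<in>UNIV. lookup n (Inr j))"
proof -
  have "(\<Sum>v\<in>UNIV. lookup m v * gam_exp a v (Inl k)) = lookup m (Inl k) + (\<Sum>j\<in>UNIV. lookup m (Inr j) * a j k)" for m k
    by (simp add: sum_3_3 gam_exp_def sum_unitv)
  moreover have "(\<Sum>v\<in>UNIV. lookup m v * gam_exp a v (Inr k)) = (\<Sum>j\<in>UNIV. lookup m (Inr j)) * unitv 0 k" for m k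
    by (simp add: sum_3_3 gam_exp_def sum_distrib_right)
  ultimately show ?thesis
    unfolding texp_eq_iff by (simp add: all_3_3 all3) (auto simp: unitv_def)
qed

lemma texp_hyp_iff:
  "texp (hyp_exp p q) m = texp (hyp_exp p q) n \<longleftrightarrow>
    (\<forall>k. lookup m (Inl k) + lookup m (Inr 0) * q k + lookup m (Inr 1) * p k =
         lookup n (Inl k) + lookup n (Inr 0) * q k + lookup n (Inr 1) * p k) \<and>
    lookup m (Inr 0) + lookup m (Inr 1) = lookup n (Inr 0) + lookup n (Inr 1) \<and>
    lookup m (Inr 2) = lookup n (Inr 2)"
proof -
  have "(\<Sum>v\<in>UNIV. lookup m v * hyp_exp p q v (Inl k)) =
      lookup m (Inl k) + lookup m (Inr 0) * q k + lookup m (Inr 1) * p k" for m k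
    by (simp add: sum_3_3 hyp_exp_def sum_unitv) (simp add: sum3)
  moreover have "(\<Sum>v\<in>UNIV. lookup m v * hyp_exp p q v (Inr k)) =
      (lookup m (Inr 0) + lookup m (Inr 1)) * unitv 0 k + lookup m (Inr 2) * unitv 1 k" for m k
    by (simp add: sum_3_3 hyp_exp_def) (simp add: sum3 distrib_right)
  ultimately show ?thesis
    unfolding texp_eq_iff by (simp add: all_3_3 all3) (auto simp: unitv_def)
qed

definition graph_ideal :: "(3 \<Rightarrow> 3 \<Rightarrow> nat) \<Rightarrow> 'k::field bipoly set" where
  "graph_ideal a = tker {} (gam_exp a)"

lemma avoids_empty [simp]: "avoids {} m"
  by (simp add: avoids_def)

text \<open>The exponents of the two monomials of \<open>y\<^sub>0 x\<^sup>p - y\<^sub>j x\<^sup>q\<close>, where \<open>p\<close> and \<open>q\<close> are the positive and the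
  negative part of the difference of the rows \<open>j\<close> and \<open>0\<close>.\<close>

definition lbin :: "(3 \<Rightarrow> 3 \<Rightarrow> nat) \<Rightarrow> 3 \<Rightarrow> 3 + 3 \<Rightarrow> nat" where
  "lbin a j = case_sum (\<lambda>k. a j k - a 0 k) (unitv 0)"

definition rbin :: "(3 \<Rightarrow> 3 \<Rightarrow> nat) \<Rightarrow> 3 \<Rightarrow> 3 + 3 \<Rightarrow> nat" where
  "rbin a j = case_sum (\<lambda>k. a 0 k - a j k) (unitv j)"

definition graph_binomial :: "(3 \<Rightarrow> 3 \<Rightarrow> nat) \<Rightarrow> 3 \<Rightarrow> 'k::field bipoly" where
  "graph_binomial a j = single (monf (lbin a j)) 1 - single (monf (rbin a j)) 1"

text \<open>Away from the coordinate hyperplanes the two binomials cut out the graph: up to a power of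
  the monomial \<open>x\<^sup>a\<^sup>0\<close>, each \<open>y\<^sub>j\<close> may be replaced by \<open>y\<^sub>0 x\<^sup>a\<^sup>j\<close>.\<close>

lemma graph_ideal_least:
  assumes J: "is_ideal J" and F: "graph_binomial a 1 \<in> J" "graph_binomial a 2 \<in> J"
    and cancel: "\<And>m x. single m 1 * x \<in> J \<Longrightarrow> x \<in> J"
  shows "graph_ideal a \<subseteq> J"
  unfolding graph_ideal_def
proof (rule tker_least[OF J])
  fix m n assume eq: "texp (gam_exp a) m = texp (gam_exp a) n"
  have bin: "bicong J (case_sum (a 0) (unitv j)) (case_sum (a j) (unitv 0))" for j
  proof (cases "j = 0")
    case True
    then show ?thesis by (simp add: bicong_refl[OF J])
  next
    case False
    then have "j = 1 \<or> j = 2" using UNIV3 by auto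
    then have "graph_binomial a j \<in> J" using F by auto
    then have "bicong J (lbin a j) (rbin a j)" by (simp add: graph_binomial_def bicong_def)
    from bicong_add[OF J this bicong_refl[OF J, of "case_sum (\<lambda>k. min (a 0 k) (a j k)) (\<lambda>_. 0)"]]
    have *: "bicong J (\<lambda>v. lbin a j v + case_sum (\<lambda>k. min (a 0 k) (a j k)) (\<lambda>_. 0) v)
        (\<lambda>v. rbin a j v + case_sum (\<lambda>k. min (a 0 k) (a j k)) (\<lambda>_. 0) v)" .
    have l: "(\<lambda>v. lbin a j v + case_sum (\<lambda>k. min (a 0 k) (a j k)) (\<lambda>_. 0) v) = case_sum (a j) (unitv 0)"
      by (rule ext) (auto simp: lbin_def split: sum.split)
    have r: "(\<lambda>v. rbin a j v + case_sum (\<lambda>k. min (a 0 k) (a j k)) (\<lambda>_. 0) v) = case_sum (a 0) (unitv j)"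
      by (rule ext) (auto simp: rbin_def split: sum.split)
    show ?thesis using bicong_sym[OF J *] unfolding l r .
  qed
  define W where "W m = (\<Sum>j\<in>UNIV. lookup m (Inr j))" for m :: "3 + 3 \<Rightarrow>\<^sub>0 nat"
  define c :: "3 + 3 \<Rightarrow> nat" where "c = case_sum (\<lambda>k. W m * a 0 k) (\<lambda>_. 0)"
  define R where "R m = case_sum (\<lambda>k. lookup m (Inl k) + (\<Sum>j\<in>UNIV. lookup m (Inr j) * a j k)) (\<lambda>l. W m * unitv 0 l)" for m :: "3 + 3 \<Rightarrow>\<^sub>0 nat"
  have Wn: "W m = W n" using eq by (simp add: texp_gam_iff W_def)
  have Rn: "R m = R n" using eq by (simp add: texp_gam_iff R_def Wn)
  have key: "bicong J (\<lambda>v. lookup m' v + c v) (R m')" if W: "W m' = W m" for m'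
  proof -
    let ?w = "\<lambda>j. lookup m' (Inr j)"
    let ?L = "\<lambda>j v. ?w j * case_sum (a 0) (unitv j) v" and ?R = "\<lambda>j v. ?w j * case_sum (a j) (unitv 0) v"
    let ?u = "case_sum (\<lambda>k. lookup m' (Inl k)) (\<lambda>_. 0)"
    have s: "bicong J (?L j) (?R j)" for j by (rule bicong_scale[OF J bin])
    have "bicong J (\<lambda>v. ((?L 0 v + ?L 1 v) + ?L 2 v) + ?u v) (\<lambda>v. ((?R 0 v + ?R 1 v) + ?R 2 v) + ?u v)"
      by (intro bicong_add[OF J] s bicong_refl[OF J])
    moreover have "(\<lambda>v. ((?L 0 v + ?L 1 v) + ?L 2 v) + ?u v) = (\<lambda>v. lookup m' v + c v)"
    proof
      fix v show "((?L 0 v + ?L 1 v) + ?L 2 v) + ?u v = lookup m' v + c v"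
      proof (cases v)
        case (Inl k)
        then show ?thesis using W[symmetric] by (simp add: c_def W_def sum3 distrib_right)
      next
        case (Inr k)
        have "k = 0 \<or> k = 1 \<or> k = 2" using UNIV3 by auto
        then show ?thesis using Inr by (auto simp: c_def unitv_def)
      qed
    qed
    moreover have "(\<lambda>v. ((?R 0 v + ?R 1 v) + ?R 2 v) + ?u v) = R m'"
    proof
      fix v show "((?R 0 v + ?R 1 v) + ?R 2 v) + ?u v = R m' v"
        by (cases v) (simp_all add: R_def W_def sum3 distrib_right)
    qed
    ultimately show ?thesis by simp
  qed
  have "bicong J (\<lambda>v. lookup m v + c v) (\<lambda>v. lookup n v + c v)"
    using bicong_trans[OF J key[OF refl] bicong_sym[OF J key[OF Wn[symmetric], folded Rn]]] .
  then have "single (monf c) 1 * (single m 1 - single n 1) \<in> J"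
    by (simp add: bicong_def monf_add mult_single right_diff_distrib add.commute)
  then show "single m 1 - single n 1 \<in> J" by (rule cancel)
qed simp

text \<open>The last condition says that the differences of the rows form a basis of the vectors of coordinate
  sum zero, in the coordinates with indices 1 and 2.\<close>

locale cremona_matrix =
  fixes a :: "3 \<Rightarrow> 3 \<Rightarrow> nat" and d :: nat
  assumes rows: "(\<Sum>k\<in>UNIV. a j k) = d"
    and cols: "\<exists>j. a j k = 0"
    and unimodular: "\<bar>(int (a 1 1) - int (a 0 1)) * (int (a 2 2) - int (a 0 2)) -
      (int (a 1 2) - int (a 0 2)) * (int (a 2 1) - int (a 0 1))\<bar> = 1"
begin

lemma rows3: "a j 0 + a j 1 + a j 2 = d"
  using rows[of j] by (simp add: sum3)

lemma graded_gam: "graded_exp {} (gam_exp a)"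
  unfolding graded_exp_def
proof (intro allI impI)
  fix m n assume eq: "texp (gam_exp a) m = texp (gam_exp a) n"
  have W: "(\<Sum>j\<in>UNIV. lookup m (Inr j)) = (\<Sum>j\<in>UNIV. lookup n (Inr j))" using eq by (simp add: texp_gam_iff)
  have tot: "(\<Sum>k\<in>UNIV. lookup m (Inl k) + (\<Sum>j\<in>UNIV. lookup m (Inr j) * a j k)) =
      (\<Sum>k\<in>UNIV. lookup m (Inl k)) + (\<Sum>j\<in>UNIV. lookup m (Inr j)) * d" for m
  proof -
    have "(\<Sum>k\<in>UNIV. \<Sum>j\<in>UNIV. lookup m (Inr j) * a j k) = (\<Sum>j\<in>UNIV. \<Sum>k\<in>UNIV. lookup m (Inr j) * a j k)"
      by (rule sum.swap)
    also have "\<dots> = (\<Sum>j\<in>UNIV. lookup m (Inr j)) * d"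
      by (simp add: rows sum_distrib_right flip: sum_distrib_left)
    finally show ?thesis by (simp add: sum.distrib)
  qed
  have "(\<Sum>k\<in>UNIV. lookup m (Inl k) + (\<Sum>j\<in>UNIV. lookup m (Inr j) * a j k)) =
      (\<Sum>k\<in>UNIV. lookup n (Inl k) + (\<Sum>j\<in>UNIV. lookup n (Inr j) * a j k))"
    using eq by (simp add: texp_gam_iff)
  then show "bideg m = bideg n" unfolding tot using W by (simp add: bideg_def)
qed

lemma subvariety_graph: "subvariety (graph_ideal a)"
  unfolding graph_ideal_def using subvariety_tker[OF graded_gam, of 0 0] by simp

lemma Var_notin_graph: "Var v \<notin> graph_ideal a"
  by (simp add: graph_ideal_def Var_in_tker)

lemma monomial_notin_graph: "single m 1 \<notin> graph_ideal a"
  by (simp add: graph_ideal_def monomial_in_tker)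

lemma graph_binomial_in_graph: "graph_binomial a j \<in> graph_ideal a"
proof -
  have "texp (gam_exp a) (monf (lbin a j)) = texp (gam_exp a) (monf (rbin a j))"
    unfolding texp_gam_iff by (simp add: lbin_def rbin_def sum_unitv_left sum_unitv_one) linarith
  then show ?thesis unfolding graph_binomial_def graph_ideal_def by (simp add: binomial_in_tker)
qed


lemma row_differs:
  assumes "j \<noteq> 0"
  obtains k where "a 0 k < a j k"
proof -
  have "\<exists>k. a 0 k < a j k"
  proof (rule ccontr)
    assume "\<nexists>k. a 0 k < a j k"
    then have "a j k \<le> a 0 k" for k by (simp add: not_less)
    from this[of 0] this[of 1] this[of 2] have "a j 0 = a 0 0" "a j 1 = a 0 1" "a j 2 = a 0 2"
      using rows3[of j] rows3[of 0] by linarith+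
    moreover have "j = 1 \<or> j = 2" using assms UNIV3 by auto
    ultimately show False using unimodular by auto
  qed
  then show ?thesis using that by blast
qed

text \<open>A constant column would make the differences of the rows linearly dependent.\<close>

lemma column_varies: "\<exists>j\<in>{1, 2}. a j k \<noteq> a 0 k"
proof (rule ccontr)
  assume "\<not> ?thesis"
  then have c: "a 1 k = a 0 k" "a 2 k = a 0 k" by auto
  have k: "k = 0 \<or> k = 1 \<or> k = 2" using UNIV3 by auto
  let ?r = "\<lambda>j k. int (a j k) - int (a 0 k)"
  have "?r 1 0 + ?r 1 1 + ?r 1 2 = 0" "?r 2 0 + ?r 2 1 + ?r 2 2 = 0"
    using rows3[of 1] rows3[of 2] rows3[of 0] by linarith+
  then have r: "?r 1 2 = - ?r 1 1 - ?r 1 0" "?r 2 2 = - ?r 2 1 - ?r 2 0" by linarith+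
  have "?r 1 1 * ?r 2 2 - ?r 1 2 * ?r 2 1 = 0"
    using k
  proof (elim disjE)
    assume "k = 0"
    then show ?thesis unfolding r using c by (simp add: algebra_simps)
  qed (use c in simp_all)
  then show False using unimodular by simp
qed

lemma sum_excess: "(\<Sum>k\<in>UNIV. a j k - a 0 k) = (\<Sum>k\<in>UNIV. a 0 k - a j k)"
  using rows3[of j] rows3[of 0] by (simp add: sum3)

lemma bideg_monf: "bideg (monf f) = (\<Sum>k\<in>UNIV. f (Inl k), \<Sum>k\<in>UNIV. f (Inr k))"
  by (simp add: bideg_def)

lemma bihomog_graph_binomial: "bihomog (\<Sum>k\<in>UNIV. a j k - a 0 k) 1 (graph_binomial a j)"
  unfolding graph_binomial_def
  by (intro bihomog_diff bihomog_single) (simp_all add: bideg_monf lbin_def rbin_def sum_unitv_one sum_excess)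

definition hyp :: "'k::field bipoly set" where
  "hyp = tker {} (hyp_exp (\<lambda>k. a 1 k - a 0 k) (\<lambda>k. a 0 k - a 1 k))"

lemma graded_hyp: "graded_exp {} (hyp_exp (\<lambda>k. a 1 k - a 0 k) (\<lambda>k. a 0 k - a 1 k))"
  unfolding graded_exp_def
proof (intro allI impI)
  let ?p = "\<lambda>k. a 1 k - a 0 k" and ?q = "\<lambda>k. a 0 k - a 1 k"
  fix m n assume eq: "texp (hyp_exp ?p ?q) m = texp (hyp_exp ?p ?q) n"
  have y: "lookup m (Inr 0) + lookup m (Inr 1) = lookup n (Inr 0) + lookup n (Inr 1)"
    "lookup m (Inr 2) = lookup n (Inr 2)" using eq unfolding texp_hyp_iff by blast+
  have tot: "(\<Sum>k\<in>UNIV. lookup m (Inl k) + lookup m (Inr 0) * ?q k + lookup m (Inr 1) * ?p k) =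
      (\<Sum>k\<in>UNIV. lookup m (Inl k)) + (lookup m (Inr 0) + lookup m (Inr 1)) * (\<Sum>k\<in>UNIV. ?q k)" for m
    by (simp only: sum.distrib sum_distrib_left[symmetric] sum_excess distrib_right add.assoc)
  have "(\<Sum>k\<in>UNIV. lookup m (Inl k) + lookup m (Inr 0) * ?q k + lookup m (Inr 1) * ?p k) =
      (\<Sum>k\<in>UNIV. lookup n (Inl k) + lookup n (Inr 0) * ?q k + lookup n (Inr 1) * ?p k)"
    using eq unfolding texp_hyp_iff by (intro sum.cong) auto
  then have "(\<Sum>k\<in>UNIV. lookup m (Inl k)) = (\<Sum>k\<in>UNIV. lookup n (Inl k))" unfolding tot y by simp
  then show "bideg m = bideg n" using y by (simp add: bideg_def sum3)
qed

lemma subvariety_hyp: "subvariety hyp"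
  unfolding hyp_def using subvariety_tker[OF graded_hyp, of 0 0] by simp

text \<open>Restoring the common factor of the first two monomials turns the parametrization of the threefold
  into that of the graph.\<close>

lemma hyp_subset_graph: "hyp \<subseteq> graph_ideal a"
  unfolding hyp_def
proof (rule tker_least)
  let ?p = "\<lambda>k. a 1 k - a 0 k" and ?q = "\<lambda>k. a 0 k - a 1 k"
  show "is_ideal (graph_ideal a)" unfolding graph_ideal_def by (rule is_ideal_tker)
  fix m n assume eq: "texp (hyp_exp ?p ?q) m = texp (hyp_exp ?p ?q) n"
  have y: "lookup m (Inr 0) + lookup m (Inr 1) = lookup n (Inr 0) + lookup n (Inr 1)"
    "lookup m (Inr 2) = lookup n (Inr 2)" using eq unfolding texp_hyp_iff by blast+
  have x: "lookup m (Inl k) + (\<Sum>j\<in>UNIV. lookup m (Inr j) * a j k) =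
      (lookup m (Inl k) + lookup m (Inr 0) * ?q k + lookup m (Inr 1) * ?p k) +
      (lookup m (Inr 0) + lookup m (Inr 1)) * min (a 0 k) (a 1 k) + lookup m (Inr 2) * a 2 k" for m k
  proof -
    have "a 0 k = ?q k + min (a 0 k) (a 1 k)" "a 1 k = ?p k + min (a 0 k) (a 1 k)" by simp_all
    then have "lookup m (Inr 0) * a 0 k + lookup m (Inr 1) * a 1 k =
      lookup m (Inr 0) * (?q k + min (a 0 k) (a 1 k)) + lookup m (Inr 1) * (?p k + min (a 0 k) (a 1 k))" by simp
    then show ?thesis by (simp add: sum3 distrib_left distrib_right)
  qed
  have "lookup m (Inl k) + lookup m (Inr 0) * ?q k + lookup m (Inr 1) * ?p k =
      lookup n (Inl k) + lookup n (Inr 0) * ?q k + lookup n (Inr 1) * ?p k" for k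
    using eq unfolding texp_hyp_iff by blast
  then have "lookup m (Inl k) + (\<Sum>j\<in>UNIV. lookup m (Inr j) * a j k) =
      lookup n (Inl k) + (\<Sum>j\<in>UNIV. lookup n (Inr j) * a j k)" for k
    unfolding x y by simp
  then have "texp (gam_exp a) m = texp (gam_exp a) n"
    unfolding texp_gam_iff using y by (simp add: sum3)
  then show "single m 1 - single n 1 \<in> graph_ideal a"
    by (simp add: graph_ideal_def binomial_in_tker)
qed simp

lemma binomial_1_in_hyp: "graph_binomial a 1 \<in> hyp"
  unfolding graph_binomial_def hyp_def
  by (simp add: binomial_in_tker texp_hyp_iff lbin_def rbin_def unitv_def)

lemma binomial_2_notin_hyp: "graph_binomial a 2 \<notin> hyp"
  unfolding graph_binomial_def hyp_def
  by (simp add: binomial_in_tker texp_hyp_iff lbin_def rbin_def unitv_def)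

lemma monomial_notin_hyp: "single m 1 \<notin> hyp"
  by (simp add: hyp_def monomial_in_tker)

lemma graph_binomial_nonzero: "graph_binomial a 1 \<noteq> 0"
proof
  assume 0: "graph_binomial a 1 = (0 :: 'b::field bipoly)"
  have "lookup (monf (lbin a 1)) (Inr 0) \<noteq> lookup (monf (rbin a 1)) (Inr 0)"
    by (simp add: lbin_def rbin_def unitv_def)
  then have "monf (lbin a 1) \<noteq> monf (rbin a 1)" by metis
  then have "lookup (graph_binomial a 1 :: 'b bipoly) (monf (lbin a 1)) = 1"
    by (simp add: graph_binomial_def lookup_minus lookup_single when_def)
  then show False by (simp add: 0)
qed

lemma dim_hyp_graph:
  fixes V \<Gamma> :: "'k::field bipoly set"
  defines "V \<equiv> hyp" and "\<Gamma> \<equiv> graph_ideal a"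
  shows "dimv V \<le> 3" "dimv \<Gamma> < dimv V"
proof -
  have "V \<noteq> {0}" using binomial_1_in_hyp graph_binomial_nonzero unfolding V_def by blast
  then show "dimv V \<le> 3" using dimv_less_4[of V] subvariety_hyp unfolding V_def by fastforce
  have "V \<subset> \<Gamma>" unfolding V_def \<Gamma>_def
    using hyp_subset_graph graph_binomial_in_graph[of 2] binomial_2_notin_hyp by blast
  then show "dimv \<Gamma> < dimv V"
    unfolding V_def \<Gamma>_def by (rule dimv_less[OF subvariety_hyp subvariety_graph])
qed

text \<open>The two monomials of each binomial have disjoint supports.  Hence a surface on which one of
  their variables vanishes is a coordinate surface.\<close>

lemma binomial_two_vars:
  assumes Z: "subvariety Z" "dimv Z = 2" and F: "graph_binomial a j \<in> Z"
    and v: "Var v \<in> Z" "lbin a j v > 0 \<or> rbin a j v > 0" and j: "j \<noteq> 0"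
  shows "\<exists>v w. v \<noteq> w \<and> Z = coord {v, w}"
proof -
  note gp = subvariety_gprime[OF Z(1)]
  have disj: "lbin a j v = 0 \<or> rbin a j v = 0" for v
    using j by (cases v) (auto simp: lbin_def rbin_def unitv_def)
  have "\<exists>w. w \<noteq> v \<and> Var w \<in> Z"
  proof (cases "lbin a j v > 0")
    case True
    then have "single (monf (lbin a j)) 1 \<in> Z" using v(1) monomial_in_prime[OF gp] by auto
    then have "single (monf (rbin a j)) 1 \<in> Z"
      using is_idealD(6)[OF gprimeD(2)[OF gp] _ F] by (fastforce simp: graph_binomial_def)
    then obtain w where "rbin a j w > 0" "Var w \<in> Z" using monomial_in_prime[OF gp] by auto
    then show ?thesis using True disj[of v] by (intro exI[of _ w]) auto
  next
    case False
    then have r: "rbin a j v > 0" using v(2) by simp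
    then have "single (monf (rbin a j)) 1 \<in> Z" using v(1) monomial_in_prime[OF gp] by auto
    then have "single (monf (lbin a j)) 1 \<in> Z"
      using is_idealD(2)[OF gprimeD(2)[OF gp] F] by (fastforce simp: graph_binomial_def)
    then obtain w where "lbin a j w > 0" "Var w \<in> Z" using monomial_in_prime[OF gp] by auto
    then show ?thesis using r disj[of v] by (intro exI[of _ w]) auto
  qed
  then obtain w where w: "w \<noteq> v" "Var w \<in> Z" by blast
  from eq_coord_surface[OF Z v(1) w(2) w(1)[symmetric]] w(1) show ?thesis by metis
qed

lemma surface_on_binomials:
  fixes Z :: "'k::field bipoly set"
  assumes Z: "subvariety Z" "dimv Z = 2" and F: "graph_binomial a 1 \<in> Z" "graph_binomial a 2 \<in> Z"
    and \<Gamma>: "dimv (graph_ideal a :: 'k bipoly set) = 2"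
  shows "Z = graph_ideal a \<or> (\<exists>v w. v \<noteq> w \<and> Z = coord {v, w})"
proof (cases "\<exists>v. Var v \<in> Z")
  case False
  note gp = subvariety_gprime[OF Z(1)]
  have "single m 1 * x \<in> Z \<Longrightarrow> x \<in> Z" for m x
    using False monomial_in_prime[OF gp, of m] gprimeD(4)[OF gp] by blast
  then have "graph_ideal a \<subseteq> Z" by (rule graph_ideal_least[OF gprimeD(2)[OF gp] F])
  then show ?thesis using dimv_eq_imp_eq[OF subvariety_graph Z(1)] Z(2) \<Gamma> by simp
next
  case True
  then obtain v where v: "Var v \<in> Z" by blast
  have "\<exists>j\<in>{1, 2}. lbin a j v > 0 \<or> rbin a j v > 0"
  proof (cases v)
    case (Inl k)
    obtain j where "j \<in> {1, 2}" "a j k \<noteq> a 0 k" using column_varies by blast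
    then show ?thesis using Inl by (auto simp: lbin_def rbin_def intro!: bexI[of _ j])
  next
    case (Inr k)
    have "k = 0 \<or> k = 1 \<or> k = 2" using UNIV3 by auto
    then show ?thesis using Inr by (auto simp: lbin_def rbin_def unitv_def)
  qed
  then show ?thesis using binomial_two_vars[OF Z _ v] F distinct3 by blast
qed

text \<open>On the threefold \<open>hyp\<close> the divisor of the second binomial is the graph plus coordinate
  surfaces, while that of a monomial whose variables all divide the first monomial of the equation of
  \<open>hyp\<close> consists of coordinate surfaces only.\<close>

lemma graph_in_std_span:
  assumes dim: "dimv (graph_ideal a :: 'k::field bipoly set) = 2"
  shows "frag_of (graph_ideal a :: 'k bipoly set) \<in> std_span"
proof -
  let ?V = "hyp :: 'k bipoly set" and ?\<Gamma> = "graph_ideal a :: 'k bipoly set"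
  have "dimv ?V = 3" using dim_hyp_graph[where 'k = 'k] dim by linarith
  note V = subvariety_hyp this
  obtain l where l: "a 0 l < a 1 l" using row_differs[of 1] by auto
  define N where "N = (\<Sum>k\<in>UNIV. a 2 k - a 0 k)"
  define gm where "gm = monf (case_sum (\<lambda>k. N * unitv l k) (unitv 0))"
  let ?f = "graph_binomial a 2 :: 'k bipoly" and ?g = "single gm 1 :: 'k bipoly"
  have f: "bihomog N 1 ?f" "?f \<notin> ?V" using bihomog_graph_binomial[of 2] binomial_2_notin_hyp by (simp_all add: N_def)
  have "(\<Sum>k\<in>UNIV. N * unitv l k) = N" by (simp add: sum_unitv_one flip: sum_distrib_left)
  then have g: "bihomog N 1 ?g" "?g \<notin> ?V"
    using monomial_notin_hyp by (auto intro!: bihomog_single simp: gm_def bideg_monf sum_unitv_one)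
  define K :: "'k bipoly set set" where "K = {coord {v, w} |v w. v \<noteq> w}"
  have "K \<subseteq> (\<lambda>(v, w). coord {v, w}) ` UNIV" by (auto simp: K_def)
  then have finK: "finite K" by (rule finite_subset) simp
  have K: "subvariety Z \<and> dimv Z = 2" if "Z \<in> K" for Z using that coord_surface by (auto simp: K_def)
  have "?\<Gamma> \<notin> K"
  proof
    assume "?\<Gamma> \<in> K"
    then obtain v w where "?\<Gamma> = coord {v, w}" by (auto simp: K_def)
    then show False using Var_notin_graph[of v] Var_in_coord[of v "{v, w}"] by auto
  qed
  define e where "e Z = ord_along ?V Z ?f - ord_along ?V Z ?g" for Z
  have F1: "graph_binomial a 1 \<in> Z" if "?V \<subseteq> Z" for Z using that binomial_1_in_hyp by blast
  have out: "e Z = 0" if Z: "subvariety Z" "dimv Z = 2" "Z \<notin> insert ?\<Gamma> K" for Z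
  proof -
    have "1 \<in> J" if J: "J \<in> local_ideals Z" "?V \<subseteq> J" "h \<in> J" and h: "h = ?f \<or> h = ?g" for J h
    proof (rule ccontr)
      assume 1: "1 \<notin> J"
      then have JZ: "J \<subseteq> Z" using local_maximal[OF J(1) gprimeD(2)[OF subvariety_gprime[OF Z(1)]]] by blast
      then have F: "graph_binomial a 1 \<in> Z" "h \<in> Z" using F1[OF J(2)] J(3) by blast+
      have "Z \<in> insert ?\<Gamma> K"
      proof (cases "h = ?f")
        case True
        then show ?thesis using surface_on_binomials[OF Z(1,2) F(1) _ dim] F(2) by (auto simp: K_def)
      next
        case False
        then have "?g \<in> Z" using h F(2) by simp
        then obtain v where v: "lookup gm v > 0" "Var v \<in> Z"
          using monomial_in_prime[OF subvariety_gprime[OF Z(1)]] by blast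
        have "lbin a 1 v > 0"
          using v(1) l by (cases v) (auto simp: gm_def lbin_def unitv_def split: if_splits)
        then show ?thesis using binomial_two_vars[OF Z(1,2) F(1) v(2)] by (auto simp: K_def)
      qed
      then show False using Z(3) by simp
    qed
    then have "ord_along ?V Z ?f = 0" "ord_along ?V Z ?g = 0" by (intro ord_along_eq_0; blast)+
    then show ?thesis by (simp add: e_def)
  qed
  have e\<Gamma>: "e ?\<Gamma> = 1"
  proof -
    have "ord_along ?V ?\<Gamma> ?f = 1"
    proof (rule ord_along_eq_1[OF subvariety_gprime[OF subvariety_graph] hyp_subset_graph graph_binomial_in_graph])
      fix J assume J: "J \<in> local_ideals ?\<Gamma>" "?V \<subseteq> J" "?f \<in> J"
      have "x \<in> J" if "single m 1 * x \<in> J" for m x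
        using local_idealsD(3)[OF J(1) _ monomial_notin_graph that] bihomog_single[of m "fst (bideg m)" "snd (bideg m)" 1]
        by simp
      then show "?\<Gamma> \<subseteq> J" by (rule graph_ideal_least[OF local_idealsD(2)[OF J(1)] F1[OF J(2)] J(3)])
    qed
    moreover have "ord_along ?V ?\<Gamma> ?g = 0"
      using local_unit[OF _ g(1) _ monomial_notin_graph] by (intro ord_along_eq_0) blast
    ultimately show ?thesis by (simp add: e_def)
  qed
  define \<alpha> where "\<alpha> = (\<Sum>Z\<in>insert ?\<Gamma> K. frag_cmul (e Z) (frag_of Z))"
  have look: "lookup \<alpha> Z = (if Z \<in> insert ?\<Gamma> K then e Z else 0)" for Z
  proof -
    have "lookup \<alpha> Z = (\<Sum>Y\<in>insert ?\<Gamma> K. if Y = Z then e Y else 0)"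
      unfolding \<alpha>_def lookup_sum by (intro sum.cong) (auto simp: lookup_single when_def)
    then show ?thesis using finK by simp
  qed
  have "\<alpha> \<in> rat_triv"
  proof (rule principal_rat_triv[OF _ V f g])
    show "subvariety Z \<and> dimv Z = 2" if "Z \<in> keys \<alpha>" for Z
    proof -
      have "Z \<in> insert ?\<Gamma> K" using that look[of Z] by (auto simp: in_keys_iff split: if_splits)
      then show ?thesis using K subvariety_graph dim by blast
    qed
    show "lookup \<alpha> Z = ord_along ?V Z ?f - ord_along ?V Z ?g" if "subvariety Z" "dimv Z = 2" for Z
      using look[of Z] out[OF that] by (simp add: e_def split: if_splits)
  qed
  moreover have "\<alpha> = frag_of ?\<Gamma> + (\<Sum>Z\<in>K. frag_cmul (e Z) (frag_of Z))"
    unfolding \<alpha>_def using finK \<open>?\<Gamma> \<notin> K\<close> e\<Gamma> by simp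
  ultimately have "frag_of ?\<Gamma> - frag_cmul (- 1) (\<Sum>Z\<in>K. frag_cmul (e Z) (frag_of Z)) \<in> rat_triv"
    by simp
  moreover have "frag_cmul (- 1) (\<Sum>Z\<in>K. frag_cmul (e Z) (frag_of Z)) \<in> std_span"
    using coord_in_std_span by (intro std_span_cmul std_span_sum) (auto simp: K_def)
  ultimately show ?thesis by (rule std_span_equiv)
qed

end

section \<open>The Hilbert function of the graph\<close>

definition triples :: "nat \<Rightarrow> (3 \<Rightarrow> nat) set" where
  "triples n = {g. (\<Sum>k\<in>UNIV. g k) = n}"

lemma triples_iff: "g \<in> triples n \<longleftrightarrow> g 0 + g 1 + g 2 = n"
  by (simp add: triples_def sum3)

lemma fun3_eqI: "f 0 = g 0 \<Longrightarrow> f 1 = g 1 \<Longrightarrow> f 2 = g 2 \<Longrightarrow> f = (g :: 3 \<Rightarrow> 'a)"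
proof
  fix k :: 3 assume "f 0 = g 0" "f 1 = g 1" "f 2 = g 2"
  moreover have "k = 0 \<or> k = 1 \<or> k = 2" using UNIV3 by auto
  ultimately show "f k = g k" by auto
qed

definition triple :: "'a \<Rightarrow> 'a \<Rightarrow> 'a \<Rightarrow> 3 \<Rightarrow> 'a" where
  "triple x y z k = (if k = 0 then x else if k = 1 then y else z)"

lemma triple_simps [simp]: "triple x y z 0 = x" "triple x y z 1 = y" "triple x y z 2 = z"
  by (simp_all add: triple_def)

lemma triples_bij: "bij_betw (\<lambda>g. (g 0, g 1)) (triples n) (SIGMA x:{..n}. {..n - x})"
proof (rule bij_betwI[where g = "\<lambda>(x, y). triple x y (n - x - y)"])
  show "(\<lambda>g. (g 0, g 1)) \<in> triples n \<rightarrow> (SIGMA x:{..n}. {..n - x})" by (auto simp: triples_iff)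
  show "(\<lambda>(x, y). triple x y (n - x - y)) \<in> (SIGMA x:{..n}. {..n - x}) \<rightarrow> triples n" by (auto simp: triples_iff)
  show "(case (g 0, g 1) of (x, y) \<Rightarrow> triple x y (n - x - y)) = g" if "g \<in> triples n" for g
    using that by (auto simp: triples_iff intro!: fun3_eqI)
qed auto

lemma finite_triples: "finite (triples n)"
  using bij_betw_finite[OF triples_bij] by simp

lemma card_triples: "2 * card (triples n) = (n + 1) * (n + 2)"
proof -
  have "card (triples n) = card (SIGMA x:{..n}. {..n - x})" by (rule bij_betw_same_card[OF triples_bij])
  also have "\<dots> = (\<Sum>x\<le>n. Suc (n - x))" by (subst card_SigmaI) auto
  also have "\<dots> = (\<Sum>x\<le>n. Suc x)" 
    by (rule sum.reindex_bij_witness[of _ "\<lambda>x. n - x" "\<lambda>x. n - x"]) auto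
  finally have "card (triples n) = (\<Sum>x\<le>n. Suc x)" .
  moreover have "2 * (\<Sum>x\<le>n. Suc x) = (n + 1) * (n + 2)" by (induction n) auto
  ultimately show ?thesis by simp
qed

lemma card_image_cong:
  assumes "\<And>x y. x \<in> A \<Longrightarrow> y \<in> A \<Longrightarrow> f x = f y \<longleftrightarrow> g x = g y"
  shows "card (f ` A) = card (g ` A)"
proof -
  have "bij_betw (\<lambda>z. g (inv_into A f z)) (f ` A) (g ` A)"
  proof (rule bij_betw_imageI)
    have inv: "inv_into A f (f x) \<in> A \<and> f (inv_into A f (f x)) = f x" if "x \<in> A" for x
      using that by (simp add: inv_into_into f_inv_into_f)
    then have gi: "g (inv_into A f (f x)) = g x" if "x \<in> A" for x
      using assms that by blast
    show "inj_on (\<lambda>z. g (inv_into A f z)) (f ` A)"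
      using gi assms by (auto intro!: inj_onI)
    show "(\<lambda>z. g (inv_into A f z)) ` f ` A = g ` A"
      using gi by (auto simp: image_image)
  qed
  then show ?thesis by (rule bij_betw_same_card)
qed

lemma bideg_triples:
  "bideg m = (s, t) \<longleftrightarrow> (\<lambda>k. lookup m (Inl k)) \<in> triples s \<and> (\<lambda>k. lookup m (Inr k)) \<in> triples t"
  by (simp add: bideg_def triples_def)

lemma hilb_coord: "hilb (coord W) s t = card {m. bideg m = (s, t) \<and> avoids W m}"
proof -
  have "inj_on (texp id_exp) A" for A by (rule inj_onI) (simp add: texp_id_exp)
  then show ?thesis by (simp add: coord_eq_tker hilb_tker card_image)
qed

lemma hilb_std:
  shows "hilb (coordinate_subvariety {} {0, 1}) s t = card (triples s)"
    and "hilb (coordinate_subvariety {0, 1} {}) s t = card (triples t)"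
    and "hilb (coordinate_subvariety {0} {0}) s t = (s + 1) * (t + 1)"
proof -
  have "bij_betw (\<lambda>m k. lookup m (Inl k)) {m. bideg m = (s, t) \<and> avoids {Inr 0, Inr 1} m} (triples s)"
  proof (rule bij_betwI[where g = "\<lambda>u. monf (case_sum u (triple 0 0 t))"])
    show "monf (case_sum (\<lambda>k. lookup m (Inl k)) (triple 0 0 t)) = m"
      if "m \<in> {m. bideg m = (s, t) \<and> avoids {Inr 0, Inr 1} m}" for m
    proof (rule poly_mapping_eqI)
      fix v
      have "triple 0 0 t = (\<lambda>k. lookup m (Inr k))"
        using that by (intro fun3_eqI) (auto simp: bideg_triples triples_iff avoids_def)
      then show "lookup (monf (case_sum (\<lambda>k. lookup m (Inl k)) (triple 0 0 t))) v = lookup m v"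
        by (cases v) simp_all
    qed
  qed (auto simp: bideg_triples triples_iff avoids_def)
  then show "hilb (coordinate_subvariety {} {0, 1}) s t = card (triples s)"
    by (simp add: coordinate_subvariety_eq hilb_coord bij_betw_same_card)
  have "bij_betw (\<lambda>m k. lookup m (Inr k)) {m. bideg m = (s, t) \<and> avoids {Inl 0, Inl 1} m} (triples t)"
  proof (rule bij_betwI[where g = "\<lambda>u. monf (case_sum (triple 0 0 s) u)"])
    show "monf (case_sum (triple 0 0 s) (\<lambda>k. lookup m (Inr k))) = m"
      if "m \<in> {m. bideg m = (s, t) \<and> avoids {Inl 0, Inl 1} m}" for m
    proof (rule poly_mapping_eqI)
      fix v
      have "triple 0 0 s = (\<lambda>k. lookup m (Inl k))"
        using that by (intro fun3_eqI) (auto simp: bideg_triples triples_iff avoids_def)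
      then show "lookup (monf (case_sum (triple 0 0 s) (\<lambda>k. lookup m (Inr k)))) v = lookup m v"
        by (cases v) simp_all
    qed
  qed (auto simp: bideg_triples triples_iff avoids_def)
  then show "hilb (coordinate_subvariety {0, 1} {}) s t = card (triples t)"
    by (simp add: coordinate_subvariety_eq hilb_coord bij_betw_same_card)
  have "bij_betw (\<lambda>m. (lookup m (Inl 1), lookup m (Inr 1))) {m. bideg m = (s, t) \<and> avoids {Inl 0, Inr 0} m}
      ({..s} \<times> {..t})"
  proof (rule bij_betwI[where g = "\<lambda>(x, y). monf (case_sum (triple 0 x (s - x)) (triple 0 y (t - y)))"])
    show "(case (lookup m (Inl 1), lookup m (Inr 1)) of
        (x, y) \<Rightarrow> monf (case_sum (triple 0 x (s - x)) (triple 0 y (t - y)))) = m"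
      if "m \<in> {m. bideg m = (s, t) \<and> avoids {Inl 0, Inr 0} m}" for m
    proof -
      have "triple 0 (lookup m (Inl 1)) (s - lookup m (Inl 1)) = (\<lambda>k. lookup m (Inl k))"
        "triple 0 (lookup m (Inr 1)) (t - lookup m (Inr 1)) = (\<lambda>k. lookup m (Inr k))"
        using that by (auto intro!: fun3_eqI simp: bideg_triples triples_iff avoids_def)
      then have "lookup (monf (case_sum (triple 0 (lookup m (Inl 1)) (s - lookup m (Inl 1)))
          (triple 0 (lookup m (Inr 1)) (t - lookup m (Inr 1))))) v = lookup m v" for v
        by (cases v) simp_all
      then show ?thesis by (auto intro: poly_mapping_eqI)
    qed
  qed (auto simp: bideg_triples triples_iff avoids_def)
  then show "hilb (coordinate_subvariety {0} {0}) s t = (s + 1) * (t + 1)"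
    by (simp add: coordinate_subvariety_eq hilb_coord bij_betw_same_card card_cartesian_product insert_commute)
qed

context cremona_matrix
begin

definition pt :: "(3 \<Rightarrow> nat) \<Rightarrow> (3 \<Rightarrow> nat) \<Rightarrow> 3 \<Rightarrow> nat" where
  "pt u w k = u k + (\<Sum>j\<in>UNIV. w j * a j k)"

lemma hilb_graph: "hilb (graph_ideal a) s t = card ((\<lambda>(u, w). pt u w) ` (triples s \<times> triples t))"
proof -
  let ?M = "{m. bideg m = (s, t)}"
  let ?p = "\<lambda>m. pt (\<lambda>k. lookup m (Inl k)) (\<lambda>k. lookup m (Inr k))"
  have "hilb (graph_ideal a) s t = card (texp (gam_exp a) ` ?M)"
    unfolding graph_ideal_def by (simp add: hilb_tker)
  also have "\<dots> = card (?p ` ?M)"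
  proof (rule card_image_cong)
    fix m n assume "m \<in> ?M" "n \<in> ?M"
    then show "texp (gam_exp a) m = texp (gam_exp a) n \<longleftrightarrow> ?p m = ?p n"
      unfolding texp_gam_iff by (simp add: fun_eq_iff pt_def bideg_def)
  qed
  also have "?p ` ?M = (\<lambda>(u, w). pt u w) ` (triples s \<times> triples t)"
  proof
    show "?p ` ?M \<subseteq> (\<lambda>(u, w). pt u w) ` (triples s \<times> triples t)"
      by (force simp: bideg_triples)
    show "(\<lambda>(u, w). pt u w) ` (triples s \<times> triples t) \<subseteq> ?p ` ?M"
    proof
      fix g assume "g \<in> (\<lambda>(u, w). pt u w) ` (triples s \<times> triples t)"
      then obtain u w where uw: "u \<in> triples s" "w \<in> triples t" "g = pt u w" by auto
      let ?m = "monf (case_sum u w)"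
      have "?m \<in> ?M" "g = ?p ?m" using uw by (simp_all add: bideg_triples)
      then show "g \<in> ?p ` ?M" by blast
    qed
  qed
  finally show ?thesis .
qed

lemma pt_total: "u \<in> triples s \<Longrightarrow> w \<in> triples t \<Longrightarrow> pt u w \<in> triples (s + t * d)"
proof -
  assume u: "u \<in> triples s" and w: "w \<in> triples t"
  have "(\<Sum>k\<in>UNIV. \<Sum>j\<in>UNIV. w j * a j k) = (\<Sum>j\<in>UNIV. \<Sum>k\<in>UNIV. w j * a j k)" by (rule sum.swap)
  also have "\<dots> = (\<Sum>j\<in>UNIV. w j) * d" by (simp add: rows sum_distrib_right flip: sum_distrib_left)
  finally show ?thesis using u w by (simp add: triples_def pt_def sum.distrib)
qed

lemma hilb_graph_upper: "hilb (graph_ideal a) s t \<le> card (triples (s + t * d))"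
  unfolding hilb_graph using pt_total by (intro card_mono finite_triples) auto

lemma entry_le: "a j k \<le> d"
  using rows[of j] member_le_sum[of k UNIV "a j"] by simp

text \<open>A point of the large triangle is missed only if two of its coordinates are small, because
  every column of the matrix contains a zero.\<close>

lemma hilb_graph_lower: "card (triples (s + t * d)) \<le> hilb (graph_ideal a) s t + 3 * (t * d) ^ 2"
proof -
  let ?N = "s + t * d" and ?b = "t * d"
  let ?I = "(\<lambda>(u, w). pt u w) ` (triples s \<times> triples t)"
  let ?B = "\<lambda>i j. {g \<in> triples ?N. g i < ?b \<and> g j < ?b}"
  have B: "card (?B i j) \<le> ?b ^ 2" if ij: "(i, j) \<in> {(0, 1), (0, 2), (1, 2)}" for i j :: 3
  proof -
    have "card (?B i j) \<le> card ({..<?b} \<times> {..<?b})"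
    proof (rule card_inj_on_le)
      show "inj_on (\<lambda>g. (g i, g j)) (?B i j)"
        using ij by (intro inj_onI fun3_eqI) (auto simp: triples_iff)
    qed auto
    then show ?thesis by (simp add: card_cartesian_product power2_eq_square)
  qed
  have "triples ?N \<subseteq> ?I \<union> (?B 0 1 \<union> ?B 0 2 \<union> ?B 1 2)"
  proof
    fix g assume g: "g \<in> triples ?N"
    show "g \<in> ?I \<union> (?B 0 1 \<union> ?B 0 2 \<union> ?B 1 2)"
    proof (cases "\<exists>l. \<forall>k. k \<noteq> l \<longrightarrow> g k \<ge> ?b")
      case True
      then obtain l where l: "\<And>k. k \<noteq> l \<Longrightarrow> g k \<ge> ?b" by blast
      obtain j where j: "a j l = 0" using cols by blast
      have le: "t * a j k \<le> g k" for k
      proof (cases "k = l")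
        case False
        then show ?thesis using l[OF False] mult_le_mono2[OF entry_le, of t j k] by linarith
      qed (simp add: j)
      define u where "u k = g k - t * a j k" for k
      have "pt u (\<lambda>i. t * unitv j i) = g"
      proof
        fix k
        have "(\<Sum>i\<in>UNIV. t * unitv j i * a i k) = t * a j k"
          by (simp add: mult.assoc sum_unitv_left flip: sum_distrib_left)
        then show "pt u (\<lambda>i. t * unitv j i) k = g k" using le[of k] by (simp add: pt_def u_def)
      qed
      moreover have "(\<lambda>i. t * unitv j i) \<in> triples t"
        by (simp add: triples_def sum_unitv_one flip: sum_distrib_left)
      moreover have "u \<in> triples s"
      proof -
        have "(\<Sum>k\<in>UNIV. u k) + (\<Sum>k\<in>UNIV. t * a j k) = (\<Sum>k\<in>UNIV. g k)"
          unfolding sum.distrib[symmetric] u_def using le by (intro sum.cong) auto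
        moreover have "(\<Sum>k\<in>UNIV. t * a j k) = t * d" by (simp add: rows flip: sum_distrib_left)
        ultimately show ?thesis using g by (simp add: triples_def)
      qed
      ultimately have "g \<in> ?I" by (force intro: rev_image_eqI[of "(u, \<lambda>i. t * unitv j i)"])
      then show ?thesis by blast
    next
      case False
      then have "\<not> (\<forall>k. k \<noteq> l \<longrightarrow> g k \<ge> ?b)" for l by blast
      from this[of 0] this[of 1] this[of 2] show ?thesis
        using g unfolding all3 by (auto simp: not_le)
    qed
  qed
  then have "card (triples ?N) \<le> card (?I \<union> (?B 0 1 \<union> ?B 0 2 \<union> ?B 1 2))"
    by (intro card_mono) (auto simp: finite_triples)
  also have "\<dots> \<le> card ?I + (card (?B 0 1) + card (?B 0 2) + card (?B 1 2))"
    by (meson add_left_mono add_right_mono card_Un_le order_trans)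
  also have "\<dots> \<le> card ?I + 3 * ?b ^ 2" using B[of 0 1] B[of 0 2] B[of 1 2] by simp
  finally show ?thesis unfolding hilb_graph .
qed

lemma lattice_injective:
  fixes w :: "3 \<Rightarrow> int"
  assumes "w 0 + w 1 + w 2 = 0" "\<And>k. w 0 * a 0 k + w 1 * a 1 k + w 2 * a 2 k = 0"
  shows "w k = 0"
proof -
  let ?r = "\<lambda>j k. int (a j k) - int (a 0 k)"
  have w0: "w 0 = - w 1 - w 2" using assms(1) by linarith
  have e: "w 1 * ?r 1 k + w 2 * ?r 2 k = 0" for k
    using assms(2)[of k] by (simp add: w0 algebra_simps)
  let ?D = "?r 1 1 * ?r 2 2 - ?r 1 2 * ?r 2 1"
  have "w 1 * ?D = (w 1 * ?r 1 1 + w 2 * ?r 2 1) * ?r 2 2 - (w 1 * ?r 1 2 + w 2 * ?r 2 2) * ?r 2 1"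
    "w 2 * ?D = (w 1 * ?r 1 2 + w 2 * ?r 2 2) * ?r 1 1 - (w 1 * ?r 1 1 + w 2 * ?r 2 1) * ?r 1 2"
    by (simp_all add: algebra_simps)
  then have "w 1 * ?D = 0" "w 2 * ?D = 0" unfolding e by simp_all
  moreover have "?D \<noteq> 0" using unimodular by auto
  ultimately have "w 1 = 0" "w 2 = 0" by simp_all
  moreover have "k = 0 \<or> k = 1 \<or> k = 2" using UNIV3 by auto
  ultimately show ?thesis using w0 by auto
qed

lemma lattice_surjective:
  fixes u :: "3 \<Rightarrow> int"
  assumes "u 0 + u 1 + u 2 = 0"
  obtains w :: "3 \<Rightarrow> int" where "w 0 + w 1 + w 2 = 0" "\<And>k. w 0 * a 0 k + w 1 * a 1 k + w 2 * a 2 k = u k"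
proof -
  let ?r = "\<lambda>j k. int (a j k) - int (a 0 k)"
  let ?D = "?r 1 1 * ?r 2 2 - ?r 1 2 * ?r 2 1"
  have D: "?D * ?D = 1" using unimodular by (metis abs_mult_self_eq mult_1)
  define w1 where "w1 = ?D * (u 1 * ?r 2 2 - u 2 * ?r 2 1)"
  define w2 where "w2 = ?D * (u 2 * ?r 1 1 - u 1 * ?r 1 2)"
  have "w1 * ?r 1 1 + w2 * ?r 2 1 = (?D * ?D) * u 1" "w1 * ?r 1 2 + w2 * ?r 2 2 = (?D * ?D) * u 2"
    unfolding w1_def w2_def by (simp_all only: algebra_simps)
  then have e: "w1 * ?r 1 1 + w2 * ?r 2 1 = u 1" "w1 * ?r 1 2 + w2 * ?r 2 2 = u 2" unfolding D by simp_all
  have r0: "?r j 0 = - ?r j 1 - ?r j 2" for j using rows3[of j] rows3[of 0] by linarith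
  have "w1 * ?r 1 0 + w2 * ?r 2 0 = - (w1 * ?r 1 1 + w2 * ?r 2 1) - (w1 * ?r 1 2 + w2 * ?r 2 2)"
    unfolding r0 by (simp add: algebra_simps)
  then have e0: "w1 * ?r 1 0 + w2 * ?r 2 0 = u 0" unfolding e using assms by simp
  have all: "w1 * ?r 1 k + w2 * ?r 2 k = u k" for k
  proof -
    have "k = 0 \<or> k = 1 \<or> k = 2" using UNIV3 by auto
    then show ?thesis using e e0 by auto
  qed
  show ?thesis
    by (rule that[of "triple (- w1 - w2) w1 w2"]) (simp_all add: all[symmetric] algebra_simps)
qed

lemma lattice_preimages:
  "\<exists>(\<zeta> :: 3 \<Rightarrow> 3 \<Rightarrow> int) K. (\<forall>i. \<zeta> i 0 + \<zeta> i 1 + \<zeta> i 2 = 0) \<and>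
    (\<forall>i k. \<zeta> i 0 * a 0 k + \<zeta> i 1 * a 1 k + \<zeta> i 2 * a 2 k = int (unitv i k) - int (unitv 0 k)) \<and>
    (\<forall>i j. \<bar>\<zeta> i j\<bar> \<le> int K)"
proof -
  have "\<exists>z :: 3 \<Rightarrow> int. z 0 + z 1 + z 2 = 0 \<and>
      (\<forall>k. z 0 * a 0 k + z 1 * a 1 k + z 2 * a 2 k = int (unitv i k) - int (unitv 0 k))" for i
  proof -
    have "i = 0 \<or> i = 1 \<or> i = 2" using UNIV3 by auto
    then have "(int (unitv i 0) - int (unitv 0 0)) + (int (unitv i 1) - int (unitv 0 1)) + (int (unitv i 2) - int (unitv 0 2)) = 0"
      by (auto simp: unitv_def)
    from lattice_surjective[of "\<lambda>k. int (unitv i k) - int (unitv 0 k)", OF this] show ?thesis by blast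
  qed
  then obtain \<zeta> :: "3 \<Rightarrow> 3 \<Rightarrow> int" where \<zeta>: "\<And>i. \<zeta> i 0 + \<zeta> i 1 + \<zeta> i 2 = 0"
    "\<And>i k. \<zeta> i 0 * a 0 k + \<zeta> i 1 * a 1 k + \<zeta> i 2 * a 2 k = int (unitv i k) - int (unitv 0 k)" by metis
  define K where "K = (\<Sum>i\<in>UNIV. \<Sum>j\<in>UNIV. nat \<bar>\<zeta> i j\<bar>)"
  have "\<bar>\<zeta> i j\<bar> \<le> int K" for i j
  proof -
    have "nat \<bar>\<zeta> i j\<bar> \<le> (\<Sum>j\<in>UNIV. nat \<bar>\<zeta> i j\<bar>)" by (rule member_le_sum) auto
    also have "\<dots> \<le> K" unfolding K_def by (rule member_le_sum) auto
    finally show ?thesis by linarith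
  qed
  then show ?thesis using \<zeta> by blast
qed

text \<open>Fixing the first summand, the points are distinct because the matrix is injective on vectors of equal
  coordinate sum.\<close>

lemma hilb_graph_lower': "card (triples t) \<le> hilb (graph_ideal a) s t"
proof -
  let ?u = "triple s 0 0"
  have "inj_on (pt ?u) (triples t)"
  proof (rule inj_onI)
    fix w v assume wv: "w \<in> triples t" "v \<in> triples t" "pt ?u w = pt ?u v"
    let ?z = "\<lambda>j. int (w j) - int (v j)"
    have "?z k = 0" for k
    proof (rule lattice_injective)
      show "?z 0 + ?z 1 + ?z 2 = 0" using wv(1,2) unfolding triples_iff by linarith
      fix k
      have "(\<Sum>j\<in>UNIV. w j * a j k) = (\<Sum>j\<in>UNIV. v j * a j k)" using fun_cong[OF wv(3), of k] by (simp add: pt_def)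
      then have "int (w 0 * a 0 k + w 1 * a 1 k + w 2 * a 2 k) = int (v 0 * a 0 k + v 1 * a 1 k + v 2 * a 2 k)"
        by (simp add: sum3)
      then show "?z 0 * a 0 k + ?z 1 * a 1 k + ?z 2 * a 2 k = 0" by (simp add: algebra_simps)
    qed
    then show "w = v" by auto
  qed
  moreover have "?u \<in> triples s" by (simp add: triples_iff)
  then have "pt ?u ` triples t \<subseteq> (\<lambda>(u, w). pt u w) ` (triples s \<times> triples t)" by force
  ultimately show ?thesis
    unfolding hilb_graph by (metis card_image card_mono finite_SigmaI finite_imageI finite_triples)
qed

text \<open>Because the matrix acts invertibly on the vectors of coordinate sum zero, the part of a point
  coming from the first factor can be moved to the second one.\<close>

lemma hilb_graph_upper': "\<exists>K. \<forall>s t. hilb (graph_ideal a) s t \<le> card (triples (t + 3 * K * s))"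
proof -
  from lattice_preimages obtain \<zeta> :: "3 \<Rightarrow> 3 \<Rightarrow> int" and K :: nat
    where *: "\<forall>i. \<zeta> i 0 + \<zeta> i 1 + \<zeta> i 2 = 0"
      "\<forall>i k. \<zeta> i 0 * a 0 k + \<zeta> i 1 * a 1 k + \<zeta> i 2 * a 2 k = int (unitv i k) - int (unitv 0 k)"
      "\<forall>i j. \<bar>\<zeta> i j\<bar> \<le> int K" by (elim exE conjE)
  note \<zeta> = *(1,2)[rule_format] and K = *(3)[rule_format]
  have "hilb (graph_ideal a) s t \<le> card (triples (t + 3 * K * s))" for s t
  proof -
    \<comment> \<open>Points of the second triangle, enlarged by \<open>K s\<close> on each side so that the moved vectors have
      nonnegative coordinates.\<close>
    define \<Psi> where "\<Psi> v k = nat (int s * int (unitv 0 k) + (\<Sum>j\<in>UNIV. (int (v j) - int (K * s)) * int (a j k)))"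
      for v :: "3 \<Rightarrow> nat" and k
    have "pt u w \<in> \<Psi> ` triples (t + 3 * K * s)" if u: "u \<in> triples s" and w: "w \<in> triples t" for u w
    proof -
      define z where "z j = u 0 * \<zeta> 0 j + u 1 * \<zeta> 1 j + u 2 * \<zeta> 2 j" for j
      have zK: "\<bar>z j\<bar> \<le> int (K * s)" for j
      proof -
        have "\<bar>int (u i) * \<zeta> i j\<bar> = int (u i) * \<bar>\<zeta> i j\<bar>" for i by (simp add: abs_mult)
        from this[of 0] this[of 1] this[of 2] have "\<bar>z j\<bar> \<le> int (u 0) * \<bar>\<zeta> 0 j\<bar> + int (u 1) * \<bar>\<zeta> 1 j\<bar> + int (u 2) * \<bar>\<zeta> 2 j\<bar>"
          unfolding z_def by linarith
        also have "\<dots> \<le> int (u 0) * int K + int (u 1) * int K + int (u 2) * int K"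
          by (intro add_mono mult_left_mono K) auto
        also have "\<dots> = int ((u 0 + u 1 + u 2) * K)" by (simp add: algebra_simps)
        also have "(u 0 + u 1 + u 2) * K = K * s" using u by (simp add: triples_iff)
        finally show ?thesis .
      qed
      have z_sum: "z 0 + z 1 + z 2 = 0"
      proof -
        have "z 0 + z 1 + z 2 = int (u 0) * (\<zeta> 0 0 + \<zeta> 0 1 + \<zeta> 0 2) + int (u 1) * (\<zeta> 1 0 + \<zeta> 1 1 + \<zeta> 1 2) +
          int (u 2) * (\<zeta> 2 0 + \<zeta> 2 1 + \<zeta> 2 2)" unfolding z_def by (simp add: algebra_simps)
        then show ?thesis unfolding \<zeta>(1) by simp
      qed
      have z_img: "z 0 * a 0 k + z 1 * a 1 k + z 2 * a 2 k = int (u k) - int s * int (unitv 0 k)" for k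
      proof -
        have "z 0 * a 0 k + z 1 * a 1 k + z 2 * a 2 k =
          int (u 0) * (\<zeta> 0 0 * a 0 k + \<zeta> 0 1 * a 1 k + \<zeta> 0 2 * a 2 k) +
          int (u 1) * (\<zeta> 1 0 * a 0 k + \<zeta> 1 1 * a 1 k + \<zeta> 1 2 * a 2 k) +
          int (u 2) * (\<zeta> 2 0 * a 0 k + \<zeta> 2 1 * a 1 k + \<zeta> 2 2 * a 2 k)"
          unfolding z_def by (simp add: algebra_simps)
        also have "\<dots> = (int (u 0) * int (unitv 0 k) + int (u 1) * int (unitv 1 k) + int (u 2) * int (unitv 2 k)) -
            int (u 0 + u 1 + u 2) * int (unitv 0 k)"
          unfolding \<zeta>(2) by (simp add: algebra_simps)
        also have "int (u 0) * int (unitv 0 k) + int (u 1) * int (unitv 1 k) + int (u 2) * int (unitv 2 k) = int (u k)"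
        proof -
          have "k = 0 \<or> k = 1 \<or> k = 2" using UNIV3 by auto
          then show ?thesis by (auto simp: unitv_def)
        qed
        finally show ?thesis using u by (simp add: triples_iff)
      qed
      define v where "v j = nat (int (w j) + z j + int (K * s))" for j
      have v: "int (v j) = int (w j) + z j + int (K * s)" for j
        using zK[of j] by (simp add: v_def)
      have "int (v 0 + v 1 + v 2) = int (w 0 + w 1 + w 2) + (z 0 + z 1 + z 2) + 3 * int (K * s)"
        by (simp add: v)
      also have "\<dots> = int (t + 3 * K * s)" using w z_sum by (simp add: triples_iff)
      finally have "v \<in> triples (t + 3 * K * s)" unfolding triples_iff by linarith
      moreover have "\<Psi> v = pt u w"
      proof
        fix k
        have "(\<Sum>j\<in>UNIV. (int (v j) - int (K * s)) * int (a j k)) = (\<Sum>j\<in>UNIV. (int (w j) + z j) * int (a j k))"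
          by (simp add: v)
        also have "\<dots> = int (\<Sum>j\<in>UNIV. w j * a j k) + (z 0 * a 0 k + z 1 * a 1 k + z 2 * a 2 k)"
          by (simp add: sum3 distrib_right)
        finally have "int s * int (unitv 0 k) + (\<Sum>j\<in>UNIV. (int (v j) - int (K * s)) * int (a j k)) = int (pt u w k)"
          unfolding z_img by (simp add: pt_def)
        then show "\<Psi> v k = pt u w k" by (simp add: \<Psi>_def)
      qed
      ultimately show ?thesis by force
    qed
    then have "(\<lambda>(u, w). pt u w) ` (triples s \<times> triples t) \<subseteq> \<Psi> ` triples (t + 3 * K * s)" by auto
    then have "hilb (graph_ideal a) s t \<le> card (\<Psi> ` triples (t + 3 * K * s))"
      unfolding hilb_graph by (intro card_mono finite_imageI finite_triples)
    also have "\<dots> \<le> card (triples (t + 3 * K * s))" by (rule card_image_le[OF finite_triples])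
    finally show ?thesis .
  qed
  then show ?thesis by blast
qed

end

section \<open>The multidegree of a monomial Cremona map\<close>

lemma quadratic_le:
  fixes p q b c :: int
  assumes "\<And>k :: nat. k \<ge> 1 \<Longrightarrow> p * int k ^ 2 \<le> q * int k ^ 2 + b * int k + c"
  shows "p \<le> q"
proof (rule ccontr)
  assume "\<not> p \<le> q"
  then have pq: "1 \<le> p - q" by simp
  define k where "k = nat (\<bar>b\<bar> + \<bar>c\<bar> + 1)"
  have k: "int k = \<bar>b\<bar> + \<bar>c\<bar> + 1" "k \<ge> 1" by (simp_all add: k_def)
  have "int k ^ 2 \<le> (p - q) * int k ^ 2" using mult_right_mono[OF pq, of "int k ^ 2"] by simp
  also have "\<dots> \<le> b * int k + c" using assms[OF k(2)] by (simp add: left_diff_distrib)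
  also have "\<dots> \<le> \<bar>b\<bar> * int k + \<bar>c\<bar> * int k"
  proof (rule add_mono)
    show "b * int k \<le> \<bar>b\<bar> * int k" by (intro mult_right_mono) auto
    have "\<bar>c\<bar> * 1 \<le> \<bar>c\<bar> * int k" using k(2) by (intro mult_left_mono) auto
    then show "c \<le> \<bar>c\<bar> * int k" by simp
  qed
  also have "\<dots> = (\<bar>b\<bar> + \<bar>c\<bar>) * int k" by (simp add: distrib_right)
  also have "\<dots> < int k * int k" using k by (intro mult_strict_right_mono) auto
  finally show False by (simp add: power2_eq_square)
qed

lemma abs_combine: "2 * c = h - (q + l) \<Longrightarrow> \<bar>c\<bar> \<le> A \<Longrightarrow> \<bar>l\<bar> \<le> B \<Longrightarrow> \<bar>h - q\<bar> \<le> 2 * A + B"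
  for A B c h l q :: int
  by linarith

lemma card_triples_int: "2 * int (card (triples n)) = (int n + 1) * (int n + 2)"
  using card_triples[of n] by (metis of_nat_1 of_nat_add of_nat_mult of_nat_numeral)

context cremona_matrix
begin

lemma dim_graph: "dimv (graph_ideal a :: 'k::field bipoly set) = 2"
proof (rule antisym)
  show "dimv (graph_ideal a :: 'k bipoly set) \<le> 2" using dim_hyp_graph[where 'k = 'k] by linarith
  show "2 \<le> dimv (graph_ideal a :: 'k bipoly set)"
  proof (rule ccontr)
    assume "\<not> ?thesis"
    then have "growth 1 (\<lambda>k. hilb (graph_ideal a :: 'k bipoly set) (1 * k) (1 * k))"
      by (intro hilb_growth(1) subvariety_graph) auto
    then obtain C where C: "\<And>k. hilb (graph_ideal a :: 'k bipoly set) k k \<le> C * (k + 1)" by (auto simp: growth_def)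
    have "1 * int k ^ 2 \<le> 0 * int k ^ 2 + int (2 * C) * int k + int (2 * C)" for k
    proof -
      have "int k ^ 2 \<le> (int k + 1) * (int k + 2)" by (simp add: power2_eq_square algebra_simps)
      also have "\<dots> = 2 * int (card (triples k))" by (simp only: card_triples_int)
      also have "\<dots> \<le> 2 * int (C * (k + 1))"
        using order_trans[OF hilb_graph_lower' C, of k] of_nat_mono by (metis mult_left_mono zero_le_numeral)
      finally show ?thesis by (simp add: algebra_simps)
    qed
    from quadratic_le[OF this] show False by simp
  qed
qed

text \<open>Along the ray \<open>(s, t)\<close> twice the Hilbert function of the standard cycle is
  \<open>(x s\<^sup>2 + 2 y s t + z t\<^sup>2) k\<^sup>2\<close> up to a linear error.  The bounds on the Hilbert function of the graph
  confine this quadratic form between \<open>(s + d t)\<^sup>2 - 6 d\<^sup>2 t\<^sup>2\<close> and \<open>(s + d t)\<^sup>2\<close>, and between \<open>t\<^sup>2\<close> and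
  \<open>(t + 3 K s)\<^sup>2\<close>.  Letting \<open>s\<close> grow in the first pair determines \<open>x\<close> and \<open>y\<close>, letting \<open>t\<close> grow in
  the second pair determines \<open>z\<close>.\<close>

lemma multidegree_coefficients:
  assumes "chow_class 2 (frag_of (graph_ideal a :: 'k::field bipoly set)) = chow_class 2 (std_cycle x y z)"
  shows "x = 1" "y = int d" "z = 1"
proof -
  let ?H = "\<lambda>s t. int (hilb (graph_ideal a :: 'k bipoly set) s t)"
  have asym: "\<exists>C. \<forall>k. \<bar>2 * ?H (s * k) (t * k) -
      (x * int s ^ 2 + 2 * y * int s * int t + z * int t ^ 2) * int k ^ 2\<bar> \<le> C * (int k + 1)"
    if st: "s \<ge> 1" "t \<ge> 1" for s t
  proof -
    let ?c = "\<lambda>k. cdeg s t (frag_of (graph_ideal a :: 'k bipoly set)) k -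
      cdeg s t (std_cycle x y z :: 'k bipoly set \<Rightarrow>\<^sub>0 int) k"
    obtain C where C: "\<And>k. \<bar>?c k\<bar> \<le> C * (int k + 1)"
      using chow_class_degree[OF st assms] by (auto simp: at_most_linear_def)
    let ?l = "\<lambda>k. x * (3 * int s * int k + 2) + 2 * y * (int s * int k + int t * int k + 1) + z * (3 * int t * int k + 2)"
    let ?L = "\<bar>x\<bar> * (3 * int s + 2) + 2 * \<bar>y\<bar> * (int s + int t + 1) + \<bar>z\<bar> * (3 * int t + 2)"
    have std: "2 * cdeg s t (std_cycle x y z :: 'k bipoly set \<Rightarrow>\<^sub>0 int) k =
        (x * int s ^ 2 + 2 * y * int s * int t + z * int t ^ 2) * int k ^ 2 + ?l k" for k
    proof -
      have "2 * cdeg s t (std_cycle x y z :: 'k bipoly set \<Rightarrow>\<^sub>0 int) k =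
        x * (2 * int (card (triples (s * k)))) + 2 * y * int ((s * k + 1) * (t * k + 1)) +
        z * (2 * int (card (triples (t * k))))"
        by (simp add: std_cycle_def cdeg_add cdeg_frag_cmul cdeg_frag_of hilb_std algebra_simps)
      then show ?thesis unfolding card_triples_int by (simp add: power2_eq_square algebra_simps)
    qed
    have l: "\<bar>?l k\<bar> \<le> ?L * (int k + 1)" for k
    proof -
      have "\<bar>x * (3 * int s * int k + 2)\<bar> \<le> \<bar>x\<bar> * ((3 * int s + 2) * (int k + 1))"
        "\<bar>2 * y * (int s * int k + int t * int k + 1)\<bar> \<le> 2 * \<bar>y\<bar> * ((int s + int t + 1) * (int k + 1))"
        "\<bar>z * (3 * int t * int k + 2)\<bar> \<le> \<bar>z\<bar> * ((3 * int t + 2) * (int k + 1))"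
        unfolding abs_mult by (intro mult_mono; simp add: algebra_simps)+
      then have "\<bar>?l k\<bar> \<le> \<bar>x\<bar> * ((3 * int s + 2) * (int k + 1)) +
        2 * \<bar>y\<bar> * ((int s + int t + 1) * (int k + 1)) + \<bar>z\<bar> * ((3 * int t + 2) * (int k + 1))" by linarith
      then show ?thesis by (simp only: distrib_right mult.assoc)
    qed
    have "\<bar>2 * ?H (s * k) (t * k) - (x * int s ^ 2 + 2 * y * int s * int t + z * int t ^ 2) * int k ^ 2\<bar> \<le>
        (2 * C + ?L) * (int k + 1)" for k
    proof -
      have "2 * ?c k = 2 * ?H (s * k) (t * k) -
          ((x * int s ^ 2 + 2 * y * int s * int t + z * int t ^ 2) * int k ^ 2 + ?l k)"
        unfolding right_diff_distrib std by (simp add: cdeg_frag_of)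
      moreover have "(2 * C + ?L) * (int k + 1) = 2 * (C * (int k + 1)) + ?L * (int k + 1)" by (simp only: distrib_right mult.assoc)
      ultimately show ?thesis using abs_combine[OF _ C[of k] l[of k]] by simp
    qed
    then show ?thesis by blast
  qed
  define Q where "Q s t = x * int s ^ 2 + 2 * y * int s * int t + z * int t ^ 2" for s t
  have lower: "p \<le> Q s t" if st: "s \<ge> 1" "t \<ge> 1" and p: "\<And>k. p * int k ^ 2 \<le> 2 * ?H (s * k) (t * k)" for p s t
  proof -
    obtain C where C: "\<And>k. \<bar>2 * ?H (s * k) (t * k) - Q s t * int k ^ 2\<bar> \<le> C * (int k + 1)"
      using asym[OF st] unfolding Q_def by blast
    have "p * int k ^ 2 \<le> Q s t * int k ^ 2 + C * int k + C" for k
    proof -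
      have "C * (int k + 1) = C * int k + C" by (simp add: distrib_left)
      then show ?thesis using C[of k] p[of k] by linarith
    qed
    then show ?thesis by (rule quadratic_le)
  qed
  have upper: "Q s t \<le> int n ^ 2" if st: "s \<ge> 1" "t \<ge> 1"
    and p: "\<And>k. hilb (graph_ideal a :: 'k bipoly set) (s * k) (t * k) \<le> card (triples (n * k))" for n s t
  proof -
    obtain C where C: "\<And>k. \<bar>2 * ?H (s * k) (t * k) - Q s t * int k ^ 2\<bar> \<le> C * (int k + 1)"
      using asym[OF st] unfolding Q_def by blast
    have "Q s t * int k ^ 2 \<le> int n ^ 2 * int k ^ 2 + (C + 3 * int n + 2) * int k + (C + 3 * int n + 2)" for k
    proof -
      have "2 * ?H (s * k) (t * k) \<le> 2 * int (card (triples (n * k)))" using p[of k] by simp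
      also have "\<dots> = (int n * int k + 1) * (int n * int k + 2)" by (simp add: card_triples_int)
      also have "\<dots> \<le> int n ^ 2 * int k ^ 2 + (3 * int n + 2) * (int k + 1)"
        by (simp add: power2_eq_square algebra_simps)
      finally have "2 * ?H (s * k) (t * k) \<le> int n ^ 2 * int k ^ 2 + (3 * int n + 2) * (int k + 1)" .
      moreover have "(C + 3 * int n + 2) * int k + (C + 3 * int n + 2) = C * (int k + 1) + (3 * int n + 2) * (int k + 1)"
        by (simp add: algebra_simps)
      ultimately show ?thesis using C[of k] by linarith
    qed
    then show ?thesis by (rule quadratic_le)
  qed
  have Q1: "Q s 1 \<le> int (s + d) ^ 2" if "s \<ge> 1" for s
  proof (rule upper)
    show "hilb (graph_ideal a) (s * k) (1 * k) \<le> card (triples ((s + d) * k))" for k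
      using hilb_graph_upper[of "s * k" k] by (simp add: algebra_simps)
  qed (use that in auto)
  have Q2: "int (s + d) ^ 2 - 6 * int d ^ 2 \<le> Q s 1" if "s \<ge> 1" for s
  proof (rule lower)
    fix k
    have "int (card (triples (s * k + k * d))) \<le> int (hilb (graph_ideal a :: 'k bipoly set) (s * k) k + 3 * (k * d) ^ 2)"
      unfolding of_nat_le_iff by (rule hilb_graph_lower)
    then have "int (card (triples (s * k + k * d))) \<le> ?H (s * k) (1 * k) + 3 * int (k * d) ^ 2"
      by simp
    moreover have "int (s + d) ^ 2 * int k ^ 2 \<le> 2 * int (card (triples (s * k + k * d)))"
      unfolding card_triples_int by (simp add: power2_eq_square algebra_simps)
    ultimately show "(int (s + d) ^ 2 - 6 * int d ^ 2) * int k ^ 2 \<le> 2 * ?H (s * k) (1 * k)"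
      by (simp add: left_diff_distrib power_mult_distrib algebra_simps)
  qed (use that in auto)
  have Q3: "int t ^ 2 \<le> Q 1 t" if "t \<ge> 1" for t
  proof (rule lower)
    fix k
    have "int t ^ 2 * int k ^ 2 \<le> 2 * int (card (triples (t * k)))"
      unfolding card_triples_int by (simp add: power2_eq_square algebra_simps)
    moreover have "int (card (triples (t * k))) \<le> ?H (1 * k) (t * k)"
      unfolding of_nat_le_iff by (rule hilb_graph_lower')
    ultimately show "int t ^ 2 * int k ^ 2 \<le> 2 * ?H (1 * k) (t * k)" by linarith
  qed (use that in auto)
  obtain K where K: "\<And>s t. hilb (graph_ideal a :: 'k bipoly set) s t \<le> card (triples (t + 3 * K * s))"
    using hilb_graph_upper' by blast
  have Q4: "Q 1 t \<le> int (t + 3 * K) ^ 2" if "t \<ge> 1" for t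
  proof (rule upper)
    show "hilb (graph_ideal a :: 'k bipoly set) (1 * k) (t * k) \<le> card (triples ((t + 3 * K) * k))" for k
      using K[of "1 * k" "t * k"] by (simp add: algebra_simps)
  qed (use that in auto)
  have "x \<le> 1"
  proof (rule quadratic_le)
    fix k :: nat assume "k \<ge> 1"
    then show "x * int k ^ 2 \<le> 1 * int k ^ 2 + (2 * int d - 2 * y) * int k + (int d ^ 2 - z)"
      using Q1[of k] by (simp add: Q_def power2_eq_square algebra_simps)
  qed
  moreover have "1 \<le> x"
  proof (rule quadratic_le)
    fix k :: nat assume "k \<ge> 1"
    then show "1 * int k ^ 2 \<le> x * int k ^ 2 + (2 * y - 2 * int d) * int k + (z + 5 * int d ^ 2)"
      using Q2[of k] by (simp add: Q_def power2_eq_square algebra_simps)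
  qed
  ultimately show x: "x = 1" by simp
  have lin: "2 * (y - int d) * int s \<le> int d ^ 2 - z \<and> 2 * (int d - y) * int s \<le> z + 5 * int d ^ 2" if "s \<ge> 1" for s
    using Q1[OF that] Q2[OF that] by (simp add: Q_def x power2_eq_square algebra_simps)
  have lin0: "e \<le> 0" if e: "\<And>s :: nat. s \<ge> 1 \<Longrightarrow> 2 * e * int s \<le> c" for e c :: int
  proof (rule ccontr)
    assume "\<not> e \<le> 0"
    then have "1 * (2 * int (nat \<bar>c\<bar> + 1)) \<le> e * (2 * int (nat \<bar>c\<bar> + 1))" by (intro mult_right_mono) auto
    then show False using e[of "nat \<bar>c\<bar> + 1"] by (simp add: algebra_simps)
  qed
  have "y - int d \<le> 0" "int d - y \<le> 0" using lin0 lin by blast+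
  then show "y = int d" by simp
  have "z \<le> 1"
  proof (rule quadratic_le)
    fix k :: nat assume "k \<ge> 1"
    then show "z * int k ^ 2 \<le> 1 * int k ^ 2 + (6 * int K - 2 * y) * int k + (9 * int K ^ 2 - x)"
      using Q4[of k] by (simp add: Q_def power2_eq_square algebra_simps)
  qed
  moreover have "1 \<le> z"
  proof (rule quadratic_le)
    fix k :: nat assume "k \<ge> 1"
    then show "1 * int k ^ 2 \<le> z * int k ^ 2 + (2 * y) * int k + (x)"
      using Q3[of k] by (simp add: Q_def power2_eq_square algebra_simps)
  qed
  ultimately show "z = 1" by simp
qed

lemma graph_chow_class:
  "chow_class 2 (frag_of (graph_ideal a :: 'k::field bipoly set)) = chow_class 2 (std_cycle 1 \<delta> 1) \<longleftrightarrow> \<delta> = int d"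
proof
  assume "\<delta> = int d"
  obtain x y z where "frag_of (graph_ideal a :: 'k bipoly set) - std_cycle x y z \<in> rat_triv"
    using graph_in_std_span[OF dim_graph] unfolding std_span_def by blast
  then have *: "chow_class 2 (frag_of (graph_ideal a :: 'k bipoly set)) = chow_class 2 (std_cycle x y z)"
    by (rule chow_class_eqI)
  show "chow_class 2 (frag_of (graph_ideal a :: 'k bipoly set)) = chow_class 2 (std_cycle 1 \<delta> 1)"
    using * multidegree_coefficients[OF *] \<open>\<delta> = int d\<close> by simp
qed (rule multidegree_coefficients(2))

end

section \<open>Evaluation of polynomials over an infinite field\<close>

text \<open>Over a finite field \<open>1 + \<Prod>(X - a)\<close> has no root.\<close>

lemma infinite_alg_closed: "infinite (UNIV :: 'k::alg_closed_field set)"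
proof
  assume fin: "finite (UNIV :: 'k set)"
  define p where "p = (\<Prod>a\<in>UNIV. [:- a, 1 :: 'k:])"
  have "degree p = (\<Sum>a\<in>(UNIV :: 'k set). degree [:- a, 1:])"
    unfolding p_def by (rule degree_prod_sum_eq) simp
  also have "\<dots> = card (UNIV :: 'k set)" by simp
  finally have deg: "degree p = card (UNIV :: 'k set)" .
  moreover have "card (UNIV :: 'k set) > 0" using fin by (simp add: card_gt_0_iff)
  ultimately have "degree (p + 1) > 0" by (subst degree_add_eq_left) auto
  then obtain x where x: "poly (p + 1) x = 0" using alg_closed_imp_poly_has_root by blast
  have "poly p x = 0" unfolding p_def poly_prod using fin by (rule prod_zero) auto
  then show False using x by simp
qed

lemma ex_power_neq:
  assumes "infinite (UNIV :: 'k::field set)" "p \<noteq> q"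
  obtains x :: "'k::field" where "x \<noteq> 0" "x ^ p \<noteq> x ^ q"
proof -
  have "monom 1 p - monom (1 :: 'k) q \<noteq> 0"
  proof
    assume "monom 1 p - monom (1 :: 'k) q = 0"
    then have "coeff (monom 1 p - monom (1 :: 'k) q) p = 0" by simp
    then show False using assms(2) by simp
  qed
  then have "finite (insert 0 {x. poly (monom 1 p - monom (1 :: 'k) q) x = 0})" by (intro finite.insertI poly_roots_finite)
  then obtain x where "x \<notin> insert 0 {x. poly (monom 1 p - monom (1 :: 'k) q) x = 0}"
    using assms(1) by (metis finite_subset subsetI)
  then show ?thesis using that[of x] by (simp add: poly_monom)
qed

text \<open>Monomials are distinct characters of the torus, so they are linearly independent.\<close>

lemma characters_independent:
  fixes e :: "'a \<Rightarrow> 'v::finite \<Rightarrow> nat" and c :: "'a \<Rightarrow> 'k::field"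
  assumes inf: "infinite (UNIV :: 'k set)" and "finite T" "inj_on e T"
    and "\<And>u. (\<forall>i. u i \<noteq> 0) \<Longrightarrow> (\<Sum>x\<in>T. c x * (\<Prod>i\<in>UNIV. u i ^ e x i)) = 0"
  shows "\<forall>x\<in>T. c x = 0"
  using assms(2-)
proof (induction T arbitrary: c rule: finite_induct)
  case (insert y T)
  let ?\<chi> = "\<lambda>x u. \<Prod>i\<in>UNIV. u i ^ e x i"
  have T: "c x = 0" if x: "x \<in> T" for x
  proof -
    have "e x \<noteq> e y" using insert.prems(1) insert.hyps x by (auto simp: inj_on_def)
    then obtain i where i: "e x i \<noteq> e y i" by blast
    obtain \<tau> :: 'k where \<tau>: "\<tau> \<noteq> 0" "\<tau> ^ e x i \<noteq> \<tau> ^ e y i" using ex_power_neq[OF inf i] by blast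
    define t where "t = (\<lambda>k. if k = i then \<tau> else 1)"
    have t0: "t k \<noteq> 0" for k using \<tau> by (simp add: t_def)
    have \<chi>t: "?\<chi> z t = \<tau> ^ e z i" for z
    proof -
      have "?\<chi> z t = (\<Prod>k\<in>UNIV. if k = i then \<tau> ^ e z k else 1)" by (intro prod.cong) (auto simp: t_def)
      then show ?thesis by simp
    qed
    have "\<forall>x\<in>T. c x * (?\<chi> x t - ?\<chi> y t) = 0"
    proof (rule insert.IH)
      show "inj_on e T" using insert.prems(1) by (simp add: inj_on_def)
      fix u :: "'v \<Rightarrow> 'k" assume u: "\<forall>i. u i \<noteq> 0"
      have mult: "?\<chi> z (\<lambda>k. t k * u k) = ?\<chi> z t * ?\<chi> z u" for z
        by (simp add: power_mult_distrib prod.distrib)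
      have "(\<Sum>x\<in>insert y T. c x * ?\<chi> x (\<lambda>k. t k * u k)) = 0"
        by (rule insert.prems(2)) (use u t0 in simp)
      then have "c y * ?\<chi> y t * ?\<chi> y u + (\<Sum>x\<in>T. c x * ?\<chi> x t * ?\<chi> x u) = 0"
        using insert.hyps by (simp add: mult mult.assoc)
      moreover have "(\<Sum>x\<in>insert y T. c x * ?\<chi> x u) = 0" by (rule insert.prems(2)[OF u])
      then have "c y * ?\<chi> y u + (\<Sum>x\<in>T. c x * ?\<chi> x u) = 0" using insert.hyps by simp
      then have "?\<chi> y t * (c y * ?\<chi> y u + (\<Sum>x\<in>T. c x * ?\<chi> x u)) = 0" by simp
      then have "c y * ?\<chi> y t * ?\<chi> y u + (\<Sum>x\<in>T. ?\<chi> y t * (c x * ?\<chi> x u)) = 0"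
        by (simp add: distrib_left sum_distrib_left mult.commute mult.left_commute)
      ultimately have "c y * ?\<chi> y t * ?\<chi> y u + (\<Sum>x\<in>T. c x * ?\<chi> x t * ?\<chi> x u) =
          c y * ?\<chi> y t * ?\<chi> y u + (\<Sum>x\<in>T. ?\<chi> y t * (c x * ?\<chi> x u))"
        by (simp only:)
      then have "(\<Sum>x\<in>T. c x * ?\<chi> x t * ?\<chi> x u) = (\<Sum>x\<in>T. ?\<chi> y t * (c x * ?\<chi> x u))"
        by (simp only: add_left_cancel)
      then show "(\<Sum>x\<in>T. c x * (?\<chi> x t - ?\<chi> y t) * ?\<chi> x u) = 0"
        by (simp add: right_diff_distrib left_diff_distrib sum_subtractf mult.commute mult.left_commute)
    qed
    then have "c x * (?\<chi> x t - ?\<chi> y t) = 0" using x by blast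
    then show ?thesis using \<tau>(2) unfolding \<chi>t by simp
  qed
  moreover have "c y = 0"
  proof -
    have "(\<Sum>x\<in>insert y T. c x * ?\<chi> x (\<lambda>_. 1)) = 0" by (rule insert.prems(2)) simp
    then show ?thesis using T insert.hyps by simp
  qed
  ultimately show ?case by simp
qed simp

lemma prod_power_swap:
  fixes u :: "'b \<Rightarrow> 'c::comm_semiring_1"
  shows "(\<Prod>v\<in>A. (\<Prod>w\<in>B. u w ^ E v w) ^ m v) = (\<Prod>w\<in>B. u w ^ (\<Sum>v\<in>A. m v * E v w))"
proof -
  have "(\<Prod>v\<in>A. (\<Prod>w\<in>B. u w ^ E v w) ^ m v) = (\<Prod>v\<in>A. \<Prod>w\<in>B. u w ^ (m v * E v w))"
    by (simp add: prod_power_distrib mult.commute flip: power_mult)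
  also have "\<dots> = (\<Prod>w\<in>B. \<Prod>v\<in>A. u w ^ (m v * E v w))" by (rule prod.swap)
  finally show ?thesis by (simp add: power_sum)
qed

interpretation id_hom: scalar_hom "\<lambda>c :: 'k::comm_ring_1. c"
  by unfold_locales auto

lemma peval_lin_ext: "peval f u = lin_ext (\<lambda>c. c) (\<lambda>m. \<Prod>i\<in>UNIV. u i ^ lookup m i) f"
  by (simp add: peval_def lin_ext_def)

lemma peval_add: "peval (f + g) u = peval f u + peval g u"
  by (simp add: peval_lin_ext id_hom.lin_ext_add)

lemma peval_zero [simp]: "peval 0 u = 0"
  by (simp add: peval_def)

lemma peval_diff: "peval (f - g) u = peval f u - peval g u"
  using peval_add[of "f - g" g u] by simp

lemma peval_mult: "peval (f * g) u = peval f u * peval g u"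
  unfolding peval_lin_ext
  by (rule id_hom.lin_ext_mult) (simp add: lookup_add power_add prod.distrib)

lemma peval_single: "peval (single m c) u = c * (\<Prod>i\<in>UNIV. u i ^ lookup m i)"
  by (simp add: peval_lin_ext id_hom.lin_ext_single)

lemma prod_power_single: "(\<Prod>i\<in>UNIV. u i ^ lookup (single (v :: 'v::finite) n) i) = (u v :: 'k::comm_ring_1) ^ n"
proof -
  have "(\<Prod>i\<in>UNIV. u i ^ lookup (single v n) i) = (\<Prod>i\<in>UNIV. if i = v then u i ^ n else 1)"
    by (intro prod.cong) (auto simp: lookup_single when_def)
  then show ?thesis by simp
qed

lemma peval_Var: "peval (Var v) u = u v"
  by (simp add: Var_def peval_single prod_power_single)

lemma peval_eq_0_imp:
  fixes f :: "('v::finite, 'k::field) mpoly"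
  assumes inf: "infinite (UNIV :: 'k set)" and "\<And>u. (\<forall>i. u i \<noteq> 0) \<Longrightarrow> peval f u = 0"
  shows "f = 0"
proof -
  have "\<forall>m\<in>keys f. lookup f m = 0"
    by (rule characters_independent[OF inf, where e = lookup])
      (use assms(2) in \<open>auto simp: peval_def intro!: inj_onI poly_mapping_eqI\<close>)
  then show ?thesis by (intro poly_mapping_eqI) (auto simp: in_keys_iff)
qed

definition mexp :: "('v::finite \<Rightarrow> nat) \<Rightarrow> 'v \<Rightarrow>\<^sub>0 nat" where
  "mexp e = (\<Sum>v\<in>UNIV. single v (e v))"

lemma lookup_mexp [simp]: "lookup (mexp e) v = e v"
proof -
  have "lookup (mexp e) v = (\<Sum>w\<in>UNIV. if w = v then e w else 0)"
    unfolding mexp_def lookup_sum by (intro sum.cong) (auto simp: lookup_single when_def)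
  then show ?thesis by simp
qed

lemma Var_power: "Var v ^ n = single (single v n) 1"
  by (induction n) (simp_all add: Var_def mult_single single_add[symmetric] flip: single_one)

lemma prod_Var: "(\<Prod>v\<in>S. Var v ^ e v) = single (\<Sum>v\<in>S. single v (e v)) 1"
  by (induction S rule: infinite_finite_induct) (simp_all add: Var_power mult_single flip: single_one)

lemma monomial_map_eq: "monomial_map A i = single (mexp (\<lambda>j. A $ i $ j)) 1"
  by (simp add: monomial_map_def prod_Var mexp_def)

lemma pmap_monomial_map: "pmap (monomial_map A) v i = (\<Prod>j\<in>UNIV. v j ^ (A $ i $ j))"
  by (simp add: pmap_def monomial_map_eq peval_single)

section \<open>The graph closure is a toric ideal\<close>

lemma peval_torus:
  "peval f (\<lambda>v. \<Prod>w\<in>UNIV. u w ^ E v w) =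
    lin_ext (\<lambda>c. c) (\<lambda>g. \<Prod>w\<in>UNIV. u w ^ lookup g (var_index w)) (torus_hom {} E f)"
proof (induction f rule: poly_induct)
  case (single m c)
  show ?case by (simp add: prod_power_swap lookup_texp peval_single torus_hom_single id_hom.lin_ext_single)
qed (simp_all add: peval_add torus_hom_add id_hom.lin_ext_add)

lemma gam_subst:
  "(\<lambda>v. \<Prod>w\<in>UNIV. u w ^ gam_exp a v w) =
    case_sum (\<lambda>i. u (Inl i)) (\<lambda>j. u (Inr 0) * (\<Prod>k\<in>UNIV. u (Inl k) ^ a j k))"
proof
  have split: "(\<Prod>w\<in>(UNIV :: (3 + 3) set). F w) = (\<Prod>i\<in>UNIV. F (Inl i)) * (\<Prod>j\<in>UNIV. F (Inr j))" for F :: "3 + 3 \<Rightarrow> 'a"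
    using prod.Plus[of "UNIV :: 3 set" "UNIV :: 3 set" F] by (simp add: UNIV_Plus_UNIV)
  have unit: "(\<Prod>i\<in>UNIV. f i ^ unitv k i) = f k" for f :: "3 \<Rightarrow> 'a" and k
  proof -
    have "(\<Prod>i\<in>UNIV. f i ^ unitv k i) = (\<Prod>i\<in>UNIV. if i = k then f i else 1)"
      by (intro prod.cong) (auto simp: unitv_def)
    then show ?thesis by simp
  qed
  fix v show "(\<Prod>w\<in>UNIV. u w ^ gam_exp a v w) =
    case_sum (\<lambda>i. u (Inl i)) (\<lambda>j. u (Inr 0) * (\<Prod>k\<in>UNIV. u (Inl k) ^ a j k)) v"
    by (cases v) (simp_all add: split gam_exp_def unit mult.commute)
qed

text \<open>A polynomial vanishes on the graph iff its pullback under the parametrization vanishes on the torus,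
  iff the pullback is zero.\<close>

lemma graph_closure_eq:
  fixes A :: "nat^3^3"
  assumes inf: "infinite (UNIV :: 'k::field set)"
  shows "graph_closure (monomial_map A :: 3 \<Rightarrow> (3, 'k) mpoly) = graph_ideal (\<lambda>i j. A $ i $ j)"
proof
  let ?a = "\<lambda>i j. A $ i $ j" and ?F = "monomial_map A :: 3 \<Rightarrow> (3, 'k) mpoly"
  have ev: "peval f (case_sum v (\<lambda>i. c * pmap ?F v i)) =
      lin_ext (\<lambda>c. c) (\<lambda>g. \<Prod>w\<in>UNIV. case_sum v (\<lambda>_. c) w ^ lookup g (var_index w)) (torus_hom {} (gam_exp ?a) f)"
    for f v c
    unfolding peval_torus[symmetric] gam_subst by (simp add: pmap_monomial_map)
  show "graph_ideal ?a \<subseteq> graph_closure ?F"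
    by (auto simp: graph_ideal_def tker_def graph_closure_def ev)
  show "graph_closure ?F \<subseteq> graph_ideal ?a"
  proof
    fix f assume f: "f \<in> graph_closure ?F"
    let ?t = "torus_hom {} (gam_exp ?a) f"
    have "\<forall>g\<in>keys ?t. lookup ?t g = 0"
    proof (rule characters_independent[OF inf, where e = "\<lambda>g w. lookup g (var_index w)"])
      show "inj_on (\<lambda>g (w :: 3 + 3). lookup g (var_index w)) (keys ?t)"
      proof (intro inj_onI poly_mapping_eqI)
        fix g h k assume gh: "g \<in> keys ?t" "h \<in> keys ?t" "(\<lambda>w :: 3 + 3. lookup g (var_index w)) = (\<lambda>w. lookup h (var_index w))"
        have "lookup x k = 0" if x: "x \<in> keys ?t" and k: "k \<notin> range var_index" for x
        proof -
          have "x \<in> texp (gam_exp ?a) ` {m \<in> keys f. avoids {} m}" using x keys_torus_hom by blast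
          then obtain m where "x = texp (gam_exp ?a) m" by (elim imageE)
          then show ?thesis using lookup_texp_out[OF k] by simp
        qed
        then show "lookup g k = lookup h k"
          using gh by (cases "k \<in> range var_index") (auto dest: fun_cong)
      qed
      fix u :: "3 + 3 \<Rightarrow> 'k" assume u: "\<forall>i. u i \<noteq> 0"
      let ?v = "\<lambda>i. u (Inl i)" and ?c = "u (Inr 0)"
      have "?v \<noteq> (\<lambda>_. 0)" using u by (metis (full_types))
      moreover have "pmap ?F ?v 0 \<noteq> 0" using u by (simp add: pmap_monomial_map)
      then have "pmap ?F ?v \<noteq> (\<lambda>_. 0)" by metis
      ultimately have "peval f (case_sum ?v (\<lambda>i. ?c * pmap ?F ?v i)) = 0"
        using f u by (auto simp: graph_closure_def)
      moreover have "case_sum ?v (\<lambda>i. ?c * pmap ?F ?v i) = (\<lambda>v. \<Prod>w\<in>UNIV. u w ^ gam_exp ?a v w)"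
        unfolding gam_subst by (simp add: pmap_monomial_map)
      ultimately show "(\<Sum>g\<in>keys ?t. lookup ?t g * (\<Prod>w\<in>UNIV. u w ^ lookup g (var_index w))) = 0"
        by (simp add: peval_torus lin_ext_def)
    qed simp
    then have "?t = 0" by (intro poly_mapping_eqI) (auto simp: in_keys_iff)
    then show "f \<in> graph_ideal ?a" by (simp add: graph_ideal_def tker_def)
  qed
qed

section \<open>Birationality and unimodularity\<close>

lemma rational_map_monomial:
  assumes "\<And>i. (\<Sum>j\<in>UNIV. A $ i $ j) = d"
  shows "rational_map (monomial_map A)"
  using assms by (auto simp: rational_map_def homog_def monomial_map_eq single_eq_0)

lemma unimodular_if_inverse:
  fixes r11 r12 r21 r22 p1 p2 q1 q2 :: int
  assumes "p1 * r11 + p2 * r21 = 1" "p1 * r12 + p2 * r22 = 0" "q1 * r11 + q2 * r21 = 0" "q1 * r12 + q2 * r22 = 1"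
  shows "\<bar>r11 * r22 - r12 * r21\<bar> = 1"
proof -
  have "(r11 * r22 - r12 * r21) * (p1 * q2 - p2 * q1) =
    (p1 * r11 + p2 * r21) * (q1 * r12 + q2 * r22) - (p1 * r12 + p2 * r22) * (q1 * r11 + q2 * r21)"
    by (simp add: algebra_simps)
  then have "(r11 * r22 - r12 * r21) * (p1 * q2 - p2 * q1) = 1" using assms by simp
  then have "\<bar>(r11 * r22 - r12 * r21) * (p1 * q2 - p2 * q1)\<bar> = 1" by simp
  then show ?thesis by (rule abs_zmult_eq_1)
qed

text \<open>If \<open>G\<close> inverts \<open>F\<close>, then comparing monomials in \<open>G\<^sub>0(F) x\<^sub>j = G\<^sub>j(F) x\<^sub>0\<close> writes
  \<open>e\<^sub>j - e\<^sub>0\<close> as an integer combination of the rows with coefficient sum zero.\<close>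

lemma cremona_lattice:
  fixes A :: "nat^3^3"
  assumes inf: "infinite (UNIV :: 'k::field set)" and crem: "cremona (monomial_map A :: 3 \<Rightarrow> (3, 'k) mpoly)"
  shows "\<exists>w :: 3 \<Rightarrow> int. w 0 + w 1 + w 2 = 0 \<and>
    (\<forall>k. w 0 * A $ 0 $ k + w 1 * A $ 1 $ k + w 2 * A $ 2 $ k = int (unitv j k) - int (unitv 0 k))"
proof -
  let ?F = "monomial_map A :: 3 \<Rightarrow> (3, 'k) mpoly"
  obtain G h e where G: "\<And>i. homog e (G i)" and h: "h \<noteq> 0"
    and inv: "\<And>v. peval h v \<noteq> 0 \<Longrightarrow> \<exists>c. c \<noteq> 0 \<and> pmap G (pmap ?F v) = (\<lambda>i. c * v i)"
    using crem unfolding cremona_def rational_left_inverse_def rational_map_def by blast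
  define sh :: "(3 \<Rightarrow>\<^sub>0 nat) \<Rightarrow> 3 \<Rightarrow>\<^sub>0 nat" where "sh n = mexp (\<lambda>k. \<Sum>i\<in>UNIV. lookup n i * A $ i $ k)" for n
  define cp :: "(3, 'k) mpoly \<Rightarrow> (3, 'k) mpoly" where "cp = lin_ext (single 0) (\<lambda>n. single (sh n) 1)"
  have ev: "peval (cp g) v = peval g (pmap ?F v)" for g v
  proof (induction g rule: poly_induct)
    case (single n c)
    show ?case by (simp add: pmap_monomial_map prod_power_swap sh_def cp_def const_hom.lin_ext_single mult_single peval_single)
  qed (simp_all add: cp_def const_hom.lin_ext_add peval_add)
  have keys_cp: "keys (cp g) \<subseteq> sh ` keys g" for g
  proof -
    have "keys (cp g) \<subseteq> (\<Union>n\<in>keys g. keys (single 0 (lookup g n) * single (sh n) 1))"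
      unfolding cp_def lin_ext_def by (rule keys_sum)
    then show ?thesis by (force simp: mult_single split: if_splits)
  qed
  have "h * (Var j * cp (G 0) - Var 0 * cp (G j)) = 0"
  proof (rule peval_eq_0_imp[OF inf])
    fix u :: "3 \<Rightarrow> 'k"
    show "peval (h * (Var j * cp (G 0) - Var 0 * cp (G j))) u = 0"
    proof (cases "peval h u = 0")
      case False
      then obtain c where "pmap G (pmap ?F u) = (\<lambda>i. c * u i)" using inv by blast
      then have "peval (G i) (pmap ?F u) = c * u i" for i by (metis pmap_def)
      then show ?thesis by (simp add: peval_mult peval_diff peval_Var ev)
    qed (simp add: peval_mult)
  qed
  then have eq: "Var j * cp (G 0) = Var 0 * cp (G j)" using h by simp
  obtain u where u: "\<forall>i. u i \<noteq> 0" "peval h u \<noteq> 0" using peval_eq_0_imp[OF inf] h by blast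
  obtain c where c: "c \<noteq> 0" "pmap G (pmap ?F u) = (\<lambda>i. c * u i)" using inv[OF u(2)] by blast
  have "peval (cp (G 0)) u = c * u 0" using fun_cong[OF c(2), of 0] unfolding ev by (simp add: pmap_def)
  then have "peval (cp (G 0)) u \<noteq> 0" using c(1) u(1) by simp
  then have "cp (G 0) \<noteq> 0" by auto
  then obtain \<kappa> where \<kappa>: "\<kappa> \<in> keys (cp (G 0))" using keys_eq_empty by (metis all_not_in_conv poly_mapping_eqI in_keys_iff lookup_zero)
  have "lookup (Var j * cp (G 0)) (single j 1 + \<kappa>) = 1 * lookup (cp (G 0)) \<kappa>"
    unfolding Var_def by (rule lookup_single_mult)
  then have "single j 1 + \<kappa> \<in> keys (Var 0 * cp (G j))" using \<kappa> by (simp add: in_keys_iff flip: eq)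
  then obtain \<kappa>' where \<kappa>': "\<kappa>' \<in> keys (cp (G j))" "single j 1 + \<kappa> = single 0 1 + \<kappa>'"
    unfolding Var_def using keys_single_mult by blast
  obtain n where n: "n \<in> keys (G 0)" "\<kappa> = sh n" using keys_cp \<kappa> by blast
  obtain n' where n': "n' \<in> keys (G j)" "\<kappa>' = sh n'" using keys_cp \<kappa>' by blast
  define w where "w i = int (lookup n' i) - int (lookup n i)" for i
  have "(\<Sum>i\<in>UNIV. lookup n i) = e" "(\<Sum>i\<in>UNIV. lookup n' i) = e" using G n(1) n'(1) by (auto simp: homog_def)
  then have "w 0 + w 1 + w 2 = 0" unfolding sum3 w_def by linarith
  moreover have "w 0 * A $ 0 $ k + w 1 * A $ 1 $ k + w 2 * A $ 2 $ k = int (unitv j k) - int (unitv 0 k)" for k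
  proof -
    have "lookup (single j 1 + \<kappa>) k = lookup (single 0 1 + \<kappa>') k" using \<kappa>'(2) by simp
    then have "unitv j k + (\<Sum>i\<in>UNIV. lookup n i * A $ i $ k) = unitv 0 k + (\<Sum>i\<in>UNIV. lookup n' i * A $ i $ k)"
      by (auto simp: lookup_add lookup_single when_def n n' sh_def unitv_def)
    then have "int (unitv j k + (\<Sum>i\<in>UNIV. lookup n i * A $ i $ k)) = int (unitv 0 k + (\<Sum>i\<in>UNIV. lookup n' i * A $ i $ k))"
      by simp
    then show ?thesis by (simp add: sum3 w_def algebra_simps)
  qed
  ultimately show ?thesis by blast
qed

lemma unimodular_if_lattice:
  fixes a :: "3 \<Rightarrow> 3 \<Rightarrow> nat" and w :: "3 \<Rightarrow> 3 \<Rightarrow> int"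
  assumes w: "\<And>j. w j 0 + w j 1 + w j 2 = 0"
    "\<And>j k. w j 0 * a 0 k + w j 1 * a 1 k + w j 2 * a 2 k = int (unitv j k) - int (unitv 0 k)"
  shows "\<bar>(int (a 1 1) - int (a 0 1)) * (int (a 2 2) - int (a 0 2)) -
      (int (a 1 2) - int (a 0 2)) * (int (a 2 1) - int (a 0 1))\<bar> = 1"
proof -
  have *: "w j 1 * (int (a 1 k) - int (a 0 k)) + w j 2 * (int (a 2 k) - int (a 0 k)) = int (unitv j k) - int (unitv 0 k)" for j k
  proof -
    have w0: "w j 0 = - w j 1 - w j 2" using w(1)[of j] by linarith
    show ?thesis using w(2)[of j k] unfolding w0 by (simp add: algebra_simps)
  qed
  show ?thesis
    by (rule unimodular_if_inverse[of "w 1 1" _ "w 1 2" _ _ _ "w 2 1" "w 2 2"])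
      (simp_all add: * unitv_def)
qed

lemma proportional_powers:
  fixes v :: "3 \<Rightarrow> 'k::field"
  assumes v: "\<And>i. v i \<noteq> 0" and e: "\<And>i k. e i k + unitv 0 k = f k + unitv i k"
  shows "\<exists>c. c \<noteq> 0 \<and> (\<lambda>i. \<Prod>k\<in>UNIV. v k ^ e i k) = (\<lambda>i. c * v i)"
proof (intro exI conjI)
  let ?c = "(\<Prod>k\<in>UNIV. v k ^ f k) / v 0"
  show "?c \<noteq> 0" using v by simp
  have unit: "(\<Prod>k\<in>UNIV. v k ^ unitv i k) = v i" for i
  proof -
    have "(\<Prod>k\<in>UNIV. v k ^ unitv i k) = (\<Prod>k\<in>UNIV. if k = i then v k else 1)"
      by (intro prod.cong) (auto simp: unitv_def)
    then show ?thesis by simp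
  qed
  show "(\<lambda>i. \<Prod>k\<in>UNIV. v k ^ e i k) = (\<lambda>i. ?c * v i)"
  proof
    fix i
    have "(\<Prod>k\<in>UNIV. v k ^ e i k) * v 0 = (\<Prod>k\<in>UNIV. v k ^ (e i k + unitv 0 k))"
      by (simp add: power_add prod.distrib unit)
    also have "\<dots> = (\<Prod>k\<in>UNIV. v k ^ f k) * v i" unfolding e by (simp add: power_add prod.distrib unit)
    finally show "(\<Prod>k\<in>UNIV. v k ^ e i k) = ?c * v i" using v by (simp add: field_simps)
  qed
qed

lemma pmap_comp:
  "pmap (monomial_map B) (pmap (monomial_map A) v) = (\<lambda>i. \<Prod>k\<in>UNIV. v k ^ (\<Sum>j\<in>UNIV. B $ i $ j * A $ j $ k))"
  by (rule ext) (simp add: pmap_monomial_map prod_power_swap)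

lemma monomial_left_inverse:
  fixes A B :: "nat^3^3"
  assumes "\<And>i k. (\<Sum>j\<in>UNIV. B $ i $ j * A $ j $ k) + unitv 0 k = f k + unitv i k"
  shows "rational_left_inverse (monomial_map B) (monomial_map A :: 3 \<Rightarrow> (3, 'k::field) mpoly)"
  unfolding rational_left_inverse_def
proof (intro exI[of _ "single (mexp (\<lambda>_. 1)) 1"] conjI allI impI)
  show "single (mexp (\<lambda>_. 1)) 1 \<noteq> (0 :: (3, 'k) mpoly)" by (simp add: single_eq_0)
  fix v :: "3 \<Rightarrow> 'k" assume "peval (single (mexp (\<lambda>_. 1)) 1) v \<noteq> 0"
  then have "v i \<noteq> 0" for i by (simp add: peval_single)
  from proportional_powers[OF this assms]
  show "\<exists>c. c \<noteq> 0 \<and> pmap (monomial_map B) (pmap (monomial_map A) v) = (\<lambda>i. c * v i)"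
    by (simp add: pmap_comp)
qed

text \<open>The inverse is monomial: its rows are integer preimages of \<open>e\<^sub>i - e\<^sub>0\<close>, shifted by a constant \<open>N\<close> to make
  the exponents nonnegative.  The shift multiplies all three monomials by the same factor.\<close>

lemma cremona_if_unimodular:
  fixes A :: "nat^3^3"
  assumes "cremona_matrix (\<lambda>i j. A $ i $ j) d"
  shows "cremona (monomial_map A :: 3 \<Rightarrow> (3, 'k::field) mpoly)"
proof -
  interpret cremona_matrix "\<lambda>i j. A $ i $ j" d by (rule assms)
  from lattice_preimages obtain \<omega> :: "3 \<Rightarrow> 3 \<Rightarrow> int" and N :: nat
    where *: "\<forall>j. \<omega> j 0 + \<omega> j 1 + \<omega> j 2 = 0"
      "\<forall>j k. \<omega> j 0 * A $ 0 $ k + \<omega> j 1 * A $ 1 $ k + \<omega> j 2 * A $ 2 $ k = int (unitv j k) - int (unitv 0 k)"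
      "\<forall>i j. \<bar>\<omega> i j\<bar> \<le> int N" by (elim exE conjE)
  note \<omega> = *(1,2)[rule_format] and N = *(3)[rule_format]
  define B :: "nat^3^3" where "B = (\<chi> i j. nat (int N + \<omega> i j))"
  have B: "int (B $ i $ j) = int N + \<omega> i j" for i j using N[of i j] by (simp add: B_def)
  have "(\<Sum>j\<in>UNIV. B $ i $ j) = 3 * N" for i
  proof -
    have "int (\<Sum>j\<in>UNIV. B $ i $ j) = int (3 * N)" using \<omega>(1)[of i] by (simp add: sum3 B)
    then show ?thesis by (simp only: of_nat_eq_iff)
  qed
  then have ratB: "rational_map (monomial_map B :: 3 \<Rightarrow> (3, 'k) mpoly)" by (rule rational_map_monomial)
  have ratA: "rational_map (monomial_map A :: 3 \<Rightarrow> (3, 'k) mpoly)" using rows by (rule rational_map_monomial)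
  have "rational_left_inverse (monomial_map B) (monomial_map A :: 3 \<Rightarrow> (3, 'k) mpoly)"
  proof (rule monomial_left_inverse)
    fix i k
    have "int ((\<Sum>j\<in>UNIV. B $ i $ j * A $ j $ k) + unitv 0 k) =
        int N * (\<Sum>j\<in>UNIV. int (A $ j $ k)) + (\<omega> i 0 * A $ 0 $ k + \<omega> i 1 * A $ 1 $ k + \<omega> i 2 * A $ 2 $ k) + int (unitv 0 k)"
      by (simp add: sum3 B algebra_simps)
    also have "\<dots> = int (N * (\<Sum>j\<in>UNIV. A $ j $ k) + unitv i k)" unfolding \<omega>(2) by simp
    finally show "(\<Sum>j\<in>UNIV. B $ i $ j * A $ j $ k) + unitv 0 k = N * (\<Sum>j\<in>UNIV. A $ j $ k) + unitv i k"
      by (simp only: of_nat_eq_iff)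
  qed
  moreover have "rational_left_inverse (monomial_map A) (monomial_map B :: 3 \<Rightarrow> (3, 'k) mpoly)"
  proof (rule monomial_left_inverse)
    fix i k
    define z where "z j = (\<Sum>l\<in>UNIV. (int (A $ i $ l) - int (A $ 0 $ l)) * \<omega> l j) - (int (unitv i j) - int (unitv 0 j))" for j
    have rr: "(int (A $ i $ 0) - int (A $ 0 $ 0)) + (int (A $ i $ 1) - int (A $ 0 $ 1)) + (int (A $ i $ 2) - int (A $ 0 $ 2)) = 0"
      using rows3[of i] rows3[of 0] by linarith
    have i: "i = 0 \<or> i = 1 \<or> i = 2" using UNIV3 by auto
    have "z k = 0"
    proof (rule lattice_injective)
      have "z 0 + z 1 + z 2 = (\<Sum>l\<in>UNIV. (int (A $ i $ l) - int (A $ 0 $ l)) * (\<omega> l 0 + \<omega> l 1 + \<omega> l 2))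
        - ((int (unitv i 0) + int (unitv i 1) + int (unitv i 2)) - (int (unitv 0 0) + int (unitv 0 1) + int (unitv 0 2)))"
        by (simp add: z_def sum3 algebra_simps)
      then show "z 0 + z 1 + z 2 = 0" unfolding \<omega>(1) using i by (auto simp: unitv_def)
      fix k
      have "z 0 * A $ 0 $ k + z 1 * A $ 1 $ k + z 2 * A $ 2 $ k =
        (\<Sum>l\<in>UNIV. (int (A $ i $ l) - int (A $ 0 $ l)) * (\<omega> l 0 * A $ 0 $ k + \<omega> l 1 * A $ 1 $ k + \<omega> l 2 * A $ 2 $ k))
        - (int (unitv i 0) * A $ 0 $ k + int (unitv i 1) * A $ 1 $ k + int (unitv i 2) * A $ 2 $ k)
        + (int (unitv 0 0) * A $ 0 $ k + int (unitv 0 1) * A $ 1 $ k + int (unitv 0 2) * A $ 2 $ k)"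
        by (simp add: z_def sum3 algebra_simps)
      also have "\<dots> = (\<Sum>l\<in>UNIV. (int (A $ i $ l) - int (A $ 0 $ l)) * (int (unitv l k) - int (unitv 0 k)))
        - int (A $ i $ k) + int (A $ 0 $ k)"
        unfolding \<omega>(2) using i by (auto simp: unitv_def)
      also have "\<dots> = - int (unitv 0 k) * ((int (A $ i $ 0) - int (A $ 0 $ 0)) + (int (A $ i $ 1) - int (A $ 0 $ 1)) + (int (A $ i $ 2) - int (A $ 0 $ 2)))"
      proof -
        have "k = 0 \<or> k = 1 \<or> k = 2" using UNIV3 by auto
        then show ?thesis by (auto simp: sum3 unitv_def)
      qed
      also have "\<dots> = 0" unfolding rr by simp
      finally show "z 0 * A $ 0 $ k + z 1 * A $ 1 $ k + z 2 * A $ 2 $ k = 0" .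
    qed
    then have z: "(\<Sum>l\<in>UNIV. int (A $ i $ l) * \<omega> l k) + int (unitv 0 k) = (\<Sum>l\<in>UNIV. int (A $ 0 $ l) * \<omega> l k) + int (unitv i k)"
      by (simp add: z_def left_diff_distrib sum_subtractf)
    have AB: "int (\<Sum>l\<in>UNIV. A $ i $ l * B $ l $ k) = int N * int d + (\<Sum>l\<in>UNIV. int (A $ i $ l) * \<omega> l k)" for i
      using rows3[of i, symmetric] by (simp add: sum3 B algebra_simps)
    have "int ((\<Sum>l\<in>UNIV. A $ i $ l * B $ l $ k) + unitv 0 k) = int ((\<Sum>l\<in>UNIV. A $ 0 $ l * B $ l $ k) + unitv i k)"
      unfolding of_nat_add AB using z by linarith
    then show "(\<Sum>l\<in>UNIV. A $ i $ l * B $ l $ k) + unitv 0 k = (\<Sum>l\<in>UNIV. A $ 0 $ l * B $ l $ k) + unitv i k"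
      by (simp only: of_nat_eq_iff)
  qed
  ultimately show ?thesis unfolding cremona_def using ratA ratB by blast
qed

lemma cremona_iff_unimodular:
  fixes A :: "nat^3^3"
  assumes inf: "infinite (UNIV :: 'k::field set)" and rows: "\<And>i. (\<Sum>j\<in>UNIV. A $ i $ j) = d" and cols: "\<And>j. \<exists>i. A $ i $ j = 0"
  shows "cremona (monomial_map A :: 3 \<Rightarrow> (3, 'k) mpoly) \<longleftrightarrow> cremona_matrix (\<lambda>i j. A $ i $ j) d"
proof
  assume "cremona (monomial_map A :: 3 \<Rightarrow> (3, 'k) mpoly)"
  from cremona_lattice[OF inf this] obtain w :: "3 \<Rightarrow> 3 \<Rightarrow> int" where "\<And>j. w j 0 + w j 1 + w j 2 = 0"
    "\<And>j k. w j 0 * A $ 0 $ k + w j 1 * A $ 1 $ k + w j 2 * A $ 2 $ k = int (unitv j k) - int (unitv 0 k)" by metis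
  from unimodular_if_lattice[OF this] show "cremona_matrix (\<lambda>i j. A $ i $ j) d"
    using rows cols by unfold_locales auto
qed (rule cremona_if_unimodular)

theorem monomial_cremona_matrices_eq:
  "monomial_cremona_matrices TYPE('k::alg_closed_field) (1, int \<delta>, 1) = {A. cremona_matrix (\<lambda>i j. A $ i $ j) \<delta>}"
proof -
  note inf = infinite_alg_closed[where 'k = 'k]
  have multidegree: "has_multidegree (monomial_map A :: 3 \<Rightarrow> (3, 'k) mpoly) (1, int \<delta>, 1) \<longleftrightarrow> d = \<delta>"
    if "cremona_matrix (\<lambda>i j. A $ i $ j) d" for A and d
    using cremona_matrix.graph_chow_class[OF that, of "int \<delta>", where 'k = 'k]
    by (auto simp: has_multidegree_def graph_closure_eq[OF inf] std_cycle_def)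
  show ?thesis
  proof (intro equalityI subsetI)
    fix A assume "A \<in> monomial_cremona_matrices TYPE('k) (1, int \<delta>, 1)"
    then have A: "exponent_matrix A" "cremona (monomial_map A :: 3 \<Rightarrow> (3, 'k) mpoly)"
      "has_multidegree (monomial_map A :: 3 \<Rightarrow> (3, 'k) mpoly) (1, int \<delta>, 1)"
      by (auto simp: monomial_cremona_matrices_def)
    then obtain d where "\<And>i. (\<Sum>j\<in>UNIV. A $ i $ j) = d" "\<And>j. \<exists>i. A $ i $ j = 0" by (auto simp: exponent_matrix_def)
    then have cm: "cremona_matrix (\<lambda>i j. A $ i $ j) d" using cremona_iff_unimodular[OF inf] A(2) by blast
    then show "A \<in> {A. cremona_matrix (\<lambda>i j. A $ i $ j) \<delta>}" using multidegree[OF cm] A(3) by simp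
  next
    fix A :: "nat^3^3" assume "A \<in> {A. cremona_matrix (\<lambda>i j. A $ i $ j) \<delta>}"
    then have cm: "cremona_matrix (\<lambda>i j. A $ i $ j) \<delta>" by simp
    then have "exponent_matrix A"
      unfolding exponent_matrix_def using cremona_matrix.rows[OF cm] cremona_matrix.cols[OF cm] by blast
    then show "A \<in> monomial_cremona_matrices TYPE('k) (1, int \<delta>, 1)"
      using cremona_if_unimodular[OF cm] multidegree[OF cm] by (simp add: monomial_cremona_matrices_def)
  qed
qed

section \<open>Counting the matrices\<close>

lemma cases3: "(k :: 3) = 0 \<or> k = 1 \<or> k = 2"
  using UNIV3 by auto

text \<open>Surjectivity on the vectors of coordinate sum zero does not depend on the order of rows and columns.\<close>

lemma cremona_matrix_permute:
  assumes cm: "cremona_matrix a d" and p: "p permutes UNIV" and q: "q permutes UNIV"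
  shows "cremona_matrix (\<lambda>i j. a (p i) (q j)) d"
proof -
  interpret cremona_matrix a d by (rule cm)
  have sum_p: "(\<Sum>i\<in>UNIV. f (p i)) = (\<Sum>i\<in>UNIV. f i)" for f :: "3 \<Rightarrow> int"
    using sum.permute[OF p, of f] by (simp add: o_def)
  have sum_q: "(\<Sum>i\<in>UNIV. f (q i)) = (\<Sum>i\<in>UNIV. f i)" for f :: "3 \<Rightarrow> nat"
    using sum.permute[OF q, of f] by (simp add: o_def)
  have "\<exists>w :: 3 \<Rightarrow> int. w 0 + w 1 + w 2 = 0 \<and> (\<forall>k. w 0 * a (p 0) (q k) + w 1 * a (p 1) (q k) + w 2 * a (p 2) (q k) =
      int (unitv j k) - int (unitv 0 k))" for j
  proof -
    let ?u = "\<lambda>k. int (unitv (q j) k) - int (unitv (q 0) k)"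
    have "?u 0 + ?u 1 + ?u 2 = 0" using cases3[of "q j"] cases3[of "q 0"] by (auto simp: unitv_def)
    then obtain w :: "3 \<Rightarrow> int" where w: "w 0 + w 1 + w 2 = 0" "\<And>k. w 0 * a 0 k + w 1 * a 1 k + w 2 * a 2 k = ?u k"
      using lattice_surjective[of ?u] by metis
    have "(\<Sum>i\<in>UNIV. w (p i)) = 0" unfolding sum_p by (simp add: sum3 w(1))
    moreover have "(\<Sum>i\<in>UNIV. w (p i) * a (p i) (q k)) = ?u (q k)" for k
      unfolding sum_p[of "\<lambda>i. w i * a i (q k)"] by (simp add: sum3 w(2))
    moreover have "?u (q k) = int (unitv j k) - int (unitv 0 k)" for k
      using permutes_inj[OF q] by (simp add: unitv_def inj_eq)
    ultimately show ?thesis by (intro exI[of _ "\<lambda>i. w (p i)"]) (simp add: sum3)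
  qed
  then obtain w :: "3 \<Rightarrow> 3 \<Rightarrow> int" where "\<And>j. w j 0 + w j 1 + w j 2 = 0"
    "\<And>j k. w j 0 * a (p 0) (q k) + w j 1 * a (p 1) (q k) + w j 2 * a (p 2) (q k) = int (unitv j k) - int (unitv 0 k)"
    by metis
  from unimodular_if_lattice[of w "\<lambda>i j. a (p i) (q j)", OF this] show ?thesis
  proof unfold_locales
    show "(\<Sum>k\<in>UNIV. a (p j) (q k)) = d" for j unfolding sum_q by (rule rows)
    show "\<exists>j. a (p j) (q k) = 0" for k
      using cols[of "q k"] permutes_surj[OF p] by (metis surj_def)
  qed auto
qed

text \<open>If the zeros of the three columns lie in three different rows and no row contains two zeros,
  then the determinant, which is \<open>\<plusminus>d\<close>, is up to sign a sum of two positive products that exceeds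
  \<open>d\<close>.\<close>

lemma row_with_two_zeros:
  assumes cm: "cremona_matrix a d" and d: "d \<ge> 3"
  shows "\<exists>i k. \<forall>l. l \<noteq> k \<longrightarrow> a i l = 0"
proof -
  interpret cremona_matrix a d by (rule cm)
  obtain f where f: "\<And>j. a (f j) j = 0" using cols by metis
  have third: "\<exists>k. \<forall>l. l \<noteq> k \<longrightarrow> a i l = 0" if jl: "a i j = 0" "a i l = 0" "j \<noteq> l" for i j l
  proof -
    have "\<exists>k. \<forall>m. m \<noteq> k \<longrightarrow> m = j \<or> m = l"
    proof -
      have "card (UNIV - {j, l}) = 1" using jl(3) by (simp add: card_Diff_subset)
      then obtain k where "UNIV - {j, l} = {k}" by (rule card_1_singletonE)
      then show ?thesis by blast
    qed
    then obtain k where "\<And>m. m \<noteq> k \<Longrightarrow> m = j \<or> m = l" by blast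
    then show ?thesis using jl by (intro exI[of _ k]) blast
  qed
  show ?thesis
  proof (cases "inj f")
    case False
    then obtain j l where "f j = f l" "j \<noteq> l" by (auto simp: inj_def)
    then show ?thesis using third[of "f j" j l] f by metis
  next
    case True
    then have "bij f" by (simp add: bij_def finite_UNIV_inj_surj)
    then have "f permutes UNIV" by (rule bij_imp_permutes) simp
    then interpret B: cremona_matrix "\<lambda>i j. a (f i) j" d
      using cremona_matrix_permute[OF cm _ permutes_id] by simp
    define x y c e g h where "x = int (a (f 0) 1)" and "y = int (a (f 0) 2)" and "c = int (a (f 1) 0)"
      and "e = int (a (f 1) 2)" and "g = int (a (f 2) 0)" and "h = int (a (f 2) 1)"
    note defs = x_def y_def c_def e_def g_def h_def
    have sums: "x + y = int d" "c + e = int d" "g + h = int d"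
      using B.rows3[of 0] B.rows3[of 1] B.rows3[of 2] f[of 0] f[of 1] f[of 2] unfolding defs by linarith+
    have nonneg: "x \<ge> 0" "y \<ge> 0" "c \<ge> 0" "e \<ge> 0" "g \<ge> 0" "h \<ge> 0" by (simp_all add: defs)
    define D where "D = x * e + y * h - e * h"
    have D: "\<bar>D\<bar> = 1"
      using B.unimodular f[of 1] f[of 2] unfolding D_def defs by (simp add: algebra_simps)
    have "x * e * g + y * c * h = int d * (x * e + y * h) - e * h * (x + y)"
    proof -
      have gc: "g = int d - h" "c = int d - e" using sums by simp_all
      show ?thesis unfolding gc by (simp add: algebra_simps)
    qed
    then have det: "x * e * g + y * c * h = int d * D" unfolding sums D_def by (simp add: algebra_simps)
    have "int d * D \<ge> 0" unfolding det[symmetric] using nonneg by simp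
    then have "D = 1" using D d by (cases "D = 1") (auto simp: zero_le_mult_iff abs_if split: if_splits)
    with det have det1: "x * e * g + y * c * h = x + y" using sums by simp
    have "x = 0 \<or> y = 0 \<or> c = 0 \<or> e = 0 \<or> g = 0 \<or> h = 0"
    proof (rule ccontr)
      assume "\<not> ?thesis"
      then have pos: "x \<ge> 1" "y \<ge> 1" "c \<ge> 1" "e \<ge> 1" "g \<ge> 1" "h \<ge> 1" using nonneg by auto
      have eg: "e * g \<ge> e" "c * h \<ge> c" using pos by (simp_all add: mult_le_cancel_left1)
      have "x * (e * g) \<ge> x * e" "y * (c * h) \<ge> y * c" using pos eg by (intro mult_left_mono; simp)+
      moreover have "x * e \<ge> x" "y * c \<ge> y" using pos by (simp_all add: mult_le_cancel_left1)
      moreover have "x * (e * g) + y * (c * h) = x + y" using det1 by (simp only: mult.assoc)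
      ultimately have "x * e = x" "y * c = y" by linarith+
      then have "e = 1" "c = 1" using pos by simp_all
      then show False using sums d by simp
    qed
    then show ?thesis
    proof (elim disjE)
      assume "x = 0" then show ?thesis using third[of "f 0" 0 1] f[of 0] by (auto simp: defs)
    next
      assume "y = 0" then show ?thesis using third[of "f 0" 0 2] f[of 0] by (auto simp: defs)
    next
      assume "c = 0" then show ?thesis using third[of "f 1" 1 0] f[of 1] by (auto simp: defs)
    next
      assume "e = 0" then show ?thesis using third[of "f 1" 1 2] f[of 1] by (auto simp: defs)
    next
      assume "g = 0" then show ?thesis using third[of "f 2" 2 0] f[of 2] by (auto simp: defs)
    next
      assume "h = 0" then show ?thesis using third[of "f 2" 2 1] f[of 2] by (auto simp: defs)
    qed
  qed
qed

definition inverse_mod :: "nat \<Rightarrow> nat \<Rightarrow> nat" where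
  "inverse_mod d p = (THE s. 0 < s \<and> s < d \<and> [p * s = 1] (mod d))"

lemma inverse_mod_eqI:
  assumes s: "0 < s" "s < d" "[p * s = 1] (mod d)"
  shows "inverse_mod d p = s"
  unfolding inverse_mod_def
proof (rule the_equality)
  show "0 < s \<and> s < d \<and> [p * s = 1] (mod d)" using s by blast
  fix t assume t: "0 < t \<and> t < d \<and> [p * t = 1] (mod d)"
  have "coprime p d" using s(3) by (metis cong_imp_coprime cong_sym coprime_1_left coprime_mult_left_iff)
  moreover have "[p * t = p * s] (mod d)" using t s(3) cong_sym cong_trans by blast
  ultimately have "[t = s] (mod d)" by (simp add: cong_mult_lcancel_nat)
  then show "t = s" using t s by (simp add: cong_def)
qed

lemma inverse_mod:
  assumes "coprime p d" "d \<ge> 2"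
  shows "0 < inverse_mod d p" "inverse_mod d p < d" "[p * inverse_mod d p = 1] (mod d)"
proof -
  obtain x where x: "[p * x = 1] (mod d)" using cong_solve_coprime_nat[OF assms(1)] by auto
  have *: "[p * (x mod d) = 1] (mod d)" using x by (simp add: cong_def mod_mult_right_eq)
  have "x mod d \<noteq> 0"
  proof
    assume "x mod d = 0"
    then have "[0 = 1] (mod d)" using * by simp
    then show False using assms(2) by (simp add: cong_def)
  qed
  then have eq: "inverse_mod d p = x mod d" using * assms(2) by (intro inverse_mod_eqI) auto
  show "0 < inverse_mod d p" "inverse_mod d p < d" "[p * inverse_mod d p = 1] (mod d)"
    unfolding eq using * \<open>x mod d \<noteq> 0\<close> assms(2) by auto
qed

text \<open>Here \<open>p s - a d = 1\<close>, which is unimodularity with a fixed sign.\<close>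

definition normal_matrix :: "nat \<Rightarrow> nat \<Rightarrow> 3 \<Rightarrow> 3 \<Rightarrow> nat" where
  "normal_matrix d p = (let s = inverse_mod d p; a = (p * s - 1) div d in
     triple (triple 0 0 d) (triple a (s - a) (d - s)) (triple p (d - p) 0))"

lemma normal_matrix_entries:
  assumes "p \<in> totatives d" "d \<ge> 3"
  obtains s a where "0 < s" "s < d" "0 < p" "p < d" "a < s" "p * s = a * d + 1"
    "normal_matrix d p = triple (triple 0 0 d) (triple a (s - a) (d - s)) (triple p (d - p) 0)"
proof -
  have p: "0 < p" "p \<le> d" "coprime p d" using assms by (auto simp: totatives_def)
  have "p \<noteq> d" using p assms(2) by auto
  then have pd: "p < d" using p by simp
  define s where "s = inverse_mod d p"
  have s: "0 < s" "s < d" "[p * s = 1] (mod d)"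
    using inverse_mod[OF p(3)] assms(2) by (simp_all add: s_def)
  define a where "a = (p * s - 1) div d"
  have "d dvd p * s - 1" using s(3) p(1) s(1) by (metis cong_altdef_nat cong_sym One_nat_def Suc_leI nat_0_less_mult_iff)
  then have "a * d = p * s - 1" by (simp add: a_def)
  moreover have "p * s \<ge> 1" using p(1) s(1) by (metis One_nat_def Suc_leI nat_0_less_mult_iff)
  ultimately have eq: "p * s = a * d + 1" by simp
  have "a * d < s * d"
  proof -
    have "a * d < p * s" using eq by simp
    also have "\<dots> \<le> d * s" using pd by simp
    finally show ?thesis by (simp add: mult.commute)
  qed
  then have "a < s" by simp
  then show ?thesis using that s p pd eq by (simp add: normal_matrix_def Let_def s_def a_def)
qed

lemma cremona_normal_matrix:
  assumes "p \<in> totatives d" "d \<ge> 3"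
  shows "cremona_matrix (normal_matrix d p) d"
proof -
  obtain s a where sa: "0 < s" "s < d" "0 < p" "p < d" "a < s" "p * s = a * d + 1"
    and eq: "normal_matrix d p = triple (triple 0 0 d) (triple a (s - a) (d - s)) (triple p (d - p) 0)"
    using normal_matrix_entries[OF assms] by blast
  show ?thesis
  proof
    show "(\<Sum>k\<in>UNIV. normal_matrix d p j k) = d" for j
      using cases3[of j] sa by (auto simp: eq sum3)
    show "\<exists>j. normal_matrix d p j k = 0" for k
    proof (cases "k = 2")
      case True
      then show ?thesis by (intro exI[of _ 2]) (simp add: eq)
    next
      case False
      then show ?thesis using cases3[of k] by (intro exI[of _ 0]) (auto simp: eq)
    qed
    have "int p * int s = int a * int d + 1" using sa(6) by (metis of_nat_1 of_nat_add of_nat_mult)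
    then have "(int (s - a) - 0) * (0 - int d) - (int (d - s) - int d) * (int (d - p) - 0) = - 1"
      using sa by (simp add: of_nat_diff algebra_simps)
    then show "\<bar>(int (normal_matrix d p 1 1) - int (normal_matrix d p 0 1)) *
        (int (normal_matrix d p 2 2) - int (normal_matrix d p 0 2)) -
        (int (normal_matrix d p 1 2) - int (normal_matrix d p 0 2)) *
        (int (normal_matrix d p 2 1) - int (normal_matrix d p 0 1))\<bar> = 1"
      by (simp add: eq)
  qed
qed

text \<open>Exchanging the first two columns changes the sign of \<open>p s - a d\<close>.\<close>

lemma normal_form_exists:
  assumes cm: "cremona_matrix a d" and d: "d \<ge> 3"
  shows "\<exists>p q m. p permutes UNIV \<and> q permutes UNIV \<and> m \<in> totatives d \<and> (\<forall>i j. a (p i) (q j) = normal_matrix d m i j)"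
proof -
  obtain i k where ik: "\<And>l. l \<noteq> k \<Longrightarrow> a i l = 0" using row_with_two_zeros[OF cm d] by blast
  let ?p = "transpose 0 i" and ?q = "transpose 2 k"
  have pq: "?p permutes UNIV" "?q permutes UNIV" by (simp_all add: permutes_swap_id)
  define b where "b i j = a (?p i) (?q j)" for i j
  interpret b: cremona_matrix b d unfolding b_def by (rule cremona_matrix_permute[OF cm pq])
  have b0: "b 0 l = 0" if "l \<noteq> 2" for l
  proof -
    have "?q l \<noteq> k" using that by (metis transpose_apply_second transpose_involutory)
    then show ?thesis by (simp add: b_def ik)
  qed
  have b02: "b 0 2 = d" using b.rows3[of 0] b0[of 0] b0[of 1] by simp
  obtain r where r: "b r 2 = 0" using b.cols by blast
  have "r \<noteq> 0" using r b02 d by auto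
  let ?p' = "transpose 2 r"
  have p': "?p' permutes UNIV" by (simp add: permutes_swap_id)
  have p'0: "?p' 0 = 0" using \<open>r \<noteq> 0\<close> by (simp add: transpose_def)
  define c where "c i j = b (?p' i) j" for i j
  interpret c: cremona_matrix c d unfolding c_def
    using cremona_matrix_permute[OF b.cremona_matrix_axioms p' permutes_id] by simp
  have c: "c 0 0 = 0" "c 0 1 = 0" "c 0 2 = d" "c 2 2 = 0"
    using b0[of 0] b0[of 1] b02 r by (simp_all add: c_def p'0)
  have rows: "c 1 0 + c 1 1 + c 1 2 = d" "c 2 0 + c 2 1 = d" using c.rows3[of 1] c.rows3[of 2] c(4) by simp_all
  let ?s = "c 1 0 + c 1 1"
  have "\<exists>q. q permutes (UNIV :: 3 set) \<and> q 2 = 2 \<and> int (c 2 (q 0)) * int ?s - int (c 1 (q 0)) * int d = 1"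
  proof -
    have "int (c 1 1) * (- int d) - (int (c 1 2) - int d) * int (c 2 1) = int ?s * int (c 2 1) - int (c 1 1) * int d"
    proof -
      have e: "int (c 1 2) - int d = - int ?s" using rows(1) by linarith
      show ?thesis unfolding e by (simp add: algebra_simps)
    qed
    then have D: "\<bar>int ?s * int (c 2 1) - int (c 1 1) * int d\<bar> = 1" using c.unimodular c by simp
    have c20: "int (c 2 0) = int d - int (c 2 1)" using rows(2) by linarith
    have E: "int (c 2 0) * int ?s - int (c 1 0) * int d = - (int ?s * int (c 2 1) - int (c 1 1) * int d)"
      unfolding c20 by (simp add: algebra_simps)
    show ?thesis
    proof (cases "int ?s * int (c 2 1) - int (c 1 1) * int d = 1")
      case True
      then show ?thesis
        by (intro exI[of _ "transpose 0 1"]) (simp add: permutes_swap_id mult.commute transpose_def)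
    next
      case False
      then have "int (c 2 0) * int ?s - int (c 1 0) * int d = 1" using D E by linarith
      then show ?thesis by (intro exI[of _ id]) (simp add: permutes_id)
    qed
  qed
  then obtain q where q: "q permutes UNIV" "q 2 = 2" "int (c 2 (q 0)) * int ?s - int (c 1 (q 0)) * int d = 1" by blast
  have q01: "q 0 = 0 \<and> q 1 = 1 \<or> q 0 = 1 \<and> q 1 = 0"
    using cases3[of "q 0"] cases3[of "q 1"] q(2) permutes_inj[OF q(1)] by (metis distinct3 inj_eq)
  define m e s where "m = c 2 (q 0)" and "e = c 1 (q 0)" and "s = ?s"
  have q3: "int (m * s) = int (e * d + 1)" using q(3) unfolding m_def e_def s_def by simp
  then have eq: "m * s = e * d + 1" by (simp only: of_nat_eq_iff)
  have bounds: "m \<le> d" "s \<le> d" "e \<le> s" using rows q01 by (auto simp: m_def e_def s_def)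
  have no: "x * d = y * d + 1 \<Longrightarrow> False" for x y
  proof -
    assume h: "x * d = y * d + 1"
    then have "d dvd 1" by (metis dvd_add_right_iff dvd_triv_right)
    then show False using d by simp
  qed
  have "m \<noteq> d" using no[of s e] eq by (auto simp: mult.commute)
  have "s \<noteq> d" using no[of m e] eq by auto
  have pos: "m > 0" "s > 0" using eq by (auto intro: Nat.gr0I)
  have "coprime m d"
  proof (rule coprimeI)
    fix x assume "x dvd m" "x dvd d"
    then have "x dvd e * d + 1" "x dvd e * d" unfolding eq[symmetric] by auto
    then show "is_unit x" by (metis dvd_add_right_iff)
  qed
  then have tot: "m \<in> totatives d" using pos bounds by (simp add: totatives_def)
  have "inverse_mod d m = s"
  proof (rule inverse_mod_eqI)
    show "[m * s = 1] (mod d)" unfolding eq cong_def by (rule mod_mult_self3)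
  qed (use pos bounds \<open>s \<noteq> d\<close> in auto)
  moreover have "(m * s - 1) div d = e" using eq d by simp
  ultimately have nm: "normal_matrix d m = triple (triple 0 0 d) (triple e (s - e) (d - s)) (triple m (d - m) 0)"
    by (simp add: normal_matrix_def Let_def)
  have entries: "c i (q j) = normal_matrix d m i j" for i j
  proof -
    have "c 0 (q j) = triple 0 0 d j" using cases3[of j] q(2) q01 c by auto
    moreover have "c 1 (q j) = triple e (s - e) (d - s) j"
      using cases3[of j] q(2) q01 rows by (auto simp: e_def s_def)
    moreover have "c 2 (q j) = triple m (d - m) 0 j"
      using cases3[of j] q(2) q01 rows c(4) by (auto simp: m_def)
    ultimately show ?thesis using cases3[of i] by (auto simp: nm)
  qed
  have "a ((?p \<circ> ?p') i) ((?q \<circ> q) j) = normal_matrix d m i j" for i j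
    using entries[of i j] by (simp add: c_def b_def)
  moreover have "(?p \<circ> ?p') permutes UNIV" "(?q \<circ> q) permutes UNIV"
    using pq p' q(1) by (simp_all add: permutes_compose)
  ultimately show ?thesis using tot by blast
qed

text \<open>A permutation between two normal matrices fixes the only row with two zeros and hence, through the
  last column, all rows.  It cannot exchange the first two columns, because that changes the sign of
  the determinant.\<close>

lemma normal_form_unique:
  assumes m: "m \<in> totatives d" and n: "n \<in> totatives d" and d: "d \<ge> 3"
    and p: "p permutes UNIV" and q: "q permutes UNIV"
    and eq: "\<And>i j. normal_matrix d n i j = normal_matrix d m (p i) (q j)"
  shows "m = n"
proof -
  obtain s a where sa: "0 < s" "s < d" "0 < m" "m < d" "a < s" "m * s = a * d + 1"
    and M: "normal_matrix d m = triple (triple 0 0 d) (triple a (s - a) (d - s)) (triple m (d - m) 0)"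
    using normal_matrix_entries[OF m d] by blast
  obtain t b where tb: "0 < t" "t < d" "0 < n" "n < d" "b < t" "n * t = b * d + 1"
    and N: "normal_matrix d n = triple (triple 0 0 d) (triple b (t - b) (d - t)) (triple n (d - n) 0)"
    using normal_matrix_entries[OF n d] by blast
  note e = eq[unfolded M N]
  have injp: "p x = p y \<Longrightarrow> x = y" and injq: "q x = q y \<Longrightarrow> x = y" for x y
    using permutes_inj[OF p] permutes_inj[OF q] by (auto dest: injD)
  have q01: "q 0 \<noteq> q 1" using injq[of 0 1] by auto
  have p0: "p 0 = 0"
  proof (rule ccontr)
    assume "p 0 \<noteq> 0"
    then have "p 0 = 1 \<or> p 0 = 2" using cases3[of "p 0"] by auto
    then show False
      using e[of 0 0] e[of 0 1] q01 cases3[of "q 0"] cases3[of "q 1"] sa by auto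
  qed
  have q2: "q 2 = 2" using e[of 0 2] p0 cases3[of "q 2"] d by auto
  have p2: "p 2 = 2"
  proof -
    have "p 2 \<noteq> 0" using injp[of 2 0] p0 by auto
    moreover have "p 2 \<noteq> 1" using e[of 2 2] q2 sa by auto
    ultimately show ?thesis using cases3[of "p 2"] by auto
  qed
  have p1: "p 1 = 1" using injp[of 1 0] injp[of 1 2] p0 p2 cases3[of "p 1"] by auto
  have "q 0 \<noteq> 2" using injq[of 0 2] q2 by auto
  then have "q 0 = 0 \<or> q 0 = 1" using cases3[of "q 0"] by auto
  then show ?thesis
  proof
    assume "q 0 = 0"
    then show ?thesis using e[of 2 0] p2 by simp
  next
    assume q0: "q 0 = 1"
    have "t = s" using e[of 1 2] p1 q2 sa tb by simp
    moreover have "n = d - m" using e[of 2 0] p2 q0 by simp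
    moreover have "b = s - a" using e[of 1 0] p1 q0 by simp
    ultimately have "(d - m) * s = (s - a) * d + 1" using tb(6) by simp
    then have "int ((d - m) * s) = int ((s - a) * d + 1)" by simp
    then have "(int d - int m) * int s = (int s - int a) * int d + 1"
      using sa by (simp add: of_nat_diff)
    moreover have "int m * int s = int a * int d + 1" using sa(6) by (metis of_nat_1 of_nat_add of_nat_mult)
    ultimately show ?thesis by (simp add: algebra_simps)
  qed
qed

lemma equiv_row_column: "equiv UNIV row_column_permutation"
proof (rule equivI)
  show "refl row_column_permutation"
    by (auto simp: refl_on_def row_column_permutation_def intro!: exI[of _ id] permutes_id)
  show "sym row_column_permutation"
  proof (rule symI)
    fix A B :: "nat^3^3" assume "(A, B) \<in> row_column_permutation"
    then obtain p q where pq: "p permutes UNIV" "q permutes UNIV" "\<And>i j. B $ i $ j = A $ p i $ q j"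
      by (auto simp: row_column_permutation_def)
    have "A $ i $ j = B $ (inv_into UNIV p i) $ (inv_into UNIV q j)" for i j
      using pq by (simp add: permutes_inverses)
    then show "(B, A) \<in> row_column_permutation"
      using permutes_inv[OF pq(1)] permutes_inv[OF pq(2)] by (auto simp: row_column_permutation_def)
  qed
  show "trans row_column_permutation"
  proof (rule transI)
    fix A B C :: "nat^3^3" assume "(A, B) \<in> row_column_permutation" "(B, C) \<in> row_column_permutation"
    then obtain p q p' q' where *: "p permutes UNIV" "q permutes UNIV" "\<And>i j. B $ i $ j = A $ p i $ q j"
      "p' permutes UNIV" "q' permutes UNIV" "\<And>i j. C $ i $ j = B $ p' i $ q' j"
      by (auto simp: row_column_permutation_def)
    have "C $ i $ j = A $ (p \<circ> p') i $ (q \<circ> q') j" for i j using * by simp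
    moreover have "(p \<circ> p') permutes UNIV" "(q \<circ> q') permutes UNIV" using * by (simp_all add: permutes_compose)
    ultimately show "(A, C) \<in> row_column_permutation" unfolding row_column_permutation_def by blast
  qed
qed auto

theorem mainTheorem2:
  fixes \<delta> :: nat
  assumes "\<delta> \<ge> 3"
  shows "card (monomial_cremona_matrices TYPE('k::alg_closed_field) (1, int \<delta>, 1)
           // row_column_permutation) = totient \<delta>"
proof -
  let ?R = "row_column_permutation" and ?S = "{A. cremona_matrix (\<lambda>i j. A $ i $ j) \<delta>} :: (nat^3^3) set"
  define N :: "nat \<Rightarrow> nat^3^3" where "N m = (\<chi> i j. normal_matrix \<delta> m i j)" for m
  have N: "N m $ i $ j = normal_matrix \<delta> m i j" for m i j by (simp add: N_def)
  have N_in: "N m \<in> ?S" if "m \<in> totatives \<delta>" for m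
  proof -
    have "(\<lambda>i j. N m $ i $ j) = normal_matrix \<delta> m" by (intro ext) (simp add: N)
    then show ?thesis using cremona_normal_matrix[OF that assms] by simp
  qed
  have ex: "\<exists>m\<in>totatives \<delta>. (A, N m) \<in> ?R" if "A \<in> ?S" for A
    using normal_form_exists[of "\<lambda>i j. A $ i $ j" \<delta>] that assms
    by (simp add: row_column_permutation_def N) metis
  have cls: "?R `` {A} = ?R `` {B} \<longleftrightarrow> (A, B) \<in> ?R" for A B
    using eq_equiv_class_iff[OF equiv_row_column] by simp
  have "?S // ?R = (\<lambda>m. ?R `` {N m}) ` totatives \<delta>"
  proof
    show "?S // ?R \<subseteq> (\<lambda>m. ?R `` {N m}) ` totatives \<delta>"
    proof
      fix X assume "X \<in> ?S // ?R"
      then obtain A where A: "A \<in> ?S" "X = ?R `` {A}" by (rule quotientE)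
      obtain m where m: "m \<in> totatives \<delta>" "(A, N m) \<in> ?R" using ex[OF A(1)] by blast
      then have "X = ?R `` {N m}" using A(2) cls by simp
      then show "X \<in> (\<lambda>m. ?R `` {N m}) ` totatives \<delta>" using m(1) by blast
    qed
    show "(\<lambda>m. ?R `` {N m}) ` totatives \<delta> \<subseteq> ?S // ?R"
      using N_in by (auto intro!: quotientI)
  qed
  moreover have "inj_on (\<lambda>m. ?R `` {N m}) (totatives \<delta>)"
  proof (rule inj_onI)
    fix m n assume mn: "m \<in> totatives \<delta>" "n \<in> totatives \<delta>" "?R `` {N m} = ?R `` {N n}"
    then have "(N m, N n) \<in> ?R" using cls by blast
    then obtain p q where "p permutes UNIV" "q permutes UNIV" "\<And>i j. normal_matrix \<delta> n i j = normal_matrix \<delta> m (p i) (q j)"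
      by (auto simp: row_column_permutation_def N)
    then show "m = n" using normal_form_unique[OF mn(1,2) assms] by blast
  qed
  ultimately have "card (?S // ?R) = card (totatives \<delta>)" by (simp add: card_image)
  then show ?thesis by (simp add: monomial_cremona_matrices_eq totient_def)
qed

end
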